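(* Let $k \ge 1$ and $r \ge 2$ be integers and let $\varepsilon > 0$. There exists $C > 0$ such that, for all $p = p(n)$ satisfying $p \ge C(\log n/n)^{1/k}$ and $p \gg (\log n)^2/n$, with high probability the random graph $G_{n,p}$ has the following property: for every maximum $r$-cut $(V_1,\dotsc,V_r)$ of $G_{n,p}$, every set $W$ of $k$ vertices, and every $i \in \{1,\dotsc,r\}$, the number of vertices of $V_i$ that are adjacent to all vertices of $W$ lies in the interval $\left[(1/r-\varepsilon)np^k, (1/r+\varepsilon)np^k\right]$.
   Context: An $r$-cut in a graph $G$ is a partition of its vertex set into $r$ subsets; its size is the number of edges of $G$ with endpoints in different parts. A maximum $r$-cut of $G$ is an $r$-cut of the largest size among all $r$-cuts of $G$. $G_{n,p}$ is the binomial random graph on $n$ vertices in which each pair of vertices is an edge independently with probability $p$. "With high probability" means with probability tending to $1$ as $n\to\infty$; $f \gg g$ means $g/f \to 0$ as $n\to\infty$. *)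

theory Defs
  imports "HOL-Probability.Probability" "HOL-Probability.Product_PMF"
begin

text \<open>
  A finite simple graph is given by a vertex set \<open>X\<close> and a set \<open>E\<close> of edges, each edge being
  a two-element subset of \<open>X\<close>; in particular \<open>{v, w} \<in> E\<close> is adjacency, and it fails for \<open>v = w\<close>.
\<close>

definition all_pairs :: "'a set \<Rightarrow> 'a set set" where
  "all_pairs X = {e. e \<subseteq> X \<and> card e = 2}"

text \<open>
  The edge set of the binomial random graph on \<open>{..<n}\<close>. The library's \<open>bernoulli_pmf\<close>
  clamps its parameter to the unit interval, so this is only meaningful for \<open>0 \<le> p \<le> 1\<close>.
\<close>

definition gnp :: "nat \<Rightarrow> real \<Rightarrow> nat set set pmf" where
  "gnp n p = map_pmf (\<lambda>b. {e \<in> all_pairs {..<n}. b e})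
     (Pi_pmf (all_pairs {..<n}) False (\<lambda>_. bernoulli_pmf p))"

text \<open>
  An \<open>r\<close>-cut is an ordered tuple \<open>V 1, \<dots>, V r\<close>; parts may be empty, and the values of \<open>V\<close>
  outside \<open>{1..r}\<close> play no role.
\<close>

definition is_cut :: "nat \<Rightarrow> 'a set \<Rightarrow> (nat \<Rightarrow> 'a set) \<Rightarrow> bool" where
  "is_cut r X V \<longleftrightarrow> disjoint_family_on V {1..r} \<and> (\<Union>i\<in>{1..r}. V i) = X"

definition cut_size :: "nat \<Rightarrow> 'a set set \<Rightarrow> (nat \<Rightarrow> 'a set) \<Rightarrow> nat" where
  "cut_size r E V =
     card {e \<in> E. \<exists>i\<in>{1..r}. \<exists>j\<in>{1..r}. i \<noteq> j \<and> (\<exists>u\<in>V i. \<exists>v\<in>V j. e = {u, v})}"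

definition is_max_cut :: "nat \<Rightarrow> 'a set \<Rightarrow> 'a set set \<Rightarrow> (nat \<Rightarrow> 'a set) \<Rightarrow> bool" where
  "is_max_cut r X E V \<longleftrightarrow>
     is_cut r X V \<and> (\<forall>V'. is_cut r X V' \<longrightarrow> cut_size r E V' \<le> cut_size r E V)"

end

theory Submission
  imports Defs
begin

text \<open>
Write \<open>q = sqrt (n p)\<close>. An \<open>r\<close>-cut is encoded as a colouring of the vertices with \<open>r\<close> colours, and a
colouring is called \<open>D\<close>-near-maximum if it cuts at most \<open>D\<close> edges fewer than a maximum cut.

The core is a rigidity statement (\<open>prob_not_rigid\<close>): if \<open>p\<close> is bounded away from 1 and \<open>D\<close> is small
compared with \<open>q\<close>, then with high probability there are sets \<open>Q 1, \<dots>, Q r\<close> of at most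
\<open>(1/r + \<beta>) n\<close> vertices each such that every class of every \<open>D\<close>-near-maximum colouring lies inside
one of them. Its proof is a reversibility argument for a pair of vertices \<open>u, v\<close>. Let the gap of
\<open>u, v\<close> be the maximum size of a cut separating them minus the maximum size of a cut that does not.
Exchanging the edge status of \<open>{u, j}\<close> and \<open>{v, j}\<close> preserves the law of the random graph, does not
change the second maximum, and changes the first by at most one. In a maximum cut separating
\<open>u\<close> and \<open>v\<close>, the number of \<open>j\<close> whose exchange raises the gap and the number of \<open>j\<close> whose exchange
can lower it differ by the local slack of \<open>u\<close> and \<open>v\<close>; averaged over all pairs this slack is \<open>O(q)\<close>,
because its main terms cancel by antisymmetry (\<open>sum_slack\<close>). Balancing the probability flow between
the events \<open>gap = t\<close> and \<open>gap = t + 1\<close> (\<open>flow\<close>) shows that the distribution of the gap, weighted by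
the number of raising exchanges, is nearly nondecreasing on the nonnegative integers. The total
weight is at most \<open>O(n p) = O(q\<^sup>2)\<close> and there are \<open>q\<close> levels to share it, so each level has weight
\<open>O(q)\<close> and the levels up to \<open>D\<close> have weight \<open>O(D q)\<close> (\<open>expected_small_gaps\<close>), whereas for typical
pairs the number of raising exchanges has order \<open>q\<^sup>2\<close>. Hence only \<open>o(n\<^sup>2)\<close> pairs separated by a fixed
maximum cut have gap at most \<open>D\<close>; all other separated pairs are separated by every
\<open>D\<close>-near-maximum colouring, and rigidity follows since all classes have about \<open>n/r\<close> vertices.

To deduce the theorem, fix a set \<open>W\<close> of \<open>k\<close> vertices and let \<open>s\<close> be a large multiple of \<open>log n\<close>. If a
part of a maximum cut contains \<open>m\<close> common neighbours of \<open>W\<close>, then it contains \<open>m choose s\<close> sets \<open>S\<close>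
of size \<open>s\<close> that are completely joined to \<open>W\<close>. By the planting identity (\<open>bin_exp_plant\<close>) the
expected number of such \<open>S\<close> is \<open>p\<^bsup>k s\<^esup>\<close> times the expected number of sets \<open>S\<close> that lie in a part of a
maximum cut of the graph \<open>G\<close> augmented by all edges between \<open>W\<close> and \<open>S\<close>. Augmenting by different sets \<open>S\<close>
changes the size of any cut by at most \<open>k s\<close>, so all these parts are classes of \<open>2 k s\<close>-near-maximum
colourings of one rigid graph; hence there are at most \<open>r\<close> times \<open>(1/r + \<beta>) n choose s\<close> such sets
(\<open>prob_unbalanced\<close>). If \<open>m > (1/r + 2 \<beta>) n p\<^sup>k\<close>, comparing the two counts gives a probability that is
exponentially small in \<open>s\<close> and beats the \<open>n\<^sup>k\<close> choices of \<open>W\<close>. The hypothesis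
\<open>n p \<gg> (log n)\<^sup>2\<close> is what makes \<open>k s\<close> small compared with \<open>q\<close>, and \<open>n p\<^sup>k \<ge> C log n\<close> makes \<open>s\<close> small compared
with \<open>m\<close>. The lower bound follows from the upper bounds for the other parts, as \<open>W\<close> has about \<open>n p\<^sup>k\<close>
common neighbours. For \<open>p\<close> close to 1 rigidity is not used: the parts have about
\<open>n/r\<close> vertices, which is close to \<open>n p\<^sup>k / r\<close>.
\<close>


section \<open>Random subsets of a finite set\<close>

text \<open>
The expectation of \<open>f\<close> over a random subset of the finite set \<open>A\<close> that contains each element
independently with probability \<open>p\<close>. Probabilities are written as expectations of \<open>of_bool\<close>.
\<close>

definition bin_exp :: "'a set \<Rightarrow> real \<Rightarrow> ('a set \<Rightarrow> real) \<Rightarrow> real" where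
  "bin_exp A p f = (\<Sum>E\<in>Pow A. p ^ card E * (1 - p) ^ card (A - E) * f E)"

lemma finite_all_pairs: "finite X \<Longrightarrow> finite (all_pairs X)"
  by (rule finite_subset[of _ "Pow X"]) (auto simp: all_pairs_def)

lemma prob_gnp:
  assumes p: "0 \<le> p" "p \<le> 1"
  shows "measure_pmf.prob (gnp n p) S = bin_exp (all_pairs {..<n}) p (indicator S)"
proof -
  define A where "A = all_pairs {..<n}"
  have fin: "finite A" unfolding A_def by (simp add: finite_all_pairs)
  define P where "P = Pi_pmf A False (\<lambda>_. bernoulli_pmf p)"
  have g: "gnp n p = map_pmf (\<lambda>b. {e \<in> A. b e}) P" unfolding gnp_def A_def P_def ..
  have sub: "set_pmf (gnp n p) \<subseteq> Pow A" unfolding g by auto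
  have pm: "pmf (gnp n p) E = p ^ card E * (1 - p) ^ card (A - E)" if E: "E \<subseteq> A" for E
  proof -
    have "pmf (gnp n p) E = measure_pmf.prob P ((\<lambda>b. {e \<in> A. b e}) -` {E})"
      unfolding g pmf_map ..
    also have "\<dots> = measure_pmf.prob P {\<lambda>e. e \<in> E}"
    proof (rule measure_prob_cong_0)
      fix b assume b: "b \<in> (\<lambda>b. {e \<in> A. b e}) -` {E} - {\<lambda>e. e \<in> E}"
      then obtain e where "e \<notin> A" "b e"
        using E by (auto simp: fun_eq_iff)
      then show "pmf P b = 0" unfolding P_def using fin by (auto simp: pmf_Pi)
    qed (use E in auto)
    also have "\<dots> = (\<Prod>e\<in>A. pmf (bernoulli_pmf p) (e \<in> E))"
      unfolding P_def using fin E by (auto simp: measure_pmf_single pmf_Pi)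
    also have "\<dots> = (\<Prod>e\<in>A. if e \<in> E then p else 1 - p)"
      using p by (intro prod.cong) auto
    also have "\<dots> = p ^ card E * (1 - p) ^ card (A - E)"
      using fin E by (simp add: prod.If_cases Int_absorb1 Diff_eq)
    finally show ?thesis .
  qed
  have "measure_pmf.prob (gnp n p) S = measure_pmf.prob (gnp n p) (S \<inter> Pow A)"
    by (rule measure_prob_cong_0) (use sub in \<open>auto simp: set_pmf_eq\<close>)
  also have "\<dots> = (\<Sum>E\<in>S \<inter> Pow A. pmf (gnp n p) E)"
    using fin by (simp add: measure_measure_pmf_finite)
  also have "\<dots> = (\<Sum>E\<in>Pow A. pmf (gnp n p) E * indicator S E)"
    using fin by (intro sum.mono_neutral_cong_left) (auto simp: indicator_def)
  also have "\<dots> = bin_exp A p (indicator S)"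
    unfolding bin_exp_def by (intro sum.cong) (auto simp: pm)
  finally show ?thesis unfolding A_def .
qed

lemma bin_exp_mono:
  assumes "0 \<le> p" "p \<le> 1" "\<And>E. E \<subseteq> A \<Longrightarrow> f E \<le> g E"
  shows "bin_exp A p f \<le> bin_exp A p g"
  unfolding bin_exp_def using assms by (intro sum_mono mult_left_mono) auto

lemma bin_exp_cong:
  assumes "\<And>E. E \<subseteq> A \<Longrightarrow> f E = g E"
  shows "bin_exp A p f = bin_exp A p g"
  unfolding bin_exp_def using assms by (intro sum.cong) auto

lemma bin_exp_add: "bin_exp A p (\<lambda>E. f E + g E) = bin_exp A p f + bin_exp A p g"
  unfolding bin_exp_def by (simp add: algebra_simps sum.distrib)

lemma bin_exp_cmult: "bin_exp A p (\<lambda>E. c * f E) = c * bin_exp A p f"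
  unfolding bin_exp_def by (simp add: sum_distrib_left algebra_simps)

lemma bin_exp_diff: "bin_exp A p (\<lambda>E. f E - g E) = bin_exp A p f - bin_exp A p g"
  using bin_exp_add[of A p f "\<lambda>E. - 1 * g E"] bin_exp_cmult[of A p "-1" g] by simp

lemma bin_exp_sum: "bin_exp A p (\<lambda>E. \<Sum>i\<in>I. f i E) = (\<Sum>i\<in>I. bin_exp A p (f i))"
  unfolding bin_exp_def by (simp add: sum_distrib_left sum.swap[of _ I])

lemma bin_exp_insert:
  assumes fin: "finite A" and e: "e \<notin> A"
  shows "bin_exp (insert e A) p f = p * bin_exp A p (\<lambda>E. f (insert e E)) + (1 - p) * bin_exp A p f"
proof -
  have dj: "Pow A \<inter> insert e ` Pow A = {}" using e by auto
  have inj: "inj_on (insert e) (Pow A)" using e by (intro inj_onI) (metis PowD insert_ident subsetD)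
  have "bin_exp (insert e A) p f =
      (\<Sum>E\<in>Pow A. p ^ card E * (1 - p) ^ card (insert e A - E) * f E)
    + (\<Sum>E\<in>insert e ` Pow A. p ^ card E * (1 - p) ^ card (insert e A - E) * f E)"
    unfolding bin_exp_def Pow_insert using fin dj by (intro sum.union_disjoint) auto
  also have "(\<Sum>E\<in>insert e ` Pow A. p ^ card E * (1 - p) ^ card (insert e A - E) * f E)
     = (\<Sum>E\<in>Pow A. p * (p ^ card E * (1 - p) ^ card (A - E) * f (insert e E)))"
  proof (subst sum.reindex[OF inj], rule sum.cong[OF refl])
    fix E assume "E \<in> Pow A"
    then have "e \<notin> E" "finite E" "insert e A - insert e E = A - E"
      using e fin by (auto intro: finite_subset)
    then show "((\<lambda>E. p ^ card E * (1 - p) ^ card (insert e A - E) * f E) \<circ> insert e) E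
       = p * (p ^ card E * (1 - p) ^ card (A - E) * f (insert e E))"
      by simp
  qed
  also have "(\<Sum>E\<in>Pow A. p ^ card E * (1 - p) ^ card (insert e A - E) * f E)
     = (\<Sum>E\<in>Pow A. (1 - p) * (p ^ card E * (1 - p) ^ card (A - E) * f E))"
  proof (rule sum.cong[OF refl])
    fix E assume "E \<in> Pow A"
    then have "insert e A - E = insert e (A - E)" "finite (A - E)" "e \<notin> A - E"
      using e fin by auto
    then have "card (insert e A - E) = Suc (card (A - E))" by simp
    then show "p ^ card E * (1 - p) ^ card (insert e A - E) * f E
       = (1 - p) * (p ^ card E * (1 - p) ^ card (A - E) * f E)"
      by simp
  qed
  finally show ?thesis unfolding bin_exp_def by (simp add: sum_distrib_left)
qed

lemma bin_exp_const: "finite A \<Longrightarrow> bin_exp A p (\<lambda>_. c) = c"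
proof (induction A rule: finite_induct)
  case empty show ?case by (simp add: bin_exp_def)
next
  case (insert x F) then show ?case by (simp add: bin_exp_insert algebra_simps)
qed

lemma bin_exp_plant1:
  assumes "finite A" "e \<in> A"
  shows "bin_exp A p (\<lambda>E. of_bool (e \<in> E) * f E) = p * bin_exp A p (\<lambda>E. f (insert e E))"
proof -
  define B where "B = A - {e}"
  have A: "A = insert e B" "finite B" "e \<notin> B" using assms B_def by auto
  have z: "bin_exp B p (\<lambda>E. of_bool (e \<in> E) * f E) = bin_exp B p (\<lambda>_. 0)"
    using A(3) by (intro bin_exp_cong) auto
  show ?thesis
    unfolding A(1) bin_exp_insert[OF A(2,3)] z using A(2) by (simp add: bin_exp_const algebra_simps)
qed

text \<open>
The planting identity: conditioning a random set on containing \<open>K\<close> amounts to adding \<open>K\<close> to it.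
\<close>

lemma bin_exp_plant:
  assumes fin: "finite A" and "K \<subseteq> A"
  shows "bin_exp A p (\<lambda>E. of_bool (K \<subseteq> E) * f E) = p ^ card K * bin_exp A p (\<lambda>E. f (E \<union> K))"
proof -
  have "finite K" using assms finite_subset by blast
  then show ?thesis using assms(2)
  proof (induction K arbitrary: f rule: finite_induct)
    case empty
    then show ?case by simp
  next
    case (insert e K)
    have "bin_exp A p (\<lambda>E. of_bool (insert e K \<subseteq> E) * f E)
        = bin_exp A p (\<lambda>E. of_bool (e \<in> E) * (of_bool (K \<subseteq> E) * f E))"
      by (rule bin_exp_cong) auto
    also have "\<dots> = p * bin_exp A p (\<lambda>E. of_bool (K \<subseteq> insert e E) * f (insert e E))"
      using insert fin by (intro bin_exp_plant1) auto
    also have "bin_exp A p (\<lambda>E. of_bool (K \<subseteq> insert e E) * f (insert e E))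
        = bin_exp A p (\<lambda>E. of_bool (K \<subseteq> E) * f (insert e E))"
      using insert(2) by (intro bin_exp_cong) (simp add: subset_insert)
    also have "\<dots> = p ^ card K * bin_exp A p (\<lambda>E. f (insert e (E \<union> K)))"
      using insert by auto
    finally show ?case using insert by simp
  qed
qed

text \<open>
The events that the random set contains \<open>K i\<close>, for disjoint sets \<open>K i\<close>, are independent.
\<close>

lemma bin_exp_prod:
  assumes fin: "finite A" and "finite T"
    and "\<And>i. i \<in> T \<Longrightarrow> K i \<subseteq> A" and "disjoint_family_on K T"
  shows "bin_exp A p (\<lambda>E. \<Prod>i\<in>T. 1 + a i * of_bool (K i \<subseteq> E)) = (\<Prod>i\<in>T. 1 + a i * p ^ card (K i))"
  using assms(2-)
proof (induction T rule: finite_induct)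
  case empty
  then show ?case using fin by (simp add: bin_exp_const)
next
  case (insert x T)
  define F where "F E = (\<Prod>i\<in>T. 1 + a i * of_bool (K i \<subseteq> E))" for E
  have F: "F (E \<union> K x) = F E" for E
    unfolding F_def
  proof (rule prod.cong[OF refl])
    fix i assume "i \<in> T"
    then have "K i \<inter> K x = {}" using insert by (auto simp: disjoint_family_on_def)
    then have "(K i \<subseteq> E \<union> K x) = (K i \<subseteq> E)" by blast
    then show "1 + a i * of_bool (K i \<subseteq> E \<union> K x) = 1 + a i * of_bool (K i \<subseteq> E)"
      by simp
  qed
  have "bin_exp A p (\<lambda>E. \<Prod>i\<in>insert x T. 1 + a i * of_bool (K i \<subseteq> E))
     = bin_exp A p (\<lambda>E. F E + a x * (of_bool (K x \<subseteq> E) * F E))"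
    using insert(1,2) by (intro bin_exp_cong) (simp add: F_def algebra_simps)
  also have "\<dots> = bin_exp A p F + a x * bin_exp A p (\<lambda>E. of_bool (K x \<subseteq> E) * F E)"
    by (simp add: bin_exp_add bin_exp_cmult)
  also have "bin_exp A p (\<lambda>E. of_bool (K x \<subseteq> E) * F E) = p ^ card (K x) * bin_exp A p F"
    using bin_exp_plant[OF fin, of "K x" p F] insert(4) by (simp add: F)
  also have "bin_exp A p F = (\<Prod>i\<in>T. 1 + a i * p ^ card (K i))"
    unfolding F_def using insert(3,4,5) by (simp add: disjoint_family_on_def)
  finally show ?case using insert(1,2) by (simp add: algebra_simps)
qed

lemma bin_exp_perm:
  assumes \<pi>: "bij_betw \<pi> A A" and fin: "finite A"
  shows "bin_exp A p (\<lambda>E. f (\<pi> ` E)) = bin_exp A p f"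
proof -
  have b: "bij_betw (image \<pi>) (Pow A) (Pow A)"
    using \<pi> by (rule bij_betw_Pow)
  have "bin_exp A p f = (\<Sum>E\<in>Pow A. p ^ card (\<pi> ` E) * (1 - p) ^ card (A - \<pi> ` E) * f (\<pi> ` E))"
    unfolding bin_exp_def by (rule sum.reindex_bij_betw[OF b, symmetric])
  also have "\<dots> = bin_exp A p (\<lambda>E. f (\<pi> ` E))"
    unfolding bin_exp_def
  proof (rule sum.cong[OF refl])
    fix E assume "E \<in> Pow A"
    then have E: "E \<subseteq> A" by simp
    have inj: "inj_on \<pi> A" and im: "\<pi> ` A = A" using \<pi> by (auto simp: bij_betw_def)
    have "card (\<pi> ` E) = card E" using inj E by (meson card_image inj_on_subset)
    moreover have "A - \<pi> ` E = \<pi> ` (A - E)"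
      using inj E im by (metis Diff_subset inj_on_image_set_diff)
    then have "card (A - \<pi> ` E) = card (A - E)"
      using inj by (metis Diff_subset card_image inj_on_subset)
    ultimately show "p ^ card (\<pi> ` E) * (1 - p) ^ card (A - \<pi> ` E) * f (\<pi> ` E)
      = p ^ card E * (1 - p) ^ card (A - E) * f (\<pi> ` E)" by simp
  qed
  finally show ?thesis ..
qed

lemma bin_exp_markov:
  assumes "finite A" "0 \<le> p" "p \<le> 1" "c > 0" "\<And>E. E \<subseteq> A \<Longrightarrow> f E \<ge> 0"
  shows "bin_exp A p (\<lambda>E. of_bool (f E \<ge> c)) \<le> bin_exp A p f / c"
proof -
  have "bin_exp A p (\<lambda>E. of_bool (f E \<ge> c)) \<le> bin_exp A p (\<lambda>E. (1 / c) * f E)"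
    using assms by (intro bin_exp_mono) (auto simp: field_simps)
  then show ?thesis unfolding bin_exp_cmult by simp
qed


section \<open>Tail bounds and pseudorandomness\<close>

lemma bin_exp_union_bound:
  assumes "0 \<le> p" "p \<le> 1" "finite I"
    and "\<And>E. E \<subseteq> A \<Longrightarrow> Q E \<Longrightarrow> \<exists>i\<in>I. R i E"
  shows "bin_exp A p (\<lambda>E. of_bool (Q E)) \<le> (\<Sum>i\<in>I. bin_exp A p (\<lambda>E. of_bool (R i E)))"
proof -
  have "bin_exp A p (\<lambda>E. of_bool (Q E)) \<le> bin_exp A p (\<lambda>E. \<Sum>i\<in>I. of_bool (R i E))"
  proof (rule bin_exp_mono[OF assms(1,2)])
    fix E assume E: "E \<subseteq> A"
    show "of_bool (Q E) \<le> (\<Sum>i\<in>I. of_bool (R i E) :: real)"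
    proof (cases "Q E")
      case True
      then obtain i where "i \<in> I" "R i E" using assms(4) E by blast
      then show ?thesis
        using member_le_sum[of i I "\<lambda>i. of_bool (R i E) :: real"] assms(3) by auto
    qed (simp add: sum_nonneg)
  qed
  then show ?thesis by (simp add: bin_exp_sum)
qed

lemma exp_le_quadratic:
  fixes x :: real assumes "\<bar>x\<bar> \<le> 1"
  shows "exp x \<le> 1 + x + x\<^sup>2"
proof (cases "x \<ge> 0")
  case True then show ?thesis using assms exp_bound[of x] by simp
next
  case False
  define y where "y = - x"
  have y: "0 \<le> y" using False y_def by simp
  have a: "1 + y + y\<^sup>2 / 2 \<le> exp y" using exp_lower_Taylor_quadratic[OF y] .
  have "(1 - y + y\<^sup>2) * (1 + y + y\<^sup>2 / 2) = 1 + y\<^sup>2 / 2 + y ^ 3 / 2 + y ^ 4 / 2"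
    by (simp add: field_simps power2_eq_square power3_eq_cube power4_eq_xxxx)
  also have "\<dots> \<ge> 1" using y by simp
  finally have b: "1 \<le> (1 - y + y\<^sup>2) * (1 + y + y\<^sup>2 / 2)" .
  have "1 - y + y\<^sup>2 = (1 - y)\<^sup>2 + y" by (simp add: power2_eq_square algebra_simps)
  then have pos: "1 - y + y\<^sup>2 \<ge> 0" using y zero_le_power2[of "1 - y"] by linarith
  have "1 \<le> (1 - y + y\<^sup>2) * exp y"
    using b mult_left_mono[OF a pos] by linarith
  then have "exp (- y) \<le> 1 - y + y\<^sup>2"
    by (simp add: exp_minus field_simps)
  then show ?thesis by (simp add: y_def)
qed

text \<open>
A Chernoff bound with variance term: the exponent involves \<open>p\<close> times the sum of squared weights,
which is what makes the next estimate sharp for small \<open>p\<close>.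
\<close>

lemma bin_exp_chernoff:
  assumes fin: "finite A" and p: "0 \<le> p" "p \<le> 1"
    and c: "\<And>e. e \<in> A \<Longrightarrow> \<bar>c e\<bar> \<le> 1"
  shows "bin_exp A p (\<lambda>E. of_bool ((\<Sum>e\<in>A. c e * of_bool (e \<in> E)) - p * (\<Sum>e\<in>A. c e) \<ge> s))
     \<le> exp (p * (\<Sum>e\<in>A. (c e)\<^sup>2) - s)"
proof -
  have "bin_exp A p (\<lambda>E. exp (\<Sum>e\<in>A. c e * of_bool (e \<in> E)))
      = bin_exp A p (\<lambda>E. \<Prod>e\<in>A. 1 + (exp (c e) - 1) * of_bool ({e} \<subseteq> E))"
    unfolding exp_sum[OF fin] by (intro bin_exp_cong prod.cong refl) auto
  also have "\<dots> = (\<Prod>e\<in>A. 1 + (exp (c e) - 1) * p ^ card {e})"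
    by (rule bin_exp_prod) (use fin in \<open>auto simp: disjoint_family_on_def\<close>)
  also have "\<dots> \<le> (\<Prod>e\<in>A. exp (p * (c e + (c e)\<^sup>2)))"
  proof (intro prod_mono conjI)
    fix e assume e: "e \<in> A"
    have "(exp (c e) - 1) * p \<le> p * (c e + (c e)\<^sup>2)"
      using mult_left_mono[OF exp_le_quadratic[OF c[OF e]] p(1)] by (simp add: algebra_simps)
    then show "1 + (exp (c e) - 1) * p ^ card {e} \<le> exp (p * (c e + (c e)\<^sup>2))"
      using exp_ge_add_one_self[of "p * (c e + (c e)\<^sup>2)"] by (simp del: exp_ge_add_one_self)
    have "0 \<le> (1 - p) + p * exp (c e)" using p by (intro add_nonneg_nonneg) auto
    then show "0 \<le> 1 + (exp (c e) - 1) * p ^ card {e}" by (simp add: algebra_simps)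
  qed
  also have "\<dots> = exp (p * (\<Sum>e\<in>A. c e) + p * (\<Sum>e\<in>A. (c e)\<^sup>2))"
    by (simp add: exp_sum[OF fin, symmetric] sum.distrib sum_distrib_left algebra_simps)
  finally have m: "bin_exp A p (\<lambda>E. exp (\<Sum>e\<in>A. c e * of_bool (e \<in> E)))
      \<le> exp (p * (\<Sum>e\<in>A. c e) + p * (\<Sum>e\<in>A. (c e)\<^sup>2))" .
  have "bin_exp A p (\<lambda>E. of_bool ((\<Sum>e\<in>A. c e * of_bool (e \<in> E)) - p * (\<Sum>e\<in>A. c e) \<ge> s))
     \<le> bin_exp A p (\<lambda>E. exp (- s - p * (\<Sum>e\<in>A. c e)) * exp (\<Sum>e\<in>A. c e * of_bool (e \<in> E)))"
    by (intro bin_exp_mono p) (auto simp: exp_add[symmetric] of_bool_def)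
  also have "\<dots> \<le> exp (- s - p * (\<Sum>e\<in>A. c e)) * exp (p * (\<Sum>e\<in>A. c e) + p * (\<Sum>e\<in>A. (c e)\<^sup>2))"
    unfolding bin_exp_cmult using m by simp
  also have "\<dots> = exp (p * (\<Sum>e\<in>A. (c e)\<^sup>2) - s)"
    by (simp add: exp_add[symmetric])
  finally show ?thesis .
qed

text \<open>
The number of ordered pairs in \<open>A \<times> B\<close> that form an edge; an edge inside \<open>A \<inter> B\<close> counts twice.
\<close>

definition edge_count :: "'a set set \<Rightarrow> 'a set \<Rightarrow> 'a set \<Rightarrow> real" where
  "edge_count E A B = (\<Sum>u\<in>A. \<Sum>v\<in>B. of_bool ({u, v} \<in> E))"

text \<open>
Pseudorandomness: all edge counts are within \<open>O(n sqrt (n p))\<close> of their expectation. The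
later estimates need an error of this order.
\<close>

definition jumbled :: "nat \<Rightarrow> real \<Rightarrow> nat set set \<Rightarrow> bool" where
  "jumbled n p E \<longleftrightarrow> (\<forall>A\<subseteq>{..<n}. \<forall>B\<subseteq>{..<n}.
     \<bar>edge_count E A B - p * real (card A) * real (card B)\<bar> \<le> 11 * real n * sqrt (real n * p))"

text \<open>
A union bound over the \<open>4\<^sup>n\<close> pairs of sets. The index \<open>\<sigma>\<close> is the sign of the deviation, and \<open>w A B e\<close>
is the number of ordered pairs in \<open>A \<times> B\<close> that form the edge \<open>e\<close>.
\<close>

lemma prob_not_jumbled:
  assumes p: "0 \<le> p" "p \<le> 1" and np: "real n * p \<ge> 1"
  shows "bin_exp (all_pairs {..<n}) p (\<lambda>E. of_bool (\<not> jumbled n p E)) \<le> 1 / real n"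
proof -
  define P where "P = all_pairs {..<n}"
  have fin: "finite P" unfolding P_def by (simp add: finite_all_pairs)
  have n: "n > 0" using np by (cases n) auto
  define q where "q = sqrt (real n * p)"
  have q: "q \<ge> 1" "q\<^sup>2 = real n * p" unfolding q_def using np by auto
  define w where "w A B e = real (card {x \<in> A \<times> B. {fst x, snd x} = e})" for A B :: "nat set" and e
  define lam where "lam = 1 / (2 * q)"
  have lam: "0 < lam" "lam \<le> 1 / 2" "lam * q = 1 / 2" using q(1) unfolding lam_def by (auto simp: field_simps)
  define R where "R = (\<lambda>(A, B, \<sigma>::real) E.
     (\<Sum>e\<in>P. \<sigma> * lam * w A B e * of_bool (e \<in> E)) - p * (\<Sum>e\<in>P. \<sigma> * lam * w A B e) \<ge> 5 * real n)"
  define I where "I = Pow {..<n} \<times> Pow {..<n} \<times> {1, - 1 :: real}"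
  have w2: "w A B e \<le> 2" if "e \<in> P" for A B e
  proof -
    have "card e = 2" using that unfolding P_def all_pairs_def by simp
    then obtain x y where e: "e = {x, y}" by (meson card_2_iff)
    have sub: "{z \<in> A \<times> B. {fst z, snd z} = e} \<subseteq> {(x, y), (y, x)}"
      unfolding e by (auto simp: doubleton_eq_iff)
    have "card {z \<in> A \<times> B. {fst z, snd z} = e} \<le> card {(x, y), (y, x)}"
      by (rule card_mono[OF _ sub]) simp
    also have "\<dots> \<le> 2" using card_length[of "[(x, y), (y, x)]"] by simp
    finally have "card {z \<in> A \<times> B. {fst z, snd z} = e} \<le> 2" .
    then show ?thesis unfolding w_def by linarith
  qed
  have w0: "w A B e \<ge> 0" for A B e unfolding w_def by simp
  \<comment> \<open>Double counting of pairs by the edge that they form.\<close>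
  have edge_count_w: "edge_count E A B = (\<Sum>e\<in>P. w A B e * of_bool (e \<in> E))"
    if "A \<subseteq> {..<n}" "B \<subseteq> {..<n}" "E \<subseteq> P" for A B E
  proof -
    have f: "finite A" "finite B" using that by (auto intro: finite_subset)
    have "(\<Sum>e\<in>P. w A B e * of_bool (e \<in> E))
        = (\<Sum>e\<in>P. \<Sum>x\<in>A \<times> B. of_bool ({fst x, snd x} = e) * of_bool (e \<in> E))"
    proof (rule sum.cong[OF refl])
      fix e
      have "(\<Sum>x\<in>A \<times> B. of_bool ({fst x, snd x} = e)) = w A B e"
        unfolding w_def using f by (simp add: sum.If_cases of_bool_def Int_def)
      then show "w A B e * of_bool (e \<in> E)
        = (\<Sum>x\<in>A \<times> B. of_bool ({fst x, snd x} = e) * of_bool (e \<in> E))"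
        by (simp only: sum_distrib_right[symmetric])
    qed
    also have "\<dots> = (\<Sum>x\<in>A \<times> B. \<Sum>e\<in>P. of_bool ({fst x, snd x} = e) * of_bool (e \<in> E))"
      by (rule sum.swap)
    also have "\<dots> = (\<Sum>x\<in>A \<times> B. of_bool ({fst x, snd x} \<in> E))"
    proof (rule sum.cong[OF refl])
      fix x
      have "(\<Sum>e\<in>P. of_bool ({fst x, snd x} = e) * of_bool (e \<in> E) :: real)
          = (\<Sum>e\<in>P. if e = {fst x, snd x} then of_bool ({fst x, snd x} \<in> E) else 0)"
        by (intro sum.cong) auto
      also have "\<dots> = of_bool ({fst x, snd x} \<in> E)"
        using fin that(3) by auto
      finally show "(\<Sum>e\<in>P. of_bool ({fst x, snd x} = e) * of_bool (e \<in> E) :: real)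
          = of_bool ({fst x, snd x} \<in> E)" .
    qed
    also have "\<dots> = edge_count E A B"
      unfolding edge_count_def by (simp add: sum.cartesian_product case_prod_beta)
    finally show ?thesis ..
  qed
  have sum_w: "\<bar>(\<Sum>e\<in>P. w A B e) - real (card A) * real (card B)\<bar> \<le> real n"
      "(\<Sum>e\<in>P. w A B e) \<le> (real n)\<^sup>2"
    if AB: "A \<subseteq> {..<n}" "B \<subseteq> {..<n}" for A B
  proof -
    have f: "finite A" "finite B" using that by (auto intro: finite_subset)
    have cA: "card A \<le> n" "card B \<le> n"
      using card_mono[OF finite_lessThan AB(1)] card_mono[OF finite_lessThan AB(2)] by auto
    have "(\<Sum>e\<in>P. w A B e) = edge_count P A B" using edge_count_w[OF AB, of P] by simp
    also have "\<dots> = (\<Sum>u\<in>A. \<Sum>v\<in>B. 1 - of_bool (u = v))"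
      unfolding edge_count_def using AB by (intro sum.cong refl) (auto simp: P_def all_pairs_def card_insert_if)
    also have "\<dots> = real (card A) * real (card B) - (\<Sum>u\<in>A. of_bool (u \<in> B))"
    proof -
      have "(\<Sum>v\<in>B. of_bool (u = v)) = (of_bool (u \<in> B) :: real)" for u
        using f by (simp add: of_bool_def)
      then show ?thesis by (simp add: sum_subtractf)
    qed
    finally have e: "(\<Sum>e\<in>P. w A B e) = real (card A) * real (card B) - (\<Sum>u\<in>A. of_bool (u \<in> B))" .
    have z: "(\<Sum>u\<in>A. of_bool (u \<in> B)) \<ge> (0::real)" by (simp add: sum_nonneg)
    have "(\<Sum>u\<in>A. of_bool (u \<in> B)) \<le> (\<Sum>u\<in>A. (1::real))" by (intro sum_mono) auto
    then have y: "(\<Sum>u\<in>A. of_bool (u \<in> B)) \<le> real n" using cA by simp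
    show "\<bar>(\<Sum>e\<in>P. w A B e) - real (card A) * real (card B)\<bar> \<le> real n"
      using e z y by linarith
    have "real (card A) * real (card B) \<le> real n * real n" using cA by (intro mult_mono) auto
    then show "(\<Sum>e\<in>P. w A B e) \<le> (real n)\<^sup>2" using e z by (simp add: power2_eq_square)
  qed
  have R: "bin_exp P p (\<lambda>E. of_bool (R i E)) \<le> exp (- (9 / 2) * real n)" if "i \<in> I" for i
  proof -
    obtain A B \<sigma> where i: "i = (A, B, \<sigma>)" by (cases i)
    have AB: "A \<subseteq> {..<n}" "B \<subseteq> {..<n}" and \<sigma>: "\<bar>\<sigma>\<bar> = 1" using that unfolding I_def i by auto
    have \<sigma>2: "\<sigma>\<^sup>2 = 1" using \<sigma> by (metis power2_abs power_one)
    have "bin_exp P p (\<lambda>E. of_bool (R i E)) \<le> exp (p * (\<Sum>e\<in>P. (\<sigma> * lam * w A B e)\<^sup>2) - 5 * real n)"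
      unfolding R_def i prod.case
    proof (rule bin_exp_chernoff[OF fin p])
      fix e assume "e \<in> P"
      have "lam * w A B e \<le> 1 / 2 * 2"
        using lam w2[OF \<open>e \<in> P\<close>] w0 by (intro mult_mono) auto
      then show "\<bar>\<sigma> * lam * w A B e\<bar> \<le> 1" using \<sigma> lam w0[of A B e] by (simp add: abs_mult)
    qed
    also have "p * (\<Sum>e\<in>P. (\<sigma> * lam * w A B e)\<^sup>2) \<le> p * (\<Sum>e\<in>P. lam\<^sup>2 * (2 * w A B e))"
    proof (intro mult_left_mono sum_mono p)
      fix e assume "e \<in> P"
      have "w A B e * w A B e \<le> 2 * w A B e" using w2[OF \<open>e \<in> P\<close>] w0 by (intro mult_right_mono) auto
      then show "(\<sigma> * lam * w A B e)\<^sup>2 \<le> lam\<^sup>2 * (2 * w A B e)"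
        using \<sigma>2 by (simp add: power_mult_distrib mult_left_mono power2_eq_square[of "w A B e"])
    qed
    also have "\<dots> = 2 * p * lam\<^sup>2 * (\<Sum>e\<in>P. w A B e)"
      by (simp only: sum_distrib_left mult.assoc mult.left_commute)
    also have "\<dots> \<le> 2 * p * lam\<^sup>2 * (real n)\<^sup>2"
      using sum_w(2)[OF AB] p by (intro mult_left_mono) auto
    also have "\<dots> = 2 * (lam * q)\<^sup>2 * real n"
      using q(2) by (simp add: power_mult_distrib power2_eq_square[of "real n"] algebra_simps)
    also have "\<dots> = real n / 2" unfolding lam(3) by (simp add: power2_eq_square)
    finally show ?thesis by simp
  qed
  have "bin_exp P p (\<lambda>E. of_bool (\<not> jumbled n p E)) \<le> (\<Sum>i\<in>I. bin_exp P p (\<lambda>E. of_bool (R i E)))"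
  proof (rule bin_exp_union_bound[OF p])
    show "finite I" unfolding I_def by simp
    fix E assume E: "E \<subseteq> P" and nj: "\<not> jumbled n p E"
    then obtain A B where AB: "A \<subseteq> {..<n}" "B \<subseteq> {..<n}"
      and big: "\<bar>edge_count E A B - p * real (card A) * real (card B)\<bar> > 11 * real n * q"
      unfolding jumbled_def q_def[symmetric] by (meson not_le)
    define \<sigma> :: real where "\<sigma> = (if edge_count E A B \<ge> p * real (card A) * real (card B) then 1 else - 1)"
    have "p * \<bar>(\<Sum>e\<in>P. w A B e) - real (card A) * real (card B)\<bar> \<le> 1 * real n"
      using sum_w(1)[OF AB] p by (intro mult_mono) auto
    also have "\<dots> \<le> real n * q" using q(1) by (simp add: mult_le_cancel_left1)
    finally have "p * \<bar>(\<Sum>e\<in>P. w A B e) - real (card A) * real (card B)\<bar> \<le> real n * q" .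
    then have d: "\<bar>p * (\<Sum>e\<in>P. w A B e) - p * real (card A) * real (card B)\<bar> \<le> real n * q"
    proof -
      have "p * (\<Sum>e\<in>P. w A B e) - p * real (card A) * real (card B)
          = p * ((\<Sum>e\<in>P. w A B e) - real (card A) * real (card B))"
        by (simp only: right_diff_distrib mult.assoc)
      then show ?thesis
        using \<open>p * \<bar>(\<Sum>e\<in>P. w A B e) - real (card A) * real (card B)\<bar> \<le> real n * q\<close> p
        by (simp only: abs_mult abs_of_nonneg)
    qed
    have "10 * real n * q \<le> \<sigma> * (edge_count E A B - p * (\<Sum>e\<in>P. w A B e))"
      using big d unfolding \<sigma>_def by (auto simp: abs_real_def split: if_splits)
    then have "lam * (10 * real n * q) \<le> lam * (\<sigma> * (edge_count E A B - p * (\<Sum>e\<in>P. w A B e)))"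
      using lam(1) by (intro mult_left_mono) auto
    moreover have "lam * (10 * real n * q) = 5 * real n"
    proof -
      have "lam * (10 * real n * q) = 10 * real n * (lam * q)" by simp
      then show ?thesis using lam(3) by simp
    qed
    moreover have "lam * (\<sigma> * (edge_count E A B - p * (\<Sum>e\<in>P. w A B e)))
       = (\<Sum>e\<in>P. \<sigma> * lam * w A B e * of_bool (e \<in> E)) - p * (\<Sum>e\<in>P. \<sigma> * lam * w A B e)"
      unfolding edge_count_w[OF AB E] by (simp add: sum_distrib_left algebra_simps)
    ultimately have "R (A, B, \<sigma>) E" unfolding R_def by simp
    moreover have "(A, B, \<sigma>) \<in> I" unfolding I_def \<sigma>_def using AB by auto
    ultimately show "\<exists>i\<in>I. R i E" by blast
  qed
  also have "\<dots> \<le> (\<Sum>i\<in>I. exp (- (9 / 2) * real n))" by (intro sum_mono R)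
  also have "\<dots> = 2 * 4 ^ n * exp (- (9 / 2) * real n)"
  proof -
    have "real (card I) = 2 ^ n * 2 ^ n * 2" unfolding I_def
      by (simp add: card_cartesian_product card_Pow)
    also have "\<dots> = 2 * 4 ^ n" by (simp flip: power_mult_distrib)
    finally show ?thesis by simp
  qed
  also have "\<dots> \<le> 2 * exp (2 * real n) * exp (- (9 / 2) * real n)"
  proof -
    have "(4::real) = 2 * 2" by simp
    also have "\<dots> \<le> exp 1 * exp 1" using exp_ge_add_one_self[of 1] by (intro mult_mono) auto
    also have "\<dots> = exp 2" by (simp add: exp_add[symmetric])
    finally have "(4::real) ^ n \<le> exp 2 ^ n" by (rule power_mono) simp
    then show ?thesis by (simp add: exp_of_nat_mult[symmetric] mult.commute)
  qed
  also have "\<dots> = 2 / exp (5 / 2 * real n)"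
  proof -
    have "2 * real n + - (9 / 2) * real n = - (5 / 2 * real n)" by simp
    then have "exp (2 * real n) * exp (- (9 / 2) * real n) = inverse (exp (5 / 2 * real n))"
      by (simp only: exp_add[symmetric] exp_minus)
    then show ?thesis by (simp add: field_simps)
  qed
  also have "\<dots> \<le> 2 / (2 * real n)"
  proof -
    have "2 * real n \<le> exp (5 / 2 * real n)"
      using exp_ge_add_one_self[of "5 / 2 * real n"] by linarith
    then show ?thesis using n by (intro divide_left_mono) auto
  qed
  finally show ?thesis unfolding P_def by simp
qed


section \<open>Cuts as colourings\<close>

text \<open>
Colourings are total functions on the natural numbers; the colours of vertices outside
\<open>{..<n}\<close> are irrelevant.
\<close>

definition colourings :: "nat \<Rightarrow> (nat \<Rightarrow> nat) set" where
  "colourings r = {c. \<forall>v. c v \<in> {1..r}}"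

text \<open>
The two ends of the edge \<open>e\<close> have different colours, so the edge is cut.
\<close>

definition bichromatic :: "(nat \<Rightarrow> nat) \<Rightarrow> nat set \<Rightarrow> bool" where
  "bichromatic c e \<longleftrightarrow> (\<exists>u v. e = {u, v} \<and> c u \<noteq> c v)"

text \<open>
The number of edges of \<open>E\<close> cut by the colouring \<open>c\<close>.
\<close>

definition col_size :: "nat set set \<Rightarrow> (nat \<Rightarrow> nat) \<Rightarrow> nat" where
  "col_size E c = card {e \<in> E. bichromatic c e}"

text \<open>
The size of a maximum \<open>r\<close>-cut.
\<close>

definition maxcut :: "nat \<Rightarrow> nat set set \<Rightarrow> nat" where
  "maxcut r E = Max (col_size E ` colourings r)"

text \<open>
\<open>c\<close> cuts at most \<open>D\<close> edges fewer than a maximum cut; \<open>D = 0\<close> means that \<open>c\<close> is a maximum cut.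
\<close>

definition near_max :: "nat \<Rightarrow> nat \<Rightarrow> nat set set \<Rightarrow> (nat \<Rightarrow> nat) \<Rightarrow> bool" where
  "near_max r D E c \<longleftrightarrow> c \<in> colourings r \<and> maxcut r E \<le> col_size E c + D"

text \<open>
The set of vertices of colour \<open>i\<close>.
\<close>

definition colour_class :: "nat \<Rightarrow> (nat \<Rightarrow> nat) \<Rightarrow> nat \<Rightarrow> nat set" where
  "colour_class n c i = {v \<in> {..<n}. c v = i}"

text \<open>
The number of neighbours of \<open>u\<close> in \<open>A\<close>.
\<close>

definition deg_in :: "nat set set \<Rightarrow> nat \<Rightarrow> nat set \<Rightarrow> nat" where
  "deg_in E u A = card {v \<in> A. {u, v} \<in> E}"

lemma bichromatic_pair [simp]: "bichromatic c {u, v} \<longleftrightarrow> c u \<noteq> c v"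
  unfolding bichromatic_def by (auto simp: doubleton_eq_iff)

lemma finite_colour_class [simp]: "finite (colour_class n c i)" unfolding colour_class_def by simp

lemma colour_class_sub: "colour_class n c i \<subseteq> {..<n}" unfolding colour_class_def by auto

lemma card_colour_class_le: "card (colour_class n c i) \<le> n"
  using card_mono[OF finite_lessThan colour_class_sub] by simp

lemma deg_in_eq_sum: "finite A \<Longrightarrow> real (deg_in E u A) = (\<Sum>v\<in>A. of_bool ({u, v} \<in> E))"
  unfolding deg_in_def by (simp add: sum.If_cases of_bool_def Int_def)

lemma edge_count_eq_deg_in: "finite B \<Longrightarrow> edge_count E A B = (\<Sum>u\<in>A. real (deg_in E u B))"
  unfolding edge_count_def by (simp add: deg_in_eq_sum)

lemma deg_in_le: "finite A \<Longrightarrow> deg_in E u A \<le> card A"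
  unfolding deg_in_def by (intro card_mono) auto

lemma finite_edges: "E \<subseteq> all_pairs {..<n::nat} \<Longrightarrow> finite E"
  by (erule finite_subset) (simp add: finite_all_pairs)

lemma finite_col_size_image: "finite E \<Longrightarrow> finite (col_size E ` S)"
  by (rule finite_subset[of _ "{..card E}"]) (auto simp: col_size_def intro!: card_mono)

lemma col_size_le_maxcut: "finite E \<Longrightarrow> c \<in> colourings r \<Longrightarrow> col_size E c \<le> maxcut r E"
  unfolding maxcut_def by (intro Max_ge finite_col_size_image) auto

lemma colourings_ne: "r \<ge> 1 \<Longrightarrow> colourings r \<noteq> {}"
  unfolding colourings_def by (auto intro: exI[of _ "\<lambda>_. 1"])

lemma maxcut_attained:
  assumes "finite E" "r \<ge> 1"
  obtains c where "c \<in> colourings r" "col_size E c = maxcut r E"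
proof -
  have "maxcut r E \<in> col_size E ` colourings r"
    unfolding maxcut_def using Max_in[OF finite_col_size_image[OF assms(1)], of "colourings r"] colourings_ne[OF assms(2)]
    by blast
  then show thesis using that by (metis imageE)
qed

lemma colourings_upd: "c \<in> colourings r \<Longrightarrow> i \<in> {1..r} \<Longrightarrow> c(u := i) \<in> colourings r"
  unfolding colourings_def by auto

lemma all_pairs_pair: "{u, v} \<in> all_pairs X \<longleftrightarrow> u \<in> X \<and> v \<in> X \<and> u \<noteq> v"
  unfolding all_pairs_def by (auto simp: card_insert_if)

lemma all_pairsE:
  assumes "e \<in> all_pairs X"
  obtains u v where "e = {u, v}" "u \<in> X" "v \<in> X" "u \<noteq> v"
proof -
  have "card e = 2" "e \<subseteq> X" using assms unfolding all_pairs_def by auto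
  then obtain u v where "e = {u, v}" "u \<noteq> v" by (meson card_2_iff)
  then show thesis using that \<open>e \<subseteq> X\<close> by auto
qed

lemma col_size_split:
  assumes E: "E \<subseteq> all_pairs {..<n}" and u: "u < n"
  shows "col_size E c + deg_in E u (colour_class n c (c u)) = card {e \<in> E. u \<notin> e \<and> bichromatic c e} + deg_in E u {..<n}"
proof -
  have fin: "finite E" using E by (rule finite_edges)
  have im: "{e \<in> E. u \<in> e \<and> bichromatic c e} = (\<lambda>v. {u, v}) ` {v \<in> {..<n}. {u, v} \<in> E \<and> c v \<noteq> c u}"
  proof (intro set_eqI iffI)
    fix e assume e: "e \<in> {e \<in> E. u \<in> e \<and> bichromatic c e}"
    then obtain x y where xy: "e = {x, y}" "x < n" "y < n" "x \<noteq> y"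
      using E by (auto elim!: all_pairsE)
    then obtain v where "e = {u, v}" "v < n" using e by (auto simp: insert_commute)
    then show "e \<in> (\<lambda>v. {u, v}) ` {v \<in> {..<n}. {u, v} \<in> E \<and> c v \<noteq> c u}" using e by auto
  qed auto
  have inj: "inj_on (\<lambda>v. {u, v}) S" for S
    by (intro inj_onI) (auto simp: doubleton_eq_iff)
  have "col_size E c = card ({e \<in> E. u \<notin> e \<and> bichromatic c e} \<union> {e \<in> E. u \<in> e \<and> bichromatic c e})"
    unfolding col_size_def by (intro arg_cong[of _ _ card]) auto
  also have "\<dots> = card {e \<in> E. u \<notin> e \<and> bichromatic c e} + card {e \<in> E. u \<in> e \<and> bichromatic c e}"
    using fin by (intro card_Un_disjoint) auto
  also have "card {e \<in> E. u \<in> e \<and> bichromatic c e} = card {v \<in> {..<n}. {u, v} \<in> E \<and> c v \<noteq> c u}"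
    unfolding im by (rule card_image[OF inj])
  finally have 1: "col_size E c = card {e \<in> E. u \<notin> e \<and> bichromatic c e} + card {v \<in> {..<n}. {u, v} \<in> E \<and> c v \<noteq> c u}" .
  have "deg_in E u {..<n} = card ({v \<in> {..<n}. {u, v} \<in> E \<and> c v \<noteq> c u} \<union> {v \<in> colour_class n c (c u). {u, v} \<in> E})"
    unfolding deg_in_def colour_class_def by (intro arg_cong[of _ _ card]) auto
  also have "\<dots> = card {v \<in> {..<n}. {u, v} \<in> E \<and> c v \<noteq> c u} + deg_in E u (colour_class n c (c u))"
    unfolding deg_in_def by (intro card_Un_disjoint) (auto simp: colour_class_def)
  finally show ?thesis using 1 by simp
qed

lemma col_size_recolour:
  assumes E: "E \<subseteq> all_pairs {..<n}" and u: "u < n"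
  shows "col_size E (c(u := i)) + deg_in E u (colour_class n c i) = col_size E c + deg_in E u (colour_class n c (c u))"
proof -
  have a: "{e \<in> E. u \<notin> e \<and> bichromatic (c(u := i)) e} = {e \<in> E. u \<notin> e \<and> bichromatic c e}"
  proof (rule Collect_cong, rule conj_cong[OF refl], rule conj_cong[OF refl])
    fix e assume "u \<notin> e"
    then have "c a = (c(u := i)) a" if "a \<in> e" for a using that by auto
    then show "bichromatic (c(u := i)) e = bichromatic c e"
      unfolding bichromatic_def by (metis insertCI)
  qed
  have nu: "{u, u} \<notin> E" using E all_pairs_pair[of u u "{..<n}"] by auto
  have "{v \<in> colour_class n (c(u := i)) i. {u, v} \<in> E} = {v \<in> colour_class n c i. {u, v} \<in> E}"
    unfolding colour_class_def using nu by auto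
  then have "deg_in E u (colour_class n (c(u := i)) i) = deg_in E u (colour_class n c i)"
    unfolding deg_in_def by simp
  then show ?thesis using col_size_split[OF E u, of "c(u := i)"] col_size_split[OF E u, of c] a by simp
qed

lemma near_max_deg_in:
  assumes E: "E \<subseteq> all_pairs {..<n}" and u: "u < n" and nm: "near_max r D E c" and i: "i \<in> {1..r}"
  shows "deg_in E u (colour_class n c (c u)) \<le> deg_in E u (colour_class n c i) + D"
proof -
  have "col_size E (c(u := i)) \<le> maxcut r E"
    using E nm i by (intro col_size_le_maxcut colourings_upd) (auto simp: near_max_def intro: finite_edges)
  also have "\<dots> \<le> col_size E c + D" using nm unfolding near_max_def by simp
  finally show ?thesis using col_size_recolour[OF E u, of c i] by simp
qed

lemma sum_card_colour_class:
  assumes "c \<in> colourings r"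
  shows "(\<Sum>i\<in>{1..r}. card (colour_class n c i)) = n"
proof -
  have "n = card (\<Union>i\<in>{1..r}. colour_class n c i)"
    using assms by (subst card_lessThan[of n, symmetric], intro arg_cong[of _ _ card])
      (auto simp: colour_class_def colourings_def)
  also have "\<dots> = (\<Sum>i\<in>{1..r}. card (colour_class n c i))"
    by (intro card_UN_disjoint) (auto simp: colour_class_def)
  finally show ?thesis ..
qed

lemma jumbledD:
  assumes "jumbled n p E" "A \<subseteq> {..<n}" "B \<subseteq> {..<n}"
  shows "edge_count E A B \<le> p * real (card A) * real (card B) + 11 * real n * sqrt (real n * p)"
    and "edge_count E A B \<ge> p * real (card A) * real (card B) - 11 * real n * sqrt (real n * p)"
proof -
  have "\<bar>edge_count E A B - p * real (card A) * real (card B)\<bar> \<le> 11 * real n * sqrt (real n * p)"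
    using assms unfolding jumbled_def by blast
  then show "edge_count E A B \<le> p * real (card A) * real (card B) + 11 * real n * sqrt (real n * p)"
    and "edge_count E A B \<ge> p * real (card A) * real (card B) - 11 * real n * sqrt (real n * p)"
    by linarith+
qed

text \<open>
Recolouring a single vertex of class \<open>a\<close> to colour \<open>b\<close> gains at most \<open>D\<close>. Summed over the class this
compares the edge counts inside class \<open>a\<close> and between the classes \<open>a\<close> and \<open>b\<close>, and the comparison
fails if class \<open>a\<close> is much larger than class \<open>b\<close>.
\<close>

lemma near_max_balanced:
  assumes E: "E \<subseteq> all_pairs {..<n}" and J: "jumbled n p E" and nm: "near_max r D E c"
    and np: "real n * p \<ge> 1" and D: "real D \<le> sqrt (real n * p)" and i: "i \<in> {1..r}"
  shows "\<bar>real (card (colour_class n c i)) - real n / real r\<bar> \<le> 23 * real r * real n / sqrt (real n * p)"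
proof -
  define q where "q = sqrt (real n * p)"
  have q: "q \<ge> 1" "q\<^sup>2 = real n * p" unfolding q_def using np by auto
  have n: "n > 0" using np by (cases n) auto
  have r: "r \<ge> 1" using i by auto
  define x where "x j = real (card (colour_class n c j))" for j
  define \<kappa> where "\<kappa> = 23 * real r * real n / q"
  have x: "0 \<le> x j" "x j \<le> real n" for j unfolding x_def using card_colour_class_le[of n c j] by auto
  have sx: "(\<Sum>j\<in>{1..r}. x j) = real n"
    unfolding x_def using sum_card_colour_class[of c r n] nm by (simp add: near_max_def flip: of_nat_sum)
  have step: "x a * (x a - x b) \<le> 23 * (real n)\<^sup>2 / q" if b: "b \<in> {1..r}" for a b
  proof -
    have "edge_count E (colour_class n c a) (colour_class n c a) \<le> (\<Sum>u\<in>colour_class n c a. real (deg_in E u (colour_class n c b)) + real D)"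
      unfolding edge_count_eq_deg_in[OF finite_colour_class]
    proof (rule sum_mono)
      fix u assume "u \<in> colour_class n c a"
      then have "u < n" "c u = a" by (auto simp: colour_class_def)
      then show "real (deg_in E u (colour_class n c a)) \<le> real (deg_in E u (colour_class n c b)) + real D"
        using near_max_deg_in[OF E _ nm b, of u] by (simp flip: of_nat_add)
    qed
    also have "\<dots> = edge_count E (colour_class n c a) (colour_class n c b) + x a * real D"
      by (simp add: edge_count_eq_deg_in sum.distrib x_def)
    finally have 1: "edge_count E (colour_class n c a) (colour_class n c a) \<le> edge_count E (colour_class n c a) (colour_class n c b) + x a * real D" .
    have 2: "x a * real D \<le> real n * q"
      using x[of a] D unfolding q_def[symmetric] by (intro mult_mono) auto
    have "p * x a * x a - p * x a * x b \<le> 23 * real n * q"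
      using 1 2 jumbledD(2)[OF J colour_class_sub colour_class_sub, of c a c a] jumbledD(1)[OF J colour_class_sub colour_class_sub, of c a c b]
      unfolding x_def[symmetric] q_def[symmetric] by linarith
    then have "real n * (p * x a * x a - p * x a * x b) \<le> real n * (23 * real n * q)"
      by (intro mult_left_mono) auto
    then have "q\<^sup>2 * (x a * (x a - x b)) \<le> q * (23 * (real n)\<^sup>2)"
      unfolding q(2) by (simp add: algebra_simps power2_eq_square)
    then have "q * (x a * (x a - x b)) \<le> 23 * (real n)\<^sup>2"
      using q(1) by (simp add: power2_eq_square mult.assoc)
    then show ?thesis using q(1) by (simp add: field_simps)
  qed
  obtain a where a: "a \<in> {1..r}" and amax: "\<And>j. j \<in> {1..r} \<Longrightarrow> x j \<le> x a"
  proof -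
    have "Max (x ` {1..r}) \<in> x ` {1..r}" using r by (intro Max_in) auto
    then obtain a where "a \<in> {1..r}" "x a = Max (x ` {1..r})" by force
    then show thesis using that[of a] by simp
  qed
  have "real n \<le> (\<Sum>j\<in>{1..r}. x a)" unfolding sx[symmetric] using amax by (intro sum_mono) auto
  then have xa: "x a \<ge> real n / real r" using r by (simp add: field_simps)
  have gap: "x a - x b \<le> \<kappa>" if b: "b \<in> {1..r}" for b
  proof -
    have "x a - x b \<ge> 0" using amax[OF b] by simp
    then have "real n / real r * (x a - x b) \<le> x a * (x a - x b)"
      using xa by (intro mult_right_mono) auto
    also have "\<dots> \<le> 23 * (real n)\<^sup>2 / q" by (rule step[OF b])
    finally have "real n * (x a - x b) \<le> real n * \<kappa>"
      using r q(1) unfolding \<kappa>_def by (simp add: field_simps power2_eq_square)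
    then show ?thesis using n by simp
  qed
  have lo: "x i \<ge> real n / real r - \<kappa>" using gap[OF i] xa by simp
  have "(\<Sum>j\<in>{1..r}. x a - \<kappa>) \<le> (\<Sum>j\<in>{1..r}. x j)"
    using gap by (intro sum_mono) (simp add: algebra_simps)
  then have "real r * (x a - \<kappa>) \<le> real n" using sx by simp
  then have "x a - \<kappa> \<le> real n / real r" using r by (simp add: field_simps)
  then have "x i \<le> real n / real r + \<kappa>" using amax[OF i] by simp
  then show ?thesis using lo unfolding x_def \<kappa>_def q_def by (simp add: abs_le_iff)
qed


section \<open>Exchanging the edges of two vertices\<close>

text \<open>
The graph in which the statuses of the pairs \<open>{u, j}\<close> and \<open>{v, j}\<close> have been exchanged.
\<close>

definition swap_at :: "nat \<Rightarrow> nat \<Rightarrow> nat \<Rightarrow> nat set set \<Rightarrow> nat set set" where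
  "swap_at u v j E = Transposition.transpose {u, j} {v, j} ` E"

text \<open>
The change in the size of the cut \<open>c\<close> when the statuses of \<open>{u, j}\<close> and \<open>{v, j}\<close> are exchanged, for \<open>u\<close>,
\<open>v\<close>, \<open>j\<close> distinct.
\<close>

definition gain :: "nat set set \<Rightarrow> (nat \<Rightarrow> nat) \<Rightarrow> nat \<Rightarrow> nat \<Rightarrow> nat \<Rightarrow> int" where
  "gain E c u v j = (of_bool ({v, j} \<in> E) - of_bool ({u, j} \<in> E))
     * (of_bool (c u \<noteq> c j) - of_bool (c v \<noteq> c j))"

text \<open>
The maximum size of a cut that separates \<open>u\<close> and \<open>v\<close>.
\<close>

definition max_sep :: "nat \<Rightarrow> nat \<Rightarrow> nat \<Rightarrow> nat set set \<Rightarrow> nat" where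
  "max_sep r u v E = Max (col_size E ` {c \<in> colourings r. c u \<noteq> c v})"

text \<open>
The maximum size of a cut that does not separate \<open>u\<close> and \<open>v\<close>.
\<close>

definition max_joint :: "nat \<Rightarrow> nat \<Rightarrow> nat \<Rightarrow> nat set set \<Rightarrow> nat" where
  "max_joint r u v E = Max (col_size E ` {c \<in> colourings r. c u = c v})"

text \<open>
For \<open>u \<noteq> v\<close> and \<open>r \<ge> 2\<close>, this is positive if all maximum cuts separate \<open>u\<close> and \<open>v\<close>, negative if none does.
\<close>

definition gap :: "nat \<Rightarrow> nat \<Rightarrow> nat \<Rightarrow> nat set set \<Rightarrow> int" where
  "gap r u v E = int (max_sep r u v E) - int (max_joint r u v E)"

text \<open>
A maximum cut chosen once and for all as a function of the graph.
\<close>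

definition canon :: "nat \<Rightarrow> nat set set \<Rightarrow> nat \<Rightarrow> nat" where
  "canon r E = (SOME c. c \<in> colourings r \<and> col_size E c = maxcut r E)"

text \<open>
The number of exchanges that enlarge the chosen maximum cut by one edge.
\<close>

definition ups :: "nat \<Rightarrow> nat \<Rightarrow> nat \<Rightarrow> nat \<Rightarrow> nat set set \<Rightarrow> nat" where
  "ups n r u v E = card {j \<in> {..<n} - {u, v}. gain E (canon r E) u v j = 1}"

text \<open>
The number of exchanges that diminish the chosen maximum cut by one edge.
\<close>

definition downs :: "nat \<Rightarrow> nat \<Rightarrow> nat \<Rightarrow> nat \<Rightarrow> nat set set \<Rightarrow> nat" where
  "downs n r u v E = card {j \<in> {..<n} - {u, v}. gain E (canon r E) u v j = - 1}"

text \<open>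
The number of edges lost when the vertex \<open>u\<close> is recoloured to colour \<open>i\<close> in the chosen maximum cut.
\<close>

definition slack :: "nat \<Rightarrow> nat \<Rightarrow> nat set set \<Rightarrow> nat \<Rightarrow> nat \<Rightarrow> real" where
  "slack n r E u i = real (deg_in E u (colour_class n (canon r E) i)) - real (deg_in E u (colour_class n (canon r E) (canon r E u)))"

lemma canon_props:
  assumes "finite E" "r \<ge> 1"
  shows "canon r E \<in> colourings r" "col_size E (canon r E) = maxcut r E"
proof -
  have "\<exists>c. c \<in> colourings r \<and> col_size E c = maxcut r E"
    using maxcut_attained[OF assms] by metis
  from someI_ex[OF this] show "canon r E \<in> colourings r" "col_size E (canon r E) = maxcut r E"
    unfolding canon_def by auto
qed

lemma near_max_canon:
  assumes "finite E" "r \<ge> 1" shows "near_max r 0 E (canon r E)"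
  unfolding near_max_def using canon_props[OF assms] by simp

lemma col_size_sum: "finite E \<Longrightarrow> int (col_size E c) = (\<Sum>e\<in>E. of_bool (bichromatic c e))"
  unfolding col_size_def by (simp add: sum.If_cases of_bool_def Int_def)

lemma swap_at_swap_at: "swap_at u v j (swap_at u v j E) = E"
  unfolding swap_at_def by (simp add: image_image)

lemma finite_swap_at: "finite E \<Longrightarrow> finite (swap_at u v j E)"
  unfolding swap_at_def by simp

lemma col_size_swap_at:
  assumes fin: "finite E" and uv: "u \<noteq> v" and j: "j \<noteq> u" "j \<noteq> v"
  shows "int (col_size (swap_at u v j E) c) = int (col_size E c) + gain E c u v j"
proof -
  define P Q where "P = {u, j}" and "Q = {v, j}"
  have PQ: "P \<noteq> Q" unfolding P_def Q_def using uv j by (auto simp: doubleton_eq_iff)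
  define s where "s = Transposition.transpose P Q"
  define b :: "nat set \<Rightarrow> int" where "b e = of_bool (bichromatic c e)" for e
  have inj: "inj_on s E" unfolding s_def by (rule inj_on_subset[OF inj_transpose]) simp
  have split: "(\<Sum>e\<in>E. g e) = (\<Sum>e\<in>E - {P, Q}. g e) + of_bool (P \<in> E) * g P + of_bool (Q \<in> E) * g Q"
    for g :: "nat set \<Rightarrow> int"
  proof -
    have "(\<Sum>e\<in>E. g e) = (\<Sum>e\<in>E - {P, Q}. g e) + (\<Sum>e\<in>E \<inter> {P, Q}. g e)"
      using fin by (metis add.commute sum.Int_Diff)
    also have "(\<Sum>e\<in>E \<inter> {P, Q}. g e) = (\<Sum>e\<in>{P, Q}. of_bool (e \<in> E) * g e)"
      by (rule sum.mono_neutral_cong_left) auto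
    also have "\<dots> = of_bool (P \<in> E) * g P + of_bool (Q \<in> E) * g Q" using PQ by simp
    finally show ?thesis by simp
  qed
  have "int (col_size (swap_at u v j E) c) = (\<Sum>e\<in>s ` E. b e)"
    using col_size_sum[OF finite_swap_at[OF fin], of u v j c] unfolding swap_at_def s_def P_def Q_def b_def .
  also have "\<dots> = (\<Sum>e\<in>E. b (s e))" using inj by (simp add: sum.reindex)
  also have "\<dots> = (\<Sum>e\<in>E - {P, Q}. b (s e)) + of_bool (P \<in> E) * b Q + of_bool (Q \<in> E) * b P"
    unfolding split[of "\<lambda>e. b (s e)"] by (simp add: s_def)
  also have "(\<Sum>e\<in>E - {P, Q}. b (s e)) = (\<Sum>e\<in>E - {P, Q}. b e)"
    by (intro sum.cong refl) (auto simp: s_def)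
  finally have 1: "int (col_size (swap_at u v j E) c) = (\<Sum>e\<in>E - {P, Q}. b e) + of_bool (P \<in> E) * b Q + of_bool (Q \<in> E) * b P" .
  have 2: "int (col_size E c) = (\<Sum>e\<in>E - {P, Q}. b e) + of_bool (P \<in> E) * b P + of_bool (Q \<in> E) * b Q"
    using col_size_sum[OF fin, of c] split[of b] unfolding b_def by simp
  have "gain E c u v j = (of_bool (Q \<in> E) - of_bool (P \<in> E)) * (b P - b Q)"
    unfolding gain_def b_def P_def Q_def by simp
  then show ?thesis using 1 2 by (simp add: algebra_simps)
qed

lemma gain_bounds: "gain E c u v j \<le> 1" "gain E c u v j \<ge> - 1"
  unfolding gain_def by (auto simp: of_bool_def)

lemma gain_same: "c u = c v \<Longrightarrow> gain E c u v j = 0"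
  unfolding gain_def by simp

lemma diff_ne: "r \<ge> 2 \<Longrightarrow> u \<noteq> v \<Longrightarrow> {c \<in> colourings r. c u \<noteq> c v} \<noteq> {}"
  unfolding colourings_def by (auto intro!: exI[of _ "(\<lambda>_. 1)(v := 2)"])

lemma max_sep_ge: "finite E \<Longrightarrow> c \<in> colourings r \<Longrightarrow> c u \<noteq> c v \<Longrightarrow> col_size E c \<le> max_sep r u v E"
  unfolding max_sep_def by (intro Max_ge finite_col_size_image) auto

lemma max_joint_ge: "finite E \<Longrightarrow> c \<in> colourings r \<Longrightarrow> c u = c v \<Longrightarrow> col_size E c \<le> max_joint r u v E"
  unfolding max_joint_def by (intro Max_ge finite_col_size_image) auto

lemma max_joint_le_maxcut:
  assumes "finite E" "r \<ge> 1" shows "max_joint r u v E \<le> maxcut r E"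
proof -
  have "(\<lambda>_. 1) \<in> {c \<in> colourings r. c u = c v}" using assms(2) by (auto simp: colourings_def)
  then show ?thesis unfolding max_joint_def maxcut_def
    by (intro Max_mono finite_col_size_image assms(1) image_mono) auto
qed

lemma max_sep_le_maxcut:
  assumes "finite E" "r \<ge> 2" "u \<noteq> v" shows "max_sep r u v E \<le> maxcut r E"
  unfolding max_sep_def maxcut_def using diff_ne[OF assms(2,3)]
  by (intro Max_mono finite_col_size_image assms(1) image_mono) auto

lemma max_joint_swap_at:
  assumes fin: "finite E" and uv: "u \<noteq> v" and j: "j \<noteq> u" "j \<noteq> v"
  shows "max_joint r u v (swap_at u v j E) = max_joint r u v E"
proof -
  have "col_size (swap_at u v j E) c = col_size E c" if "c u = c v" for c
    using col_size_swap_at[OF assms, of c] gain_same[of c u v E j, OF that] by simp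
  then have "col_size (swap_at u v j E) ` {c \<in> colourings r. c u = c v} = col_size E ` {c \<in> colourings r. c u = c v}"
    by (intro image_cong) auto
  then show ?thesis unfolding max_joint_def by simp
qed

lemma max_sep_swap_at_le:
  assumes fin: "finite E" and r: "r \<ge> 2" and uv: "u \<noteq> v" and j: "j \<noteq> u" "j \<noteq> v"
  shows "max_sep r u v (swap_at u v j E) \<le> max_sep r u v E + 1"
proof -
  have "col_size (swap_at u v j E) c \<le> max_sep r u v E + 1" if "c \<in> colourings r" "c u \<noteq> c v" for c
    using col_size_swap_at[OF fin uv j, of c] gain_bounds(1)[of E c u v j] max_sep_ge[OF fin that] by linarith
  then show ?thesis
    unfolding max_sep_def[of r u v "swap_at u v j E"] using diff_ne[OF r uv]
    by (subst Max_le_iff) (auto simp: finite_col_size_image finite_swap_at fin)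
qed

lemma sep_gap_nonneg:
  assumes fin: "finite E" and r: "r \<ge> 1" and sep: "canon r E u \<noteq> canon r E v"
  shows "max_sep r u v E \<ge> maxcut r E" "gap r u v E \<ge> 0"
proof -
  show "max_sep r u v E \<ge> maxcut r E"
    using max_sep_ge[OF fin canon_props(1)[OF fin r] sep] canon_props(2)[OF fin r] by simp
  then show "gap r u v E \<ge> 0" using max_joint_le_maxcut[OF fin r, of u v] unfolding gap_def by simp
qed

lemma gap_pos_sep:
  assumes fin: "finite E" and r: "r \<ge> 2" and uv: "u \<noteq> v" and g: "gap r u v E \<ge> 1"
  shows "canon r E u \<noteq> canon r E v"
proof
  assume s: "canon r E u = canon r E v"
  have r1: "r \<ge> 1" using r by simp
  have "maxcut r E \<le> max_joint r u v E"
    using max_joint_ge[OF fin canon_props(1)[OF fin r1] s] canon_props(2)[OF fin r1] by simp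
  then show False using max_sep_le_maxcut[OF fin r uv] g unfolding gap_def by simp
qed

lemma gap_up:
  assumes fin: "finite E" and r: "r \<ge> 2" and uv: "u \<noteq> v" and j: "j \<noteq> u" "j \<noteq> v"
    and sep: "canon r E u \<noteq> canon r E v" and g: "gain E (canon r E) u v j = 1"
  shows "gap r u v (swap_at u v j E) = gap r u v E + 1"
proof -
  have r1: "r \<ge> 1" using r by simp
  have m: "max_sep r u v E = col_size E (canon r E)"
    using sep_gap_nonneg(1)[OF fin r1 sep] max_sep_le_maxcut[OF fin r uv] canon_props(2)[OF fin r1] by simp
  have "max_sep r u v (swap_at u v j E) \<ge> col_size (swap_at u v j E) (canon r E)"
    by (intro max_sep_ge finite_swap_at fin sep canon_props r1)
  then have "max_sep r u v (swap_at u v j E) = max_sep r u v E + 1"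
    using max_sep_swap_at_le[OF fin r uv j] col_size_swap_at[OF fin uv j, of "canon r E"] g m by linarith
  then show ?thesis unfolding gap_def max_joint_swap_at[OF fin uv j] by simp
qed

lemma gap_down:
  assumes fin: "finite E" and r: "r \<ge> 2" and uv: "u \<noteq> v" and j: "j \<noteq> u" "j \<noteq> v"
    and sep: "canon r E u \<noteq> canon r E v" and g: "gap r u v (swap_at u v j E) < gap r u v E"
  shows "gain E (canon r E) u v j = - 1"
proof -
  have r1: "r \<ge> 1" using r by simp
  have m: "max_sep r u v E = col_size E (canon r E)"
    using sep_gap_nonneg(1)[OF fin r1 sep] max_sep_le_maxcut[OF fin r uv] canon_props(2)[OF fin r1] by simp
  have "max_sep r u v (swap_at u v j E) \<ge> col_size (swap_at u v j E) (canon r E)"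
    by (intro max_sep_ge finite_swap_at fin sep canon_props r1)
  then show ?thesis
    using g col_size_swap_at[OF fin uv j, of "canon r E"] m gain_bounds(2)[of E "canon r E" u v j]
    unfolding gap_def max_joint_swap_at[OF fin uv j] by linarith
qed

text \<open>
The sum of all gains is minus the total slack of \<open>u\<close> and \<open>v\<close>, up to the contribution of the edge
\<open>{u, v}\<close>, which has the favourable sign.
\<close>

lemma downs_le_ups:
  assumes E: "E \<subseteq> all_pairs {..<n}" and u: "u < n" and v: "v < n"
    and sep: "canon r E u \<noteq> canon r E v"
  shows "real (downs n r u v E) \<le> real (ups n r u v E) + (slack n r E u (canon r E v) + slack n r E v (canon r E u))"
proof -
  define c where "c = canon r E"
  define J where "J = {..<n} - {u, v}"
  have uv: "u \<noteq> v" using sep by auto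
  have nl: "{x, x} \<notin> E" for x using E all_pairs_pair[of x x "{..<n}"] by auto
  define g :: "nat \<Rightarrow> int" where "g j = gain E c u v j" for j
  have g: "g j = of_bool (g j = 1) - of_bool (g j = - 1)" for j
    using gain_bounds[of E c u v j] unfolding g_def by (cases "gain E c u v j = 0") auto
  have "(\<Sum>j\<in>J. g j) = (\<Sum>j\<in>J. of_bool (g j = 1) - of_bool (g j = - 1))" by (intro sum.cong g refl)
  also have "\<dots> = int (ups n r u v E) - int (downs n r u v E)"
    unfolding ups_def downs_def J_def[symmetric] c_def[symmetric] g_def[symmetric]
    by (simp add: sum_subtractf of_bool_def sum.If_cases J_def Int_def)
  finally have 1: "(\<Sum>j\<in>J. g j) = int (ups n r u v E) - int (downs n r u v E)" .
  have "{..<n} = insert u (insert v J)" unfolding J_def using u v by auto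
  moreover have "u \<notin> insert v J" "v \<notin> J" "finite J" unfolding J_def using uv by auto
  ultimately have "(\<Sum>j<n. g j) = g u + (g v + (\<Sum>j\<in>J. g j))" by simp
  moreover have "g u \<le> 0" "g v \<le> 0" unfolding g_def gain_def using nl by auto
  ultimately have 2: "(\<Sum>j<n. g j) \<le> (\<Sum>j\<in>J. g j)" by linarith
  have gr: "real_of_int (g j) = (of_bool ({v, j} \<in> E) * of_bool (c j = c v) - of_bool ({v, j} \<in> E) * of_bool (c j = c u))
      + (of_bool ({u, j} \<in> E) * of_bool (c j = c u) - of_bool ({u, j} \<in> E) * of_bool (c j = c v))" for j
    unfolding g_def gain_def by (auto simp: of_bool_def)
  have d: "(\<Sum>j<n. of_bool ({x, j} \<in> E) * of_bool (c j = i)) = real (deg_in E x (colour_class n c i))" for x i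
    unfolding deg_in_eq_sum[OF finite_colour_class] unfolding colour_class_def by (rule sum.mono_neutral_cong_right) auto
  have "real_of_int (\<Sum>j<n. g j) = - (slack n r E u (c v) + slack n r E v (c u))"
    by (simp add: gr sum.distrib sum_subtractf d slack_def c_def[symmetric])
  then show ?thesis using 1 2 unfolding c_def[symmetric] by linarith
qed

lemma slack_nonneg:
  assumes E: "E \<subseteq> all_pairs {..<n}" and r: "r \<ge> 1" and u: "u < n" and i: "i \<in> {1..r}"
  shows "slack n r E u i \<ge> 0"
  using near_max_deg_in[OF E u near_max_canon[OF finite_edges[OF E] r] i] unfolding slack_def by simp

lemma swap_at_bij:
  assumes "u < n" "v < n" "j < n" "j \<noteq> u" "j \<noteq> v"
  shows "bij_betw (Transposition.transpose {u, j} {v, j}) (all_pairs {..<n}) (all_pairs {..<n})"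
proof -
  have "{u, j} \<in> all_pairs {..<n}" "{v, j} \<in> all_pairs {..<n}"
    using assms by (auto simp: all_pairs_pair)
  then have "Transposition.transpose {u, j} {v, j} ` all_pairs {..<n} = all_pairs {..<n}"
    by (simp add: transpose_image_eq)
  then show ?thesis unfolding bij_betw_def by (metis inj_on_subset inj_transpose subset_UNIV)
qed

text \<open>
Reversibility. The exchange at \<open>j\<close> preserves the law of the random graph, so passing from gap \<open>t\<close> to
gap \<open>t + 1\<close> is as likely as the converse. Every gain of 1 raises the gap, and only a gain of -1 can
lower it. In a graph of gap \<open>t + 1\<close> the chosen maximum cut separates \<open>u\<close> and \<open>v\<close> because the gap is positive,
so the separation constraint on the right-hand side costs nothing.
\<close>

lemma flow:
  assumes p: "0 \<le> p" "p \<le> 1" and r: "r \<ge> 2" and u: "u < n" and v: "v < n" and uv: "u \<noteq> v"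
    and t: "t \<ge> 0"
  shows "bin_exp (all_pairs {..<n}) p (\<lambda>E. of_bool (canon r E u \<noteq> canon r E v \<and> gap r u v E = t) * real (ups n r u v E))
    \<le> bin_exp (all_pairs {..<n}) p (\<lambda>E. of_bool (canon r E u \<noteq> canon r E v \<and> gap r u v E = t + 1) * real (downs n r u v E))"
proof -
  define P where "P = all_pairs {..<n}"
  define J where "J = {..<n} - {u, v}"
  have finJ: "finite J" unfolding J_def by simp
  have finP: "finite P" unfolding P_def by (simp add: finite_all_pairs)
  have fin: "finite E" if "E \<subseteq> P" for E using that unfolding P_def by (rule finite_edges)
  have card_sum: "real (card {j \<in> J. Q j}) = (\<Sum>j\<in>J. of_bool (Q j))" for Q
    using finJ by (simp add: of_bool_def sum.If_cases Int_def)
  define f where "f j E = (of_bool (gap r u v E = t \<and> gap r u v (swap_at u v j E) = t + 1) :: real)" for j E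
  have "bin_exp P p (\<lambda>E. of_bool (canon r E u \<noteq> canon r E v \<and> gap r u v E = t) * real (ups n r u v E))
     \<le> bin_exp P p (\<lambda>E. \<Sum>j\<in>J. f j E)"
  proof (rule bin_exp_mono[OF p])
    fix E assume E: "E \<subseteq> P"
    show "of_bool (canon r E u \<noteq> canon r E v \<and> gap r u v E = t) * real (ups n r u v E) \<le> (\<Sum>j\<in>J. f j E)"
    proof (cases "canon r E u \<noteq> canon r E v \<and> gap r u v E = t")
      case True
      have "real (ups n r u v E) = (\<Sum>j\<in>J. of_bool (gain E (canon r E) u v j = 1))"
        unfolding ups_def J_def[symmetric] by (rule card_sum)
      also have "\<dots> \<le> (\<Sum>j\<in>J. f j E)"
      proof (rule sum_mono)
        fix j assume "j \<in> J"
        then have j: "j \<noteq> u" "j \<noteq> v" by (auto simp: J_def)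
        show "of_bool (gain E (canon r E) u v j = 1) \<le> f j E"
          using gap_up[OF fin[OF E] r uv j] True unfolding f_def by auto
      qed
      finally show ?thesis using True by simp
    qed (auto simp: f_def sum_nonneg)
  qed
  also have "\<dots> = (\<Sum>j\<in>J. bin_exp P p (f j))" by (rule bin_exp_sum)
  also have "\<dots> = (\<Sum>j\<in>J. bin_exp P p (\<lambda>E. f j (swap_at u v j E)))"
  proof (rule sum.cong[OF refl])
    fix j assume "j \<in> J"
    then have "bij_betw (Transposition.transpose {u, j} {v, j}) P P"
      unfolding P_def using u v by (intro swap_at_bij) (auto simp: J_def)
    then show "bin_exp P p (f j) = bin_exp P p (\<lambda>E. f j (swap_at u v j E))"
      unfolding swap_at_def using finP by (simp add: bin_exp_perm)
  qed
  also have "\<dots> = bin_exp P p (\<lambda>E. \<Sum>j\<in>J. f j (swap_at u v j E))" by (simp add: bin_exp_sum)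
  also have "\<dots> \<le> bin_exp P p (\<lambda>E. of_bool (canon r E u \<noteq> canon r E v \<and> gap r u v E = t + 1) * real (downs n r u v E))"
  proof (rule bin_exp_mono[OF p])
    fix E assume E: "E \<subseteq> P"
    show "(\<Sum>j\<in>J. f j (swap_at u v j E))
       \<le> of_bool (canon r E u \<noteq> canon r E v \<and> gap r u v E = t + 1) * real (downs n r u v E)"
    proof (cases "gap r u v E = t + 1")
      case True
      have sep: "canon r E u \<noteq> canon r E v"
        by (rule gap_pos_sep[OF fin[OF E] r uv]) (use True t in simp)
      have "(\<Sum>j\<in>J. f j (swap_at u v j E)) \<le> (\<Sum>j\<in>J. of_bool (gain E (canon r E) u v j = - 1))"
      proof (rule sum_mono)
        fix j assume "j \<in> J"
        then have j: "j \<noteq> u" "j \<noteq> v" by (auto simp: J_def)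
        show "f j (swap_at u v j E) \<le> of_bool (gain E (canon r E) u v j = - 1)"
          using gap_down[OF fin[OF E] r uv j sep] True unfolding f_def swap_at_swap_at by auto
      qed
      also have "\<dots> = real (downs n r u v E)"
        unfolding downs_def J_def[symmetric] by (rule card_sum[symmetric])
      finally show ?thesis using True sep by simp
    next
      case False
      then show ?thesis by (simp add: f_def swap_at_swap_at)
    qed
  qed
  finally show ?thesis unfolding P_def .
qed

text \<open>
By \<open>flow\<close>, the weight of level \<open>t\<close> exceeds the weight of any higher level by at most the expected
slack; averaging over the \<open>J\<close> levels from \<open>t\<close> on bounds the weight of level \<open>t\<close>.
\<close>

lemma small_gap_bound:
  assumes p: "0 \<le> p" "p \<le> 1" and r: "r \<ge> 2" and u: "u < n" and v: "v < n" and J: "J > 0"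
  shows "bin_exp (all_pairs {..<n}) p (\<lambda>E. of_bool (canon r E u \<noteq> canon r E v \<and> gap r u v E \<le> int D) * real (ups n r u v E))
    \<le> (real D + 1) * bin_exp (all_pairs {..<n}) p (\<lambda>E. of_bool (canon r E u \<noteq> canon r E v) *
        (real (ups n r u v E) / real J + (slack n r E u (canon r E v) + slack n r E v (canon r E u))))"
proof (cases "u = v")
  case True
  then show ?thesis by (simp add: bin_exp_def)
next
  case uv: False
  define P where "P = all_pairs {..<n}"
  have finP: "finite P" unfolding P_def by (simp add: finite_all_pairs)
  have fin: "finite E" if "E \<subseteq> P" for E using that unfolding P_def by (rule finite_edges)
  define S where "S E \<longleftrightarrow> canon r E u \<noteq> canon r E v" for E
  define L where "L E = slack n r E u (canon r E v) + slack n r E v (canon r E u)" for E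
  define U where "U E = real (ups n r u v E)" for E
  have L0: "L E \<ge> 0" if "E \<subseteq> P" for E
  proof -
    have "canon r E w \<in> {1..r}" for w
      using canon_props(1)[OF fin[OF that], of r] r unfolding colourings_def by auto
    then show ?thesis unfolding L_def using that u v r unfolding P_def
      by (intro add_nonneg_nonneg slack_nonneg) auto
  qed
  define N where "N t = bin_exp P p (\<lambda>E. of_bool (S E \<and> gap r u v E = int t) * U E)" for t :: nat
  define M where "M = bin_exp P p (\<lambda>E. of_bool (S E) * L E)"
  have step: "N t \<le> N (Suc t) + bin_exp P p (\<lambda>E. of_bool (S E \<and> gap r u v E = int (Suc t)) * L E)" for t
  proof -
    have "N t \<le> bin_exp P p (\<lambda>E. of_bool (S E \<and> gap r u v E = int t + 1) * real (downs n r u v E))"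
      unfolding N_def S_def U_def P_def by (rule flow[OF p r u v uv]) simp
    also have "\<dots> \<le> bin_exp P p (\<lambda>E. of_bool (S E \<and> gap r u v E = int (Suc t)) * U E
        + of_bool (S E \<and> gap r u v E = int (Suc t)) * L E)"
    proof (rule bin_exp_mono[OF p])
      fix E assume "E \<subseteq> P"
      then have "S E \<Longrightarrow> real (downs n r u v E) \<le> U E + L E"
        unfolding U_def L_def S_def P_def by (intro downs_le_ups u v)
      then show "of_bool (S E \<and> gap r u v E = int t + 1) * real (downs n r u v E)
         \<le> of_bool (S E \<and> gap r u v E = int (Suc t)) * U E + of_bool (S E \<and> gap r u v E = int (Suc t)) * L E"
        by (auto simp: add.commute)
    qed
    finally show ?thesis unfolding bin_exp_add N_def .
  qed
  \<comment> \<open>Only graphs with gap above \<open>t\<close> contribute slack, and each of them at most once.\<close>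
  have iter: "N t \<le> N (t + i) + bin_exp P p (\<lambda>E. of_bool (S E \<and> int t < gap r u v E \<and> gap r u v E \<le> int (t + i)) * L E)" for t i
  proof (induction i)
    case 0
    have "(S E \<and> int t < gap r u v E \<and> gap r u v E \<le> int (t + 0)) = False" for E by auto
    then show ?case by (simp only: of_bool_def if_False mult_zero_left bin_exp_const[OF finP]) simp
  next
    case (Suc i)
    have "bin_exp P p (\<lambda>E. of_bool (S E \<and> gap r u v E = int (Suc (t + i))) * L E)
        + bin_exp P p (\<lambda>E. of_bool (S E \<and> int t < gap r u v E \<and> gap r u v E \<le> int (t + i)) * L E)
       = bin_exp P p (\<lambda>E. of_bool (S E \<and> int t < gap r u v E \<and> gap r u v E \<le> int (t + Suc i)) * L E)"
      unfolding bin_exp_add[symmetric] by (rule bin_exp_cong) (auto simp: of_bool_def)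
    then show ?case using Suc step[of "t + i"] by simp
  qed
  have NM: "N t \<le> N (t + i) + M" for t i
  proof -
    have "bin_exp P p (\<lambda>E. of_bool (S E \<and> int t < gap r u v E \<and> gap r u v E \<le> int (t + i)) * L E) \<le> M"
      unfolding M_def by (rule bin_exp_mono[OF p]) (auto simp: L0)
    then show ?thesis using iter[of t i] by linarith
  qed
  have sumN: "(\<Sum>s\<in>I. N s) \<le> bin_exp P p (\<lambda>E. of_bool (S E) * U E)" if I: "finite I" for I
  proof -
    have "(\<Sum>s\<in>I. N s) = bin_exp P p (\<lambda>E. \<Sum>s\<in>I. of_bool (S E \<and> gap r u v E = int s) * U E)"
      unfolding N_def by (rule bin_exp_sum[symmetric])
    also have "\<dots> \<le> bin_exp P p (\<lambda>E. of_bool (S E) * U E)"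
    proof (rule bin_exp_mono[OF p])
      fix E assume "E \<subseteq> P"
      have "(\<Sum>s\<in>I. of_bool (S E \<and> gap r u v E = int s) * U E)
          \<le> (\<Sum>s\<in>I. if s = nat (gap r u v E) then of_bool (S E) * U E else 0)"
        by (intro sum_mono) (auto simp: U_def)
      also have "\<dots> \<le> of_bool (S E) * U E" using I by (auto simp: U_def)
      finally show "(\<Sum>s\<in>I. of_bool (S E \<and> gap r u v E = int s) * U E) \<le> of_bool (S E) * U E" .
    qed
    finally show ?thesis .
  qed
  define T where "T = bin_exp P p (\<lambda>E. of_bool (S E) * (U E / real J + L E))"
  have T: "T = bin_exp P p (\<lambda>E. of_bool (S E) * U E) / real J + M"
  proof -
    have "T = bin_exp P p (\<lambda>E. (1 / real J) * (of_bool (S E) * U E) + of_bool (S E) * L E)"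
      unfolding T_def by (rule bin_exp_cong) (simp add: algebra_simps)
    then show ?thesis unfolding bin_exp_add bin_exp_cmult M_def by simp
  qed
  have NT: "N t \<le> T" for t
  proof -
    have "real J * N t = (\<Sum>i<J. N t)" by simp
    also have "\<dots> \<le> (\<Sum>i<J. N (t + i) + M)" by (intro sum_mono NM)
    also have "\<dots> = (\<Sum>s\<in>(+) t ` {..<J}. N s) + real J * M"
      by (simp add: sum.distrib sum.reindex)
    also have "\<dots> \<le> bin_exp P p (\<lambda>E. of_bool (S E) * U E) + real J * M"
      using sumN[of "(+) t ` {..<J}"] by simp
    also have "\<dots> = real J * T" using J unfolding T by (simp add: field_simps)
    finally show ?thesis using J by simp
  qed
  have "bin_exp P p (\<lambda>E. of_bool (S E \<and> gap r u v E \<le> int D) * U E) \<le> (\<Sum>t\<le>D. N t)"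
    unfolding N_def bin_exp_sum[symmetric]
  proof (rule bin_exp_mono[OF p])
    fix E assume E: "E \<subseteq> P"
    show "of_bool (S E \<and> gap r u v E \<le> int D) * U E \<le> (\<Sum>t\<le>D. of_bool (S E \<and> gap r u v E = int t) * U E)"
    proof (cases "S E \<and> gap r u v E \<le> int D")
      case True
      then have "gap r u v E \<ge> 0" using sep_gap_nonneg(2)[OF fin[OF E]] r unfolding S_def by simp
      then obtain t where t: "gap r u v E = int t" "t \<le> D" using True by (metis nonneg_int_cases of_nat_le_iff)
      have "of_bool (S E \<and> gap r u v E = int t) * U E \<le> (\<Sum>t\<le>D. of_bool (S E \<and> gap r u v E = int t) * U E)"
        by (rule member_le_sum) (use t in \<open>auto simp: U_def\<close>)
      then show ?thesis using True t by simp
    qed (auto simp: U_def intro!: sum_nonneg)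
  qed
  also have "\<dots> \<le> (\<Sum>t\<le>D. T)" by (intro sum_mono NT)
  also have "\<dots> = (real D + 1) * T" by simp
  finally show ?thesis unfolding T_def S_def U_def L_def P_def .
qed


section \<open>Few separated pairs have a small gap\<close>

lemma sum_by_class:
  assumes "c \<in> colourings r"
  shows "(\<Sum>v<n. h v) = (\<Sum>i\<in>{1..r}. \<Sum>v\<in>colour_class n c i. h v)"
proof -
  have "(\<Sum>i\<in>{1..r}. \<Sum>v\<in>{x \<in> {..<n}. c x = i}. h v) = (\<Sum>v<n. h v)"
    using assms by (intro sum.group) (auto simp: colourings_def)
  then show ?thesis unfolding colour_class_def ..
qed

text \<open>
Up to the pseudorandomness error, the slack summed over \<open>u\<close> in class \<open>a\<close> and \<open>v\<close> in class \<open>i\<close> is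
\<open>p\<close> times \<open>x i * x a * (x i - x a)\<close>, where \<open>x\<close> denotes class sizes. This is antisymmetric
in \<open>a\<close> and \<open>i\<close> and cancels in the sum over both.
\<close>

lemma sum_slack:
  assumes E: "E \<subseteq> all_pairs {..<n}" and J: "jumbled n p E" and r: "r \<ge> 1"
  shows "(\<Sum>u<n. \<Sum>v<n. slack n r E u (canon r E v)) \<le> 22 * real r * (real n)\<^sup>2 * sqrt (real n * p)"
proof -
  define q where "q = sqrt (real n * p)"
  define c where "c = canon r E"
  have c: "c \<in> colourings r" unfolding c_def by (rule canon_props(1)[OF finite_edges[OF E] r])
  define x where "x i = real (card (colour_class n c i))" for i
  have x0: "x i \<ge> 0" for i unfolding x_def by simp
  have sx: "(\<Sum>j\<in>{1..r}. x j) = real n"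
    unfolding x_def using sum_card_colour_class[OF c, of n] by (simp flip: of_nat_sum)
  have "(\<Sum>u<n. \<Sum>v<n. slack n r E u (c v)) = (\<Sum>u<n. \<Sum>i\<in>{1..r}. x i * slack n r E u i)"
  proof (rule sum.cong[OF refl])
    fix u
    have "(\<Sum>v<n. slack n r E u (c v)) = (\<Sum>i\<in>{1..r}. \<Sum>v\<in>colour_class n c i. slack n r E u (c v))"
      by (rule sum_by_class[OF c])
    also have "\<dots> = (\<Sum>i\<in>{1..r}. \<Sum>v\<in>colour_class n c i. slack n r E u i)"
      by (intro sum.cong refl) (simp add: colour_class_def)
    finally show "(\<Sum>v<n. slack n r E u (c v)) = (\<Sum>i\<in>{1..r}. x i * slack n r E u i)"
      by (simp add: x_def)
  qed
  also have "\<dots> = (\<Sum>i\<in>{1..r}. x i * (\<Sum>u<n. slack n r E u i))"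
    by (simp add: sum_distrib_left sum.swap[of _ "{..<n}"])
  also have "\<dots> = (\<Sum>i\<in>{1..r}. x i * (\<Sum>a\<in>{1..r}. edge_count E (colour_class n c a) (colour_class n c i) - edge_count E (colour_class n c a) (colour_class n c a)))"
  proof (rule sum.cong[OF refl])
    fix i
    have "(\<Sum>u<n. slack n r E u i) = (\<Sum>a\<in>{1..r}. \<Sum>u\<in>colour_class n c a. slack n r E u i)"
      by (rule sum_by_class[OF c])
    also have "\<dots> = (\<Sum>a\<in>{1..r}. edge_count E (colour_class n c a) (colour_class n c i) - edge_count E (colour_class n c a) (colour_class n c a))"
    proof (rule sum.cong[OF refl])
      fix a
      have "(\<Sum>u\<in>colour_class n c a. slack n r E u i)
          = (\<Sum>u\<in>colour_class n c a. real (deg_in E u (colour_class n c i)) - real (deg_in E u (colour_class n c a)))"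
        unfolding slack_def c_def by (intro sum.cong refl) (simp add: colour_class_def)
      then show "(\<Sum>u\<in>colour_class n c a. slack n r E u i) = edge_count E (colour_class n c a) (colour_class n c i) - edge_count E (colour_class n c a) (colour_class n c a)"
        by (simp add: edge_count_eq_deg_in sum_subtractf)
    qed
    finally show "x i * (\<Sum>u<n. slack n r E u i)
      = x i * (\<Sum>a\<in>{1..r}. edge_count E (colour_class n c a) (colour_class n c i) - edge_count E (colour_class n c a) (colour_class n c a))" by simp
  qed
  also have "\<dots> \<le> (\<Sum>i\<in>{1..r}. x i * (\<Sum>a\<in>{1..r}. (p * x a * x i - p * x a * x a) + 22 * real n * q))"
  proof (intro sum_mono mult_left_mono x0)
    fix i a
    show "edge_count E (colour_class n c a) (colour_class n c i) - edge_count E (colour_class n c a) (colour_class n c a)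
       \<le> (p * x a * x i - p * x a * x a) + 22 * real n * q"
      using jumbledD(1)[OF J colour_class_sub colour_class_sub, of c a c i] jumbledD(2)[OF J colour_class_sub colour_class_sub, of c a c a]
      unfolding x_def[symmetric] q_def[symmetric] by linarith
  qed
  also have "\<dots> = p * ((\<Sum>i\<in>{1..r}. \<Sum>a\<in>{1..r}. x i * x a * x i) - (\<Sum>i\<in>{1..r}. \<Sum>a\<in>{1..r}. x i * x a * x a))
      + (\<Sum>i\<in>{1..r}. x i) * (real r * (22 * real n * q))"
    by (simp add: sum.distrib sum_subtractf sum_distrib_left sum_distrib_right algebra_simps)
  also have "(\<Sum>i\<in>{1..r}. \<Sum>a\<in>{1..r}. x i * x a * x i) = (\<Sum>i\<in>{1..r}. \<Sum>a\<in>{1..r}. x i * x a * x a)"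
    by (subst sum.swap) (simp add: mult.commute)
  finally show ?thesis unfolding sx c_def q_def by (simp add: power2_eq_square mult_ac)
qed

lemma slack_same: "slack n r E u (canon r E u) = 0"
  unfolding slack_def by simp

lemma slack_le: "slack n r E u i \<le> real n"
proof -
  have "deg_in E u (colour_class n (canon r E) i) \<le> n" using deg_in_le[OF finite_colour_class] card_colour_class_le le_trans by blast
  then show ?thesis unfolding slack_def by linarith
qed

lemma ups_le_deg:
  "real (ups n r u v E) \<le> real (deg_in E u {..<n}) + real (deg_in E v {..<n})"
proof -
  have "{j \<in> {..<n} - {u, v}. gain E (canon r E) u v j = 1} \<subseteq> {j \<in> {..<n}. {u, j} \<in> E} \<union> {j \<in> {..<n}. {v, j} \<in> E}"
    unfolding gain_def by (auto simp: of_bool_def split: if_splits)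
  then have "ups n r u v E \<le> card ({j \<in> {..<n}. {u, j} \<in> E} \<union> {j \<in> {..<n}. {v, j} \<in> E})"
    unfolding ups_def by (intro card_mono) auto
  also have "\<dots> \<le> deg_in E u {..<n} + deg_in E v {..<n}" unfolding deg_in_def by (rule card_Un_le)
  finally show ?thesis by linarith
qed

lemma ups_le: "ups n r u v E \<le> n"
proof -
  have "ups n r u v E \<le> card {..<n}" unfolding ups_def by (intro card_mono) auto
  then show ?thesis by simp
qed

text \<open>
The sum over all pairs of \<open>small_gap_bound\<close>, with the number \<open>J\<close> of levels about \<open>sqrt (n p)\<close>, the choice
that balances the two terms.
\<close>

lemma expected_small_gaps:
  assumes p: "0 \<le> p" "p \<le> 1" and r: "r \<ge> 2" and np: "real n * p \<ge> 1"
  shows "bin_exp (all_pairs {..<n}) p (\<lambda>E. \<Sum>u<n. \<Sum>v<n.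
           of_bool (canon r E u \<noteq> canon r E v \<and> gap r u v E \<le> int D) * real (ups n r u v E))
    \<le> (real D + 1) * (71 * real r * (real n)\<^sup>2 * sqrt (real n * p))"
proof -
  define q where "q = sqrt (real n * p)"
  have q: "q \<ge> 1" "q\<^sup>2 = real n * p" unfolding q_def using np by auto
  have n: "n > 0" using np by (cases n) auto
  have r1: "r \<ge> 1" using r by simp
  define P where "P = all_pairs {..<n}"
  have finP: "finite P" unfolding P_def by (simp add: finite_all_pairs)
  \<comment> \<open>The average over \<open>J\<close> levels costs total weight over \<open>J\<close>, of order \<open>n\<^sup>3 p / q = n\<^sup>2 q\<close>, the same as the total slack.\<close>
  define J where "J = nat \<lceil>q\<rceil>"
  have J: "real J \<ge> q" "J > 0" unfolding J_def using q(1) by linarith+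
  define F where "F u v E = of_bool (canon r E u \<noteq> canon r E v) *
        (real (ups n r u v E) / real J + (slack n r E u (canon r E v) + slack n r E v (canon r E u)))" for u v E
  have Fle: "(\<Sum>u<n. \<Sum>v<n. F u v E) \<le> 68 * real r * (real n)\<^sup>2 * q + of_bool (\<not> jumbled n p E) * (3 * real n ^ 3)"
    if E: "E \<subseteq> P" for E
  proof (cases "jumbled n p E")
    case True
    have E': "E \<subseteq> all_pairs {..<n}" using E unfolding P_def .
    have X: "{..<n} \<subseteq> {..<n}" by simp
    have "(\<Sum>u<n. \<Sum>v<n. F u v E) \<le> (\<Sum>u<n. \<Sum>v<n. (real (deg_in E u {..<n}) + real (deg_in E v {..<n})) / q
        + (slack n r E u (canon r E v) + slack n r E v (canon r E u)))"
    proof (intro sum_mono)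
      fix u v
      have "real (ups n r u v E) / real J \<le> (real (deg_in E u {..<n}) + real (deg_in E v {..<n})) / q"
        using ups_le_deg[of n r u v E] J q(1) by (intro frac_le) auto
      moreover have "0 \<le> (real (deg_in E u {..<n}) + real (deg_in E v {..<n})) / q" using q(1) by simp
      ultimately show "F u v E \<le> (real (deg_in E u {..<n}) + real (deg_in E v {..<n})) / q
        + (slack n r E u (canon r E v) + slack n r E v (canon r E u))"
        unfolding F_def using slack_same[of n r E u] slack_same[of n r E v]
        by (cases "canon r E u = canon r E v") simp_all
    qed
    also have "\<dots> = (2 * real n * (\<Sum>u<n. real (deg_in E u {..<n}))) / q
        + ((\<Sum>u<n. \<Sum>v<n. slack n r E u (canon r E v)) + (\<Sum>u<n. \<Sum>v<n. slack n r E v (canon r E u)))"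
      by (simp add: sum.distrib sum_divide_distrib[symmetric] sum_distrib_left[symmetric] add_divide_distrib algebra_simps)
    also have "(\<Sum>u<n. \<Sum>v<n. slack n r E v (canon r E u)) = (\<Sum>u<n. \<Sum>v<n. slack n r E u (canon r E v))"
      by (rule sum.swap)
    also have "(\<Sum>u<n. real (deg_in E u {..<n})) = edge_count E {..<n} {..<n}" by (simp add: edge_count_eq_deg_in)
    finally have 1: "(\<Sum>u<n. \<Sum>v<n. F u v E) \<le> 2 * real n * edge_count E {..<n} {..<n} / q
      + 2 * (\<Sum>u<n. \<Sum>v<n. slack n r E u (canon r E v))" by simp
    have "edge_count E {..<n} {..<n} \<le> p * real n * real n + 11 * real n * q"
      using jumbledD(1)[OF True X X] unfolding q_def by simp
    also have "\<dots> = real n * q\<^sup>2 + 11 * (real n * q)" unfolding q(2) by (simp add: algebra_simps)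
    also have "\<dots> \<le> real n * q\<^sup>2 + 11 * (real n * q\<^sup>2)"
    proof -
      have "q \<le> q\<^sup>2" using q(1) by (simp add: self_le_power)
      then show ?thesis using mult_left_mono[of q "q\<^sup>2" "real n"] by simp
    qed
    finally have "2 * real n * edge_count E {..<n} {..<n} / q \<le> 2 * real n * (12 * (real n * q\<^sup>2)) / q"
      using q(1) by (intro divide_right_mono mult_left_mono) auto
    also have "\<dots> = 24 * (real n)\<^sup>2 * q" using q(1) by (simp add: power2_eq_square)
    also have "\<dots> \<le> 24 * real r * (real n)\<^sup>2 * q" using r q(1) by (intro mult_right_mono) auto
    finally have 2: "2 * real n * edge_count E {..<n} {..<n} / q \<le> 24 * real r * (real n)\<^sup>2 * q" .
    show ?thesis using 1 2 sum_slack[OF E' True r1] True unfolding q_def[symmetric] by simp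
  next
    case False
    have "(\<Sum>u<n. \<Sum>v<n. F u v E) \<le> (\<Sum>u<n. \<Sum>v<n. 3 * real n)"
    proof (intro sum_mono)
      fix u v
      have "real (ups n r u v E) / real J \<le> real n / 1"
        using ups_le[of n r u v E] J by (intro frac_le) auto
      then show "F u v E \<le> 3 * real n"
        unfolding F_def using slack_le[of n r E u "canon r E v"] slack_le[of n r E v "canon r E u"]
        by (auto simp: of_bool_def)
    qed
    also have "\<dots> = 3 * real n ^ 3" by (simp add: power3_eq_cube)
    finally show ?thesis using False q(1) by (simp add: add_increasing)
  qed
  have "bin_exp P p (\<lambda>E. \<Sum>u<n. \<Sum>v<n.
           of_bool (canon r E u \<noteq> canon r E v \<and> gap r u v E \<le> int D) * real (ups n r u v E))
     = (\<Sum>u<n. \<Sum>v<n. bin_exp P p (\<lambda>E. of_bool (canon r E u \<noteq> canon r E v \<and> gap r u v E \<le> int D) * real (ups n r u v E)))"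
    by (simp only: bin_exp_sum)
  also have "\<dots> \<le> (\<Sum>u<n. \<Sum>v<n. (real D + 1) * bin_exp P p (F u v))"
    unfolding F_def P_def by (intro sum_mono small_gap_bound[OF p r _ _ J(2)]) auto
  also have "\<dots> = (real D + 1) * bin_exp P p (\<lambda>E. \<Sum>u<n. \<Sum>v<n. F u v E)"
    by (simp only: bin_exp_sum sum_distrib_left)
  also have "\<dots> \<le> (real D + 1) * bin_exp P p (\<lambda>E. 68 * real r * (real n)\<^sup>2 * q + (3 * real n ^ 3) * of_bool (\<not> jumbled n p E))"
    using Fle by (intro mult_left_mono bin_exp_mono p) (simp_all add: mult.commute)
  also have "\<dots> = (real D + 1) * (68 * real r * (real n)\<^sup>2 * q + 3 * real n ^ 3 * bin_exp P p (\<lambda>E. of_bool (\<not> jumbled n p E)))"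
    using finP by (simp only: bin_exp_add bin_exp_cmult bin_exp_const)
  also have "\<dots> \<le> (real D + 1) * (68 * real r * (real n)\<^sup>2 * q + 3 * real n ^ 3 * (1 / real n))"
    unfolding P_def by (intro mult_left_mono add_left_mono prob_not_jumbled p np) auto
  also have "3 * real n ^ 3 * (1 / real n) = 3 * (1 * (real n)\<^sup>2 * 1)"
    using n by (simp add: power3_eq_cube power2_eq_square)
  also have "\<dots> \<le> 3 * (real r * (real n)\<^sup>2 * q)"
    using r q(1) by (intro mult_left_mono mult_mono) auto
  also have "68 * real r * (real n)\<^sup>2 * q + 3 * (real r * (real n)\<^sup>2 * q) = 71 * real r * (real n)\<^sup>2 * q" by simp
  finally show ?thesis unfolding P_def q_def by (simp add: mult_left_mono)
qed

section \<open>Rigidity of near-maximum cuts\<close>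

text \<open>
There is a fixed system of sets, each not much larger than \<open>n/r\<close>, such that every class of every
\<open>D\<close>-near-maximum colouring is contained in one of them.
\<close>

definition rigid :: "nat \<Rightarrow> nat \<Rightarrow> nat \<Rightarrow> real \<Rightarrow> nat set set \<Rightarrow> bool" where
  "rigid n r D \<beta> E \<longleftrightarrow> (\<exists>Q. (\<forall>j\<in>{1..r}. Q j \<subseteq> {..<n} \<and> real (card (Q j)) \<le> (1 / real r + \<beta>) * real n)
     \<and> (\<forall>c. near_max r D E c \<longrightarrow> (\<forall>i\<in>{1..r}. \<exists>j\<in>{1..r}. colour_class n c i \<subseteq> Q j)))"

lemma few_large_degrees:
  assumes J: "jumbled n p E" and np: "real n * p > 0" and B: "B \<subseteq> {..<n}" and \<gamma>: "\<gamma> > 0"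
  shows "real (card {v \<in> {..<n}. real (deg_in E v B) > p * real (card B) + \<gamma> * (real n * p)}) \<le> 11 * real n / (\<gamma> * sqrt (real n * p))"
proof -
  define q where "q = sqrt (real n * p)"
  have q: "q > 0" "q\<^sup>2 = real n * p" unfolding q_def using np by auto
  define U where "U = {v \<in> {..<n}. real (deg_in E v B) > p * real (card B) + \<gamma> * (real n * p)}"
  have f: "finite B" using B by (rule finite_subset) simp
  have "real (card U) * (p * real (card B) + \<gamma> * (real n * p)) = (\<Sum>u\<in>U. p * real (card B) + \<gamma> * (real n * p))" by simp
  also have "\<dots> \<le> edge_count E U B" unfolding edge_count_eq_deg_in[OF f] by (intro sum_mono) (auto simp: U_def)
  also have "\<dots> \<le> p * real (card U) * real (card B) + 11 * real n * q"
    unfolding q_def by (rule jumbledD(1)[OF J _ B]) (auto simp: U_def)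
  finally have "q * (real (card U) * \<gamma> * q) \<le> q * (11 * real n)"
    unfolding q(2)[symmetric] by (simp add: algebra_simps power2_eq_square)
  then have "real (card U) * \<gamma> * q \<le> 11 * real n" using q(1) by simp
  then show ?thesis unfolding U_def[symmetric] q_def[symmetric] using q(1) \<gamma> by (simp add: field_simps)
qed

lemma few_small_degrees:
  assumes J: "jumbled n p E" and np: "real n * p > 0" and B: "B \<subseteq> {..<n}" and \<gamma>: "\<gamma> > 0"
  shows "real (card {v \<in> {..<n}. real (deg_in E v B) < p * real (card B) - \<gamma> * (real n * p)}) \<le> 11 * real n / (\<gamma> * sqrt (real n * p))"
proof -
  define q where "q = sqrt (real n * p)"
  have q: "q > 0" "q\<^sup>2 = real n * p" unfolding q_def using np by auto
  define U where "U = {v \<in> {..<n}. real (deg_in E v B) < p * real (card B) - \<gamma> * (real n * p)}"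
  have f: "finite B" using B by (rule finite_subset) simp
  have "edge_count E U B \<le> (\<Sum>u\<in>U. p * real (card B) - \<gamma> * (real n * p))"
    unfolding edge_count_eq_deg_in[OF f] by (intro sum_mono) (auto simp: U_def)
  also have "\<dots> = real (card U) * (p * real (card B) - \<gamma> * (real n * p))" by simp
  finally have "edge_count E U B \<le> real (card U) * (p * real (card B) - \<gamma> * (real n * p))" .
  moreover have "edge_count E U B \<ge> p * real (card U) * real (card B) - 11 * real n * q"
    unfolding q_def by (rule jumbledD(2)[OF J _ B]) (auto simp: U_def)
  ultimately have "q * (real (card U) * \<gamma> * q) \<le> q * (11 * real n)"
    unfolding q(2)[symmetric] by (simp add: algebra_simps power2_eq_square)
  then have "real (card U) * \<gamma> * q \<le> 11 * real n" using q(1) by simp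
  then show ?thesis unfolding U_def[symmetric] q_def[symmetric] using q(1) \<gamma> by (simp add: field_simps)
qed

text \<open>
Exchanging at a neighbour \<open>j\<close> of \<open>u\<close> that has the colour of \<open>u\<close> and is not adjacent to \<open>v\<close> turns an edge
inside a class into a cut edge.
\<close>

lemma ups_ge:
  assumes E: "E \<subseteq> all_pairs {..<n}" and sep: "canon r E u \<noteq> canon r E v"
  defines "B \<equiv> {j \<in> colour_class n (canon r E) (canon r E u). {u, j} \<in> E}"
  shows "real (ups n r u v E) \<ge> real (card B) - real (deg_in E v B)"
proof -
  have nl: "{u, u} \<notin> E" using E all_pairs_pair[of u u "{..<n}"] by auto
  have finB: "finite B" unfolding B_def by simp
  have "B - {j \<in> B. {v, j} \<in> E} \<subseteq> {j \<in> {..<n} - {u, v}. gain E (canon r E) u v j = 1}"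
    using nl sep unfolding B_def colour_class_def gain_def by auto
  then have "card (B - {j \<in> B. {v, j} \<in> E}) \<le> ups n r u v E"
    unfolding ups_def by (intro card_mono) auto
  moreover have "card (B - {j \<in> B. {v, j} \<in> E}) = card B - deg_in E v B"
    unfolding deg_in_def using finB by (intro card_Diff_subset) auto
  ultimately show ?thesis by linarith
qed


text \<open>
For all but few pairs \<open>u, v\<close> separated by the chosen maximum cut, \<open>ups\<close> has order \<open>n p\<close>: the vertex \<open>u\<close> has
about \<open>n p / r\<close> neighbours in its own class, of which only a fraction \<open>p\<close> are adjacent to \<open>v\<close>. So the
hypothesis on the weighted sum bounds the number of separated pairs of small gap. A vertex outside the
small set \<open>X\<close> lies in few such pairs, and then its class in a near-maximum colouring is almost contained in
its class in the chosen maximum cut.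
\<close>

lemma rigid_of_few_small_gaps:
  assumes E: "E \<subseteq> all_pairs {..<n}" and J: "jumbled n p E" and r: "r \<ge> 2"
    and p: "0 \<le> p" "p \<le> 1 - \<delta>" and \<delta>: "0 < \<delta>"
    and np: "real n * p \<ge> 1" and D: "real D \<le> sqrt (real n * p)"
    and \<zeta>: "0 < \<zeta>" "\<zeta> \<le> \<beta> / 2" "\<zeta> \<le> 1 / (8 * real r)"
    and q1: "23 * real r / sqrt (real n * p) \<le> \<zeta>"
    and q2: "11 * (real r + 1) * (8 * real r) / (\<delta> * sqrt (real n * p)) \<le> \<zeta>\<^sup>2 / 2"
    and small: "(\<Sum>u<n. \<Sum>v<n. of_bool (canon r E u \<noteq> canon r E v \<and> gap r u v E \<le> int D) * real (ups n r u v E))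
        \<le> \<delta> / (4 * real r) * (\<zeta>\<^sup>2 / 2) * (real n)\<^sup>2 * (real n * p)"
  shows "rigid n r D \<beta> E"
proof -
  define q where "q = sqrt (real n * p)"
  have q: "q \<ge> 1" "q\<^sup>2 = real n * p" unfolding q_def using np by auto
  have n: "n > 0" using np by (cases n) auto
  have r1: "r \<ge> 1" and rpos: "real r > 0" using r by auto
  have fin: "finite E" using E by (rule finite_edges)
  define c0 where "c0 = canon r E"
  have c0: "c0 \<in> colourings r" unfolding c0_def by (rule canon_props(1)[OF fin r1])
  have c0r: "c0 w \<in> {1..r}" for w using c0 unfolding colourings_def by auto
  define \<gamma> where "\<gamma> = \<delta> / (8 * real r)"
  have \<gamma>: "\<gamma> > 0" unfolding \<gamma>_def using \<delta> r by simp
  have \<delta>1: "\<delta> \<le> 1" using p by linarith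
  define B where "B u = {j \<in> colour_class n c0 (c0 u). {u, j} \<in> E}" for u
  have Bsub: "B u \<subseteq> {..<n}" for u unfolding B_def colour_class_def by auto
  have cB: "card (B u) = deg_in E u (colour_class n c0 (c0 u))" for u unfolding B_def deg_in_def ..
  have bal: "\<bar>real (card (colour_class n c i)) - real n / real r\<bar> \<le> \<zeta> * real n"
    if "near_max r D E c" "i \<in> {1..r}" for c i
  proof -
    have "23 * real r * real n / q = (23 * real r / q) * real n" by simp
    also have "\<dots> \<le> \<zeta> * real n" using q1 unfolding q_def by (intro mult_right_mono) auto
    finally show ?thesis using near_max_balanced[OF E J that(1) np D that(2)] unfolding q_def by linarith
  qed
  have nm0: "near_max r D E c0" using near_max_canon[OF fin r1] unfolding near_max_def c0_def by simp
  define bad1 where "bad1 i = {u \<in> {..<n}. real (deg_in E u (colour_class n c0 i)) < p * real (card (colour_class n c0 i)) - \<gamma> * (real n * p)}" for i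
  define bad2 where "bad2 u = {v \<in> {..<n}. real (deg_in E v (B u)) > p * real (card (B u)) + \<gamma> * (real n * p)}" for u
  define Z where "Z u = {v \<in> {..<n}. c0 u \<noteq> c0 v \<and> gap r u v E \<le> int D}" for u
  define K where "K = 11 * real n / (\<gamma> * q)"
  have b1: "real (card (bad1 i)) \<le> K" for i
    unfolding bad1_def K_def q_def using np by (intro few_small_degrees[OF J _ colour_class_sub \<gamma>]) auto
  have b2: "real (card (bad2 u)) \<le> K" for u
    unfolding bad2_def K_def q_def using np by (intro few_large_degrees[OF J _ Bsub \<gamma>]) auto
  define bad where "bad = (\<Union>i\<in>{1..r}. bad1 i)"
  have "card bad \<le> (\<Sum>i\<in>{1..r}. card (bad1 i))" unfolding bad_def by (rule card_UN_le) simp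
  then have "real (card bad) \<le> (\<Sum>i\<in>{1..r}. real (card (bad1 i)))" by (simp flip: of_nat_sum)
  also have "\<dots> \<le> (\<Sum>i\<in>{1..r}. K)" by (intro sum_mono b1)
  finally have cbad: "real (card bad) \<le> real r * K" by simp
  define \<mu> where "\<mu> = \<delta> / (4 * real r) * (real n * p)"
  have \<mu>: "\<mu> > 0" unfolding \<mu>_def using \<delta> rpos np
    by (intro mult_pos_pos[of _ "real n * p"]) (auto intro: less_le_trans[of 0 1])
  \<comment> \<open>Few neighbours of \<open>u\<close> in its class are also adjacent to \<open>v\<close>.\<close>
  have ups_big: "real (ups n r u v E) \<ge> \<mu>"
    if uv: "u < n" "u \<notin> bad" "v < n" "v \<notin> bad2 u" and sep: "c0 u \<noteq> c0 v" for u v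
  proof -
    define x where "x = real (card (colour_class n c0 (c0 u)))"
    define d where "d = real (card (B u))"
    have "u \<notin> bad1 (c0 u)" using uv(2) c0r unfolding bad_def by blast
    then have d: "d \<ge> p * x - \<gamma> * (real n * p)" using uv(1) unfolding bad1_def d_def x_def cB by auto
    have x: "x \<ge> real n / real r - \<zeta> * real n" using bal[OF nm0 c0r, of u] unfolding x_def by linarith
    have "\<zeta> * real n \<le> 1 / (8 * real r) * real n" using \<zeta>(3) by (intro mult_right_mono) auto
    then have "x \<ge> 7 / (8 * real r) * real n" using x by (simp add: field_simps)
    then have "p * x \<ge> p * (7 / (8 * real r) * real n)" using p(1) by (intro mult_left_mono) auto
    moreover have "\<gamma> * (real n * p) \<le> 1 / (8 * real r) * (real n * p)"
      unfolding \<gamma>_def using \<delta>1 rpos np by (intro mult_right_mono divide_right_mono) auto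
    ultimately have d2: "d \<ge> 6 / (8 * real r) * (real n * p)" using d by (simp add: algebra_simps)
    have "v \<notin> bad2 u \<Longrightarrow> real (deg_in E v (B u)) \<le> p * d + \<gamma> * (real n * p)"
      using uv(3) unfolding bad2_def d_def by auto
    then have "real (ups n r u v E) \<ge> d - (p * d + \<gamma> * (real n * p))"
      using uv(4) ups_ge[OF E, of r u v] sep unfolding B_def c0_def d_def by auto
    moreover have "\<delta> * d \<le> (1 - p) * d" using p by (intro mult_right_mono) (auto simp: d_def)
    moreover have "\<delta> * (6 / (8 * real r) * (real n * p)) \<le> \<delta> * d" using d2 \<delta> by (intro mult_left_mono) auto
    ultimately have "real (ups n r u v E) \<ge> \<delta> * (6 / (8 * real r) * (real n * p)) - \<gamma> * (real n * p)"
      by (simp add: algebra_simps)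
    also have "\<delta> * (6 / (8 * real r) * (real n * p)) - \<gamma> * (real n * p) = 5 / 2 * \<mu>"
      unfolding \<gamma>_def \<mu>_def by (simp add: field_simps)
    finally show ?thesis using \<mu> by linarith
  qed
  have finZ: "finite (Z u)" for u unfolding Z_def by simp
  have Zcount: "(\<Sum>u<n. real (card (Z u))) \<le> \<zeta>\<^sup>2 * (real n)\<^sup>2"
  proof -
    have "\<mu> * real (card (Z u)) \<le> \<mu> * (of_bool (u \<in> bad) * real n + K)
        + (\<Sum>v<n. of_bool (c0 u \<noteq> c0 v \<and> gap r u v E \<le> int D) * real (ups n r u v E))" if u: "u < n" for u
    proof -
      have "real (card (Z u)) = (\<Sum>v<n. of_bool (v \<in> Z u))"
        using deg_in_eq_sum by (simp add: of_bool_def sum.If_cases Z_def Int_def)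
      then have "\<mu> * real (card (Z u)) = (\<Sum>v<n. \<mu> * of_bool (v \<in> Z u))" by (simp add: sum_distrib_left)
      also have "\<dots> \<le> (\<Sum>v<n. \<mu> * of_bool (u \<in> bad) + \<mu> * of_bool (v \<in> bad2 u)
           + of_bool (c0 u \<noteq> c0 v \<and> gap r u v E \<le> int D) * real (ups n r u v E))"
        using ups_big[OF u] \<mu> by (intro sum_mono) (auto simp: Z_def)
      also have "\<dots> = \<mu> * (of_bool (u \<in> bad) * real n + (\<Sum>v<n. of_bool (v \<in> bad2 u)))
          + (\<Sum>v<n. of_bool (c0 u \<noteq> c0 v \<and> gap r u v E \<le> int D) * real (ups n r u v E))"
        by (simp add: sum.distrib sum_distrib_left algebra_simps)
      also have "(\<Sum>v<n. of_bool (v \<in> bad2 u)) = real (card (bad2 u))"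
        by (simp add: of_bool_def sum.If_cases bad2_def Int_def)
      finally show ?thesis using b2[of u] \<mu> by (smt (verit) mult_left_mono)
    qed
    then have "(\<Sum>u<n. \<mu> * real (card (Z u))) \<le> (\<Sum>u<n. \<mu> * (of_bool (u \<in> bad) * real n + K)
        + (\<Sum>v<n. of_bool (c0 u \<noteq> c0 v \<and> gap r u v E \<le> int D) * real (ups n r u v E)))"
      by (intro sum_mono) auto
    also have "\<dots> = \<mu> * ((\<Sum>u<n. of_bool (u \<in> bad)) * real n + real n * K)
       + (\<Sum>u<n. \<Sum>v<n. of_bool (c0 u \<noteq> c0 v \<and> gap r u v E \<le> int D) * real (ups n r u v E))"
      by (simp add: sum.distrib flip: sum_distrib_left sum_distrib_right)
    also have "(\<Sum>u<n. of_bool (u \<in> bad)) = real (card bad)"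
    proof -
      have "bad \<subseteq> {..<n}" unfolding bad_def bad1_def by auto
      then show ?thesis by (simp add: Int_absorb1)
    qed
    also have "\<mu> * (real (card bad) * real n + real n * K) \<le> \<mu> * (real r * K * real n + real n * K)"
      using cbad \<mu> by (intro mult_left_mono add_right_mono mult_right_mono) auto
    also have "\<mu> * (real r * K * real n + real n * K) = \<mu> * (11 * (real r + 1) * (8 * real r) / (\<delta> * q)) * (real n)\<^sup>2"
      unfolding K_def \<gamma>_def using \<delta> rpos q(1) by (simp add: field_simps power2_eq_square)
    also have "\<dots> \<le> \<mu> * (\<zeta>\<^sup>2 / 2) * (real n)\<^sup>2"
      using q2 \<mu> unfolding q_def by (intro mult_right_mono mult_left_mono) auto
    also have "(\<Sum>u<n. \<Sum>v<n. of_bool (c0 u \<noteq> c0 v \<and> gap r u v E \<le> int D) * real (ups n r u v E))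
       \<le> \<mu> * (\<zeta>\<^sup>2 / 2) * (real n)\<^sup>2"
      using small unfolding c0_def \<mu>_def by (simp add: algebra_simps)
    finally have "\<mu> * (\<Sum>u<n. real (card (Z u))) \<le> \<mu> * (\<zeta>\<^sup>2 * (real n)\<^sup>2)"
      by (simp add: sum_distrib_left algebra_simps)
    then show ?thesis using \<mu> by simp
  qed
  define X where "X = {u \<in> {..<n}. real (card (Z u)) > \<zeta> * real n}"
  have cX: "real (card X) \<le> \<zeta> * real n"
  proof -
    have "real (card X) * (\<zeta> * real n) = (\<Sum>u\<in>X. \<zeta> * real n)" by simp
    also have "\<dots> \<le> (\<Sum>u\<in>X. real (card (Z u)))" by (intro sum_mono) (auto simp: X_def)
    also have "\<dots> \<le> (\<Sum>u<n. real (card (Z u)))" by (intro sum_mono2) (auto simp: X_def)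
    also have "\<dots> \<le> (\<zeta> * real n) * (\<zeta> * real n)" using Zcount by (simp add: power2_eq_square algebra_simps)
    finally show ?thesis using \<zeta>(1) n by simp
  qed
  define Q where "Q j = colour_class n c0 j \<union> X" for j
  show ?thesis
    unfolding rigid_def
  proof (intro exI[of _ Q] conjI ballI allI impI)
    fix j assume j: "j \<in> {1..r}"
    show "Q j \<subseteq> {..<n}" unfolding Q_def X_def colour_class_def by auto
    have "real (card (Q j)) \<le> real (card (colour_class n c0 j)) + real (card X)"
      unfolding Q_def using card_Un_le[of "colour_class n c0 j" X] by linarith
    also have "\<dots> \<le> real n / real r + 2 * \<zeta> * real n"
      using bal[OF nm0 j] cX by linarith
    also have "\<dots> \<le> real n / real r + \<beta> * real n"
      using \<zeta>(2) by (intro add_left_mono mult_right_mono) auto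
    finally show "real (card (Q j)) \<le> (1 / real r + \<beta>) * real n" by (simp add: algebra_simps)
  next
    fix c i assume nm: "near_max r D E c" and i: "i \<in> {1..r}"
    have c: "c \<in> colourings r" and mc: "maxcut r E \<le> col_size E c + D" using nm unfolding near_max_def by auto
    have sub: "colour_class n c i - colour_class n c0 (c0 u) \<subseteq> Z u" if u: "u \<in> colour_class n c i" for u
    proof
      fix v assume v: "v \<in> colour_class n c i - colour_class n c0 (c0 u)"
      have same: "c u = c v" and sep: "c0 u \<noteq> c0 v" and "v < n" using u v by (auto simp: colour_class_def)
      have uv: "u \<noteq> v" using sep by auto
      have "maxcut r E \<le> max_joint r u v E + D" using mc max_joint_ge[OF fin c same] by linarith
      then have "gap r u v E \<le> int D" using max_sep_le_maxcut[OF fin r uv] unfolding gap_def by linarith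
      then show "v \<in> Z u" using sep \<open>v < n\<close> unfolding Z_def by auto
    qed
    have small: "real (card (colour_class n c i - colour_class n c0 (c0 u))) \<le> \<zeta> * real n" if u: "u \<in> colour_class n c i" "u \<notin> X" for u
    proof -
      have "card (colour_class n c i - colour_class n c0 (c0 u)) \<le> card (Z u)" using sub[OF u(1)] finZ by (rule card_mono[rotated])
      moreover have "real (card (Z u)) \<le> \<zeta> * real n" using u unfolding X_def colour_class_def by auto
      ultimately show ?thesis by linarith
    qed
    show "\<exists>j\<in>{1..r}. colour_class n c i \<subseteq> Q j"
    proof (cases "colour_class n c i \<subseteq> X")
      case True
      then show ?thesis using i unfolding Q_def by blast
    next
      case False
      then obtain u where u: "u \<in> colour_class n c i" "u \<notin> X" by blast
      have "colour_class n c i \<subseteq> Q (c0 u)"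
      proof
        fix v assume v: "v \<in> colour_class n c i"
        show "v \<in> Q (c0 u)"
        proof (rule ccontr)
          assume nv: "v \<notin> Q (c0 u)"
          then have vX: "v \<notin> X" and ne: "c0 v \<noteq> c0 u" using v unfolding Q_def colour_class_def by auto
          \<comment> \<open>Two vertices of this class from different classes of the chosen maximum cut would force it to be almost empty.\<close>
          have "colour_class n c i \<subseteq> (colour_class n c i - colour_class n c0 (c0 u)) \<union> (colour_class n c i - colour_class n c0 (c0 v))"
            using ne by (auto simp: colour_class_def)
          then have "card (colour_class n c i) \<le> card ((colour_class n c i - colour_class n c0 (c0 u)) \<union> (colour_class n c i - colour_class n c0 (c0 v)))"
            by (intro card_mono) auto
          also have "\<dots> \<le> card (colour_class n c i - colour_class n c0 (c0 u)) + card (colour_class n c i - colour_class n c0 (c0 v))"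
            by (rule card_Un_le)
          finally have "real (card (colour_class n c i)) \<le> 2 * \<zeta> * real n" using small[OF u] small[OF v vX] by linarith
          moreover have "real (card (colour_class n c i)) \<ge> real n / real r - \<zeta> * real n"
            using bal[OF nm i] by linarith
          ultimately have "real n / real r \<le> 3 * \<zeta> * real n" by linarith
          also have "\<dots> \<le> 3 * (1 / (8 * real r)) * real n" using \<zeta>(3) by (intro mult_right_mono) auto
          finally have "real n * (8 * real r) \<le> real n * (3 * real r)" using rpos by (simp add: field_simps)
          then show False using n rpos by simp
        qed
      qed
      then show ?thesis using c0r by blast
    qed
  qed
qed

lemma prob_not_rigid:
  assumes r: "r \<ge> 2" and \<beta>: "\<beta> > 0" and \<delta>: "\<delta> > 0" and \<eta>: "\<eta> > 0"
  shows "\<exists>\<Lambda> \<kappa>. \<kappa> > 0 \<and> (\<forall>n p D. 0 \<le> p \<longrightarrow> p \<le> 1 - \<delta> \<longrightarrow> \<Lambda> \<le> sqrt (real n * p) \<longrightarrow> \<Lambda> \<le> real n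
      \<longrightarrow> real D + 1 \<le> \<kappa> * sqrt (real n * p)
      \<longrightarrow> bin_exp (all_pairs {..<n}) p (\<lambda>E. of_bool (\<not> rigid n r D \<beta> E)) \<le> \<eta>)"
proof -
  define \<zeta> where "\<zeta> = min (\<beta> / 2) (1 / (8 * real r))"
  have \<zeta>: "0 < \<zeta>" "\<zeta> \<le> \<beta> / 2" "\<zeta> \<le> 1 / (8 * real r)" unfolding \<zeta>_def using \<beta> r by auto
  define \<nu> where "\<nu> = \<delta> / (4 * real r) * (\<zeta>\<^sup>2 / 2)"
  have \<nu>: "\<nu> > 0" unfolding \<nu>_def using \<delta> r \<zeta>(1) by simp
  define \<Lambda> where "\<Lambda> = max (max 1 (23 * real r / \<zeta>)) (max (11 * (real r + 1) * (8 * real r) / (\<delta> * (\<zeta>\<^sup>2 / 2))) (2 / \<eta>))"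
  define \<kappa> where "\<kappa> = min 1 (\<eta> / 2 * \<nu> / (71 * real r))"
  have \<kappa>: "\<kappa> > 0" "\<kappa> \<le> 1" "\<kappa> * (71 * real r) \<le> \<eta> / 2 * \<nu>" 
    unfolding \<kappa>_def using \<eta> \<nu> r by (auto simp: min_def field_simps)
  show ?thesis
  proof (rule exI[of _ \<Lambda>], rule exI[of _ \<kappa>], intro conjI allI impI \<kappa>(1))
    fix n D :: nat and p :: real
    assume p: "0 \<le> p" "p \<le> 1 - \<delta>" and L: "\<Lambda> \<le> sqrt (real n * p)" "\<Lambda> \<le> real n"
      and D: "real D + 1 \<le> \<kappa> * sqrt (real n * p)"
    define q where "q = sqrt (real n * p)"
    have Lge: "\<Lambda> \<ge> 1" "\<Lambda> \<ge> 23 * real r / \<zeta>" "\<Lambda> \<ge> 11 * (real r + 1) * (8 * real r) / (\<delta> * (\<zeta>\<^sup>2 / 2))" "\<Lambda> \<ge> 2 / \<eta>"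
      unfolding \<Lambda>_def by auto
    have q: "q \<ge> 1" using L(1) Lge(1) unfolding q_def by linarith
    have q2: "q\<^sup>2 = real n * p" unfolding q_def using p by simp
    have np: "real n * p \<ge> 1" using q q2 one_le_power[OF q, of 2] by simp
    have n: "real n > 0" using L(2) Lge(1) by linarith
    have p1: "p \<le> 1" using p \<delta> by linarith
    have "\<kappa> * q \<le> 1 * q" using \<kappa> q by (intro mult_right_mono) auto
    then have Dq: "real D \<le> q" using D unfolding q_def[symmetric] by linarith
    have "23 * real r / \<zeta> \<le> q" using L(1) Lge(2) unfolding q_def by linarith
    then have c1: "23 * real r / q \<le> \<zeta>" using \<zeta>(1) q by (simp add: field_simps)
    have "11 * (real r + 1) * (8 * real r) / (\<delta> * (\<zeta>\<^sup>2 / 2)) \<le> q" using L(1) Lge(3) unfolding q_def by linarith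
    then have c2: "11 * (real r + 1) * (8 * real r) / (\<delta> * q) \<le> \<zeta>\<^sup>2 / 2" using \<zeta>(1) q \<delta> by (simp add: field_simps)
    define P where "P = all_pairs {..<n}"
    have finP: "finite P" unfolding P_def by (simp add: finite_all_pairs)
    define F where "F E = (\<Sum>u<n. \<Sum>v<n. of_bool (canon r E u \<noteq> canon r E v \<and> gap r u v E \<le> int D) * real (ups n r u v E))" for E
    define t where "t = \<nu> * (real n)\<^sup>2 * (real n * p)"
    have t: "t > 0" unfolding t_def using \<nu> n np
      by (intro mult_pos_pos[of _ "real n * p"]) (auto intro: less_le_trans[of 0 1])
    have "bin_exp P p (\<lambda>E. of_bool (\<not> rigid n r D \<beta> E)) \<le> bin_exp P p (\<lambda>E. of_bool (\<not> jumbled n p E) + of_bool (F E \<ge> t))"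
    proof (rule bin_exp_mono[OF p(1) p1])
      fix E assume E: "E \<subseteq> P"
      have "rigid n r D \<beta> E" if "jumbled n p E" "\<not> F E \<ge> t"
        by (rule rigid_of_few_small_gaps[OF _ that(1) r p \<delta> np _ \<zeta>])
          (use E that(2) Dq c1 c2 in \<open>auto simp: P_def q_def F_def t_def \<nu>_def\<close>)
      then show "of_bool (\<not> rigid n r D \<beta> E) \<le> (of_bool (\<not> jumbled n p E) + of_bool (F E \<ge> t) :: real)" by auto
    qed
    also have "\<dots> = bin_exp P p (\<lambda>E. of_bool (\<not> jumbled n p E)) + bin_exp P p (\<lambda>E. of_bool (F E \<ge> t))"
      by (rule bin_exp_add)
    also have "\<dots> \<le> 1 / real n + bin_exp P p F / t"
      unfolding P_def
      by (intro add_mono prob_not_jumbled p(1) p1 np bin_exp_markov t)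
        (auto simp: F_def finite_all_pairs intro!: sum_nonneg)
    finally have 1: "bin_exp P p (\<lambda>E. of_bool (\<not> rigid n r D \<beta> E)) \<le> 1 / real n + bin_exp P p F / t" .
    have "bin_exp P p F / t \<le> (real D + 1) * (71 * real r * (real n)\<^sup>2 * q) / t"
      unfolding P_def F_def q_def
      by (intro divide_right_mono expected_small_gaps p(1) p1 r np) (use t in auto)
    also have "\<dots> \<le> \<kappa> * q * (71 * real r * (real n)\<^sup>2 * q) / t"
      using D q t unfolding q_def[symmetric] by (intro divide_right_mono mult_right_mono) auto
    also have "\<dots> = (\<kappa> * (71 * real r)) * ((real n)\<^sup>2 * q\<^sup>2) / t" by (simp add: power2_eq_square)
    also have "\<dots> \<le> (\<eta> / 2 * \<nu>) * ((real n)\<^sup>2 * q\<^sup>2) / t"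
      using \<kappa>(3) t by (intro divide_right_mono mult_right_mono) auto
    also have "\<dots> = \<eta> / 2 * (t / t)" unfolding q2 t_def by simp
    also have "\<dots> = \<eta> / 2" using t by simp
    finally have 2: "bin_exp P p F / t \<le> \<eta> / 2" .
    have 3: "1 / real n \<le> \<eta> / 2"
    proof -
      have "2 / \<eta> \<le> real n" using L(2) Lge(4) by linarith
      then show ?thesis using \<eta> n by (simp add: field_simps)
    qed
    show "bin_exp (all_pairs {..<n}) p (\<lambda>E. of_bool (\<not> rigid n r D \<beta> E)) \<le> \<eta>"
      using 1 2 3 unfolding P_def by linarith
  qed
qed


section \<open>Common neighbourhoods\<close>

text \<open>
The set of common neighbours of \<open>W\<close>.
\<close>

definition common_nbrs :: "nat \<Rightarrow> nat set set \<Rightarrow> nat set \<Rightarrow> nat set" where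
  "common_nbrs n E W = {v \<in> {..<n}. \<forall>w\<in>W. {v, w} \<in> E}"

text \<open>
The edge set of the star joining \<open>v\<close> to all vertices of \<open>W\<close>.
\<close>

definition joins :: "nat set \<Rightarrow> nat \<Rightarrow> nat set set" where
  "joins W v = (\<lambda>w. {v, w}) ` W"

lemma finite_common_nbrs [simp]: "finite (common_nbrs n E W)" unfolding common_nbrs_def by simp

lemma joins_sub: "W \<subseteq> {..<n} \<Longrightarrow> v < n \<Longrightarrow> v \<notin> W \<Longrightarrow> joins W v \<subseteq> all_pairs {..<n}"
  unfolding joins_def by (auto simp: all_pairs_pair)

lemma card_joins: "finite W \<Longrightarrow> card (joins W v) = card W"
  unfolding joins_def by (intro card_image inj_onI) (auto simp: doubleton_eq_iff)

lemma joins_disjoint: "disjoint_family_on (joins W) (X - W)"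
  unfolding disjoint_family_on_def joins_def by (auto simp: doubleton_eq_iff)

lemma joins_iff: "v < n \<Longrightarrow> joins W v \<subseteq> E \<longleftrightarrow> v \<in> common_nbrs n E W"
  unfolding joins_def common_nbrs_def by auto

lemma common_nbrs_disjoint: "E \<subseteq> all_pairs {..<n} \<Longrightarrow> common_nbrs n E W \<inter> W = {}"
  unfolding common_nbrs_def using all_pairs_pair by (fastforce simp: all_pairs_def)

lemma card_UN_joins:
  assumes "finite W" "finite S" "S \<inter> W = {}"
  shows "card (\<Union>v\<in>S. joins W v) = card S * card W"
proof -
  have "card (\<Union>v\<in>S. joins W v) = (\<Sum>v\<in>S. card (joins W v))"
  proof (rule card_UN_disjoint)
    show "\<forall>i\<in>S. \<forall>j\<in>S. i \<noteq> j \<longrightarrow> joins W i \<inter> joins W j = {}"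
      using joins_disjoint[of W S] assms(3) unfolding disjoint_family_on_def by blast
  qed (use assms in \<open>auto simp: joins_def\<close>)
  then show ?thesis using assms by (simp add: card_joins)
qed

lemma prob_few_common_nbrs:
  assumes p: "0 \<le> p" "p \<le> 1" and W: "W \<subseteq> {..<n}" "card W = k"
    and \<epsilon>: "0 < \<epsilon>" "\<epsilon> \<le> 1" and n: "real k \<le> \<epsilon> / 4 * real n"
  shows "bin_exp (all_pairs {..<n}) p (\<lambda>E. of_bool (real (card (common_nbrs n E W)) < (1 - \<epsilon>) * real n * p ^ k))
    \<le> exp (- (\<epsilon>\<^sup>2 / 16) * (real n * p ^ k))"
proof -
  define P where "P = all_pairs {..<n}"
  have finP: "finite P" unfolding P_def by (simp add: finite_all_pairs)
  have finW: "finite W" using W(1) by (rule finite_subset) simp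
  have kn: "k \<le> n" using card_mono[OF finite_lessThan W(1)] W(2) by simp
  define a where "a = (1 - \<epsilon>) * real n * p ^ k"
  \<comment> \<open>The parameter of the exponential moment; any small enough constant multiple of \<open>\<epsilon>\<close> would do.\<close>
  define l where "l = \<epsilon> / 8"
  have l: "0 < l" "l \<le> 1 / 8" unfolding l_def using \<epsilon> by auto
  define f where "f E = (\<Prod>v\<in>{..<n} - W. 1 + (- l) * of_bool (joins W v \<subseteq> E))" for E
  have fE: "f E = (1 - l) ^ card (common_nbrs n E W)" if E: "E \<subseteq> P" for E
  proof -
    have "f E = (\<Prod>v\<in>{..<n} - W. if v \<in> common_nbrs n E W then 1 - l else 1)"
      unfolding f_def
    proof (intro prod.cong refl)
      fix v assume "v \<in> {..<n} - W"
      then have "joins W v \<subseteq> E \<longleftrightarrow> v \<in> common_nbrs n E W" by (intro joins_iff) simp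
      then show "1 + - l * of_bool (joins W v \<subseteq> E) = (if v \<in> common_nbrs n E W then 1 - l else 1)" by simp
    qed
    also have "\<dots> = (1 - l) ^ card (({..<n} - W) \<inter> common_nbrs n E W)"
      by (simp add: prod.If_cases)
    also have "({..<n} - W) \<inter> common_nbrs n E W = common_nbrs n E W"
      using common_nbrs_disjoint[of E n W] E unfolding P_def by (auto simp: common_nbrs_def)
    finally show ?thesis .
  qed
  have "bin_exp P p f = (\<Prod>v\<in>{..<n} - W. 1 + (- l) * p ^ card (joins W v))"
    unfolding f_def by (rule bin_exp_prod[OF finP _ _ joins_disjoint]) (use joins_sub[OF W(1)] in \<open>auto simp: P_def\<close>)
  also have "\<dots> = (1 - l * p ^ k) ^ (n - k)"
    using W finW by (simp add: card_joins card_Diff_subset)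
  also have "\<dots> \<le> exp (- (l * p ^ k)) ^ (n - k)"
  proof (rule power_mono)
    have "p ^ k \<le> 1" using p by (simp add: power_le_one)
    then have "l * p ^ k \<le> 1 * 1" using l p by (intro mult_mono) auto
    then show "0 \<le> 1 - l * p ^ k" by simp
    show "1 - l * p ^ k \<le> exp (- (l * p ^ k))" using exp_ge_add_one_self[of "- (l * p ^ k)"] by linarith
  qed
  also have "\<dots> = exp (- (l * p ^ k * (real n - real k)))"
    using kn by (simp add: exp_of_nat_mult[symmetric] of_nat_diff algebra_simps)
  finally have m: "bin_exp P p f \<le> exp (- (l * p ^ k * (real n - real k)))" .
  have lb: "exp (- (l + 2 * l\<^sup>2)) \<le> 1 - l"
  proof -
    have "- l - 2 * l\<^sup>2 \<le> ln (1 - l)" using l by (intro ln_one_minus_pos_lower_bound) auto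
    then have "exp (- l - 2 * l\<^sup>2) \<le> exp (ln (1 - l))" by (simp only: exp_le_cancel_iff)
    then show ?thesis using l by simp
  qed
  have "bin_exp P p (\<lambda>E. of_bool (real (card (common_nbrs n E W)) < a)) \<le> bin_exp P p (\<lambda>E. exp ((l + 2 * l\<^sup>2) * a) * f E)"
  proof (rule bin_exp_mono[OF p])
    fix E assume E: "E \<subseteq> P"
    show "of_bool (real (card (common_nbrs n E W)) < a) \<le> exp ((l + 2 * l\<^sup>2) * a) * f E"
    proof (cases "real (card (common_nbrs n E W)) < a")
      case True
      have "exp (- ((l + 2 * l\<^sup>2) * a)) \<le> exp (- ((l + 2 * l\<^sup>2) * real (card (common_nbrs n E W))))"
        using True l by (simp add: mult_left_mono)
      also have "\<dots> = exp (- (l + 2 * l\<^sup>2)) ^ card (common_nbrs n E W)"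
        by (simp add: exp_of_nat_mult[symmetric] algebra_simps)
      also have "\<dots> \<le> f E" unfolding fE[OF E] by (intro power_mono lb) simp
      finally have "exp ((l + 2 * l\<^sup>2) * a) * exp (- ((l + 2 * l\<^sup>2) * a)) \<le> exp ((l + 2 * l\<^sup>2) * a) * f E"
        by (intro mult_left_mono) auto
      then show ?thesis using True by (simp add: exp_add[symmetric])
    next
      case False
      then show ?thesis using l by (simp add: fE[OF E])
    qed
  qed
  also have "\<dots> \<le> exp ((l + 2 * l\<^sup>2) * a) * exp (- (l * p ^ k * (real n - real k)))"
    unfolding bin_exp_cmult using m by (intro mult_left_mono) auto
  also have "\<dots> = exp ((l + 2 * l\<^sup>2) * a - l * p ^ k * (real n - real k))"
    by (simp add: exp_add[symmetric])
  also have "\<dots> \<le> exp (- (\<epsilon>\<^sup>2 / 16) * (real n * p ^ k))"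
  proof -
    define y where "y = real n * p ^ k"
    have y: "y \<ge> 0" unfolding y_def using p by simp
    have "(l + 2 * l\<^sup>2) * a = (l + 2 * l\<^sup>2) * (1 - \<epsilon>) * y" unfolding a_def y_def by simp
    also have "\<dots> \<le> (l * (1 - \<epsilon>) + 2 * l\<^sup>2) * y"
      using y l \<epsilon> by (intro mult_right_mono) (auto simp: algebra_simps)
    finally have 1: "(l + 2 * l\<^sup>2) * a \<le> (l * (1 - \<epsilon>) + 2 * l\<^sup>2) * y" .
    have "l * p ^ k * real k \<le> l * p ^ k * (\<epsilon> / 4 * real n)"
      using l p n by (intro mult_left_mono) auto
    then have 2: "- (l * p ^ k * (real n - real k)) \<le> (l * (\<epsilon> / 4) - l) * y"
      unfolding y_def by (simp add: algebra_simps)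
    have "(l * (1 - \<epsilon>) + 2 * l\<^sup>2) * y + (l * (\<epsilon> / 4) - l) * y = - (\<epsilon>\<^sup>2 / 16) * y"
      unfolding l_def by (simp add: field_simps power2_eq_square)
    then have "(l + 2 * l\<^sup>2) * a - l * p ^ k * (real n - real k) \<le> - (\<epsilon>\<^sup>2 / 16) * y" using 1 2 by linarith
    then show ?thesis unfolding y_def by simp
  qed
  finally show ?thesis unfolding P_def a_def .
qed

lemma col_size_mono: "finite E' \<Longrightarrow> E \<subseteq> E' \<Longrightarrow> col_size E c \<le> col_size E' c"
  unfolding col_size_def by (intro card_mono) auto

lemma col_size_Un_le:
  assumes "finite E" "finite K" shows "col_size (E \<union> K) c \<le> col_size E c + card K"
proof -
  have "col_size (E \<union> K) c \<le> card ({e \<in> E. bichromatic c e} \<union> K)"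
    unfolding col_size_def using assms by (intro card_mono) auto
  also have "\<dots> \<le> col_size E c + card K" unfolding col_size_def by (rule card_Un_le)
  finally show ?thesis .
qed

text \<open>
A maximum cut stays near-maximum when a set of added edges is replaced by another one.
\<close>

lemma near_max_transfer:
  assumes fin: "finite E" "finite K" "finite K'" and r: "r \<ge> 1" and c: "near_max r 0 (E \<union> K) c"
  shows "near_max r (card K + card K') (E \<union> K') c"
proof -
  have col: "c \<in> colourings r" using c unfolding near_max_def by simp
  obtain c' where c': "c' \<in> colourings r" "col_size (E \<union> K') c' = maxcut r (E \<union> K')"
    using maxcut_attained[of "E \<union> K'" r] fin r by auto
  have "maxcut r (E \<union> K') \<le> col_size E c' + card K'" using col_size_Un_le[OF fin(1,3), of c'] c' by simp
  also have "col_size E c' \<le> col_size (E \<union> K) c'" using fin by (intro col_size_mono) auto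
  also have "col_size (E \<union> K) c' \<le> col_size (E \<union> K) c"
    using col_size_le_maxcut[OF _ c'(1), of "E \<union> K"] c fin unfolding near_max_def by simp
  also have "col_size (E \<union> K) c \<le> col_size E c + card K" by (rule col_size_Un_le[OF fin(1,2)])
  also have "col_size E c \<le> col_size (E \<union> K') c" using fin by (intro col_size_mono) auto
  finally show ?thesis using col unfolding near_max_def by simp
qed

lemma choose_le_choose: "a \<le> b \<Longrightarrow> a choose s \<le> b choose s" for a b s :: nat
proof (induction rule: dec_induct)
  case (step m)
  have "m choose s \<le> Suc m choose s" by (cases s) auto
  then show ?case using step by simp
qed simp

text \<open>
The two sides compare the number of \<open>s\<close>-sets of common neighbours of \<open>W\<close> inside a class: there are at
least \<open>m1 choose s\<close> of them in every bad graph, and after planting the stars between \<open>W\<close> and \<open>S\<close> at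
most \<open>r\<close> times \<open>m2 choose s\<close> sets \<open>S\<close> qualify for each graph.
\<close>

lemma prob_unbalanced:
  assumes p: "0 \<le> p" "p \<le> 1" and W: "W \<subseteq> {..<n}" "card W = k" and r: "r \<ge> 1"
    and m2: "(1 / real r + \<beta>) * real n < real m2 + 1"
  shows "bin_exp (all_pairs {..<n}) p (\<lambda>E. of_bool (rigid n r (2 * (k * s)) \<beta> E \<and>
      (\<exists>c i. near_max r 0 E c \<and> i \<in> {1..r} \<and> m1 \<le> card (common_nbrs n E W \<inter> colour_class n c i)))) * real (m1 choose s)
    \<le> p ^ (k * s) * (real r * real (m2 choose s))"
proof -
  define P where "P = all_pairs {..<n}"
  have finP: "finite P" unfolding P_def by (simp add: finite_all_pairs)
  have finW: "finite W" using W(1) by (rule finite_subset) simp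
  define \<S> where "\<S> = {S. S \<subseteq> {..<n} - W \<and> card S = s}"
  have fin\<S>: "finite \<S>" unfolding \<S>_def by (rule finite_subset[of _ "Pow {..<n}"]) auto
  define K where "K S = (\<Union>v\<in>S. joins W v)" for S
  have finS: "finite S" if "S \<in> \<S>" for S using that unfolding \<S>_def by (auto intro: finite_subset)
  have KP: "K S \<subseteq> P" if "S \<in> \<S>" for S
    using that joins_sub[OF W(1)] unfolding K_def \<S>_def P_def by blast
  have finK: "finite (K S)" if "S \<in> \<S>" for S using KP[OF that] finP by (rule finite_subset)
  have cK: "card (K S) = k * s" if "S \<in> \<S>" for S
  proof -
    have "S \<inter> W = {}" using that unfolding \<S>_def by auto
    then have "card (K S) = card S * card W" unfolding K_def by (rule card_UN_joins[OF finW finS[OF that]])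
    then show ?thesis using that W(2) unfolding \<S>_def by simp
  qed
  define D where "D = 2 * (k * s)"
  define g where "g S E \<longleftrightarrow> rigid n r D \<beta> E \<and> (\<exists>c i. near_max r 0 E c \<and> i \<in> {1..r} \<and> S \<subseteq> colour_class n c i)" for S E
  define bad where "bad E \<longleftrightarrow> rigid n r D \<beta> E \<and>
      (\<exists>c i. near_max r 0 E c \<and> i \<in> {1..r} \<and> m1 \<le> card (common_nbrs n E W \<inter> colour_class n c i))" for E
  have low: "real (m1 choose s) * of_bool (bad E) \<le> (\<Sum>S\<in>\<S>. of_bool (K S \<subseteq> E) * of_bool (g S E))"
    if E: "E \<subseteq> P" for E
  proof (cases "bad E")
    case True
    then obtain c i where rig: "rigid n r D \<beta> E" and c: "near_max r 0 E c" and i: "i \<in> {1..r}"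
      and m: "m1 \<le> card (common_nbrs n E W \<inter> colour_class n c i)" unfolding bad_def by blast
    define T where "T = common_nbrs n E W \<inter> colour_class n c i"
    define \<T> where "\<T> = {S. S \<subseteq> T \<and> card S = s}"
    have TW: "T \<inter> W = {}" using common_nbrs_disjoint[of E n W] E unfolding T_def P_def by auto
    have Tn: "T \<subseteq> {..<n}" unfolding T_def common_nbrs_def by auto
    have finT: "finite T" unfolding T_def by simp
    have sub: "\<T> \<subseteq> \<S>" unfolding \<T>_def \<S>_def using TW Tn by auto
    have in1: "K S \<subseteq> E \<and> g S E" if "S \<in> \<T>" for S
    proof
      show "K S \<subseteq> E" unfolding K_def
      proof (rule UN_least)
        fix v assume "v \<in> S"
        then have "v \<in> common_nbrs n E W" "v < n" using that unfolding \<T>_def T_def common_nbrs_def by auto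
        then show "joins W v \<subseteq> E" by (simp add: joins_iff)
      qed
      have "S \<subseteq> colour_class n c i" using that unfolding \<T>_def T_def by auto
      then show "g S E" unfolding g_def using rig c i by blast
    qed
    have "m1 choose s \<le> card T choose s" using m unfolding T_def by (rule choose_le_choose)
    also have "\<dots> = card \<T>" unfolding \<T>_def using n_subsets[OF finT] by simp
    finally have "real (m1 choose s) \<le> real (card \<T>)" by simp
    also have "\<dots> = (\<Sum>S\<in>\<T>. of_bool (K S \<subseteq> E) * of_bool (g S E))"
      using in1 by simp
    also have "\<dots> \<le> (\<Sum>S\<in>\<S>. of_bool (K S \<subseteq> E) * of_bool (g S E))"
      by (rule sum_mono2[OF fin\<S> sub]) simp
    finally show ?thesis using True by simp
  qed (simp add: sum_nonneg)
  have up: "(\<Sum>S\<in>\<S>. of_bool (g S (E \<union> K S))) \<le> real r * real (m2 choose s)" if E: "E \<subseteq> P" for E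
  proof (cases "\<exists>S\<in>\<S>. g S (E \<union> K S)")
    case False
    then show ?thesis by simp
  next
    case True
    then obtain S0 where S0: "S0 \<in> \<S>" "g S0 (E \<union> K S0)" by blast
    have finE: "finite E" using E finP by (rule finite_subset)
    \<comment> \<open>The rigid system of one qualifying set \<open>S0\<close> serves all the others.\<close>
    obtain Q where Q: "\<And>j. j \<in> {1..r} \<Longrightarrow> Q j \<subseteq> {..<n}"
        "\<And>j. j \<in> {1..r} \<Longrightarrow> real (card (Q j)) \<le> (1 / real r + \<beta>) * real n"
        "\<And>c i. near_max r D (E \<union> K S0) c \<Longrightarrow> i \<in> {1..r} \<Longrightarrow> \<exists>j\<in>{1..r}. colour_class n c i \<subseteq> Q j"
      using S0(2) unfolding g_def rigid_def by blast
    have finQ: "finite (Q j)" if "j \<in> {1..r}" for j using Q(1)[OF that] by (rule finite_subset) simp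
    have sub: "{S \<in> \<S>. g S (E \<union> K S)} \<subseteq> (\<Union>j\<in>{1..r}. {S. S \<subseteq> Q j \<and> card S = s})"
    proof
      fix S assume "S \<in> {S \<in> \<S>. g S (E \<union> K S)}"
      then have S: "S \<in> \<S>" "g S (E \<union> K S)" by auto
      then obtain c i where c: "near_max r 0 (E \<union> K S) c" and i: "i \<in> {1..r}" and Sc: "S \<subseteq> colour_class n c i"
        unfolding g_def by blast
      have "near_max r (card (K S) + card (K S0)) (E \<union> K S0) c"
        by (rule near_max_transfer[OF finE finK[OF S(1)] finK[OF S0(1)] r c])
      then have "near_max r D (E \<union> K S0) c" unfolding cK[OF S(1)] cK[OF S0(1)] D_def by (simp add: mult_2)
      then obtain j where "j \<in> {1..r}" "colour_class n c i \<subseteq> Q j" using Q(3) i by blast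
      then show "S \<in> (\<Union>j\<in>{1..r}. {S. S \<subseteq> Q j \<and> card S = s})" using Sc S(1) unfolding \<S>_def by blast
    qed
    have fins: "finite {S. S \<subseteq> Q j \<and> card S = s}" if "j \<in> {1..r}" for j
      by (rule finite_subset[of _ "Pow (Q j)"]) (use finQ[OF that] in auto)
    have "(\<Sum>S\<in>\<S>. of_bool (g S (E \<union> K S))) = real (card {S \<in> \<S>. g S (E \<union> K S)})"
      using fin\<S> by (simp add: of_bool_def sum.If_cases Int_def)
    also have "\<dots> \<le> real (card (\<Union>j\<in>{1..r}. {S. S \<subseteq> Q j \<and> card S = s}))"
      using sub fins by (intro of_nat_mono card_mono) auto
    also have "\<dots> \<le> real (\<Sum>j\<in>{1..r}. card {S. S \<subseteq> Q j \<and> card S = s})"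
      by (intro of_nat_mono card_UN_le) simp
    also have "\<dots> \<le> real (\<Sum>j\<in>{1..r}. m2 choose s)"
    proof (intro of_nat_mono sum_mono)
      fix j assume j: "j \<in> {1..r}"
      have "real (card (Q j)) < real m2 + 1" using Q(2)[OF j] m2 by linarith
      then have "card (Q j) \<le> m2" by linarith
      then show "card {S. S \<subseteq> Q j \<and> card S = s} \<le> m2 choose s"
        using n_subsets[OF finQ[OF j], of s] by (simp add: choose_le_choose)
    qed
    finally show ?thesis by simp
  qed
  have "real (m1 choose s) * bin_exp P p (\<lambda>E. of_bool (bad E))
     \<le> bin_exp P p (\<lambda>E. \<Sum>S\<in>\<S>. of_bool (K S \<subseteq> E) * of_bool (g S E))"
    unfolding bin_exp_cmult[symmetric] using low by (intro bin_exp_mono p)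
  also have "\<dots> = (\<Sum>S\<in>\<S>. bin_exp P p (\<lambda>E. of_bool (K S \<subseteq> E) * of_bool (g S E)))" by (rule bin_exp_sum)
  also have "\<dots> = (\<Sum>S\<in>\<S>. p ^ (k * s) * bin_exp P p (\<lambda>E. of_bool (g S (E \<union> K S))))"
    using bin_exp_plant[OF finP KP] cK by (intro sum.cong refl) simp
  also have "\<dots> = p ^ (k * s) * bin_exp P p (\<lambda>E. \<Sum>S\<in>\<S>. of_bool (g S (E \<union> K S)))"
    by (simp only: bin_exp_sum sum_distrib_left)
  also have "\<dots> \<le> p ^ (k * s) * bin_exp P p (\<lambda>E. real r * real (m2 choose s))"
    using up p by (intro mult_left_mono bin_exp_mono) auto
  also have "\<dots> = p ^ (k * s) * (real r * real (m2 choose s))" using finP by (simp only: bin_exp_const)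
  finally show ?thesis unfolding bad_def D_def P_def by (simp only: mult.commute)
qed

lemma binomial_ratio:
  assumes "s < m1"
  shows "real (m2 choose s) \<le> (real m2 / (real m1 - real s)) ^ s * real (m1 choose s)"
proof -
  have "(real m1 - real s) ^ s \<le> fact s * real (m1 choose s)"
  proof -
    have "real (m1 - s) ^ s = (\<Prod>i\<in>{0..<s}. real m1 - real s)" using assms by (simp add: of_nat_diff)
    also have "\<dots> \<le> (\<Prod>i\<in>{0..<s}. real m1 - real i)" using assms by (intro prod_mono) auto
    also have "\<dots> = fact s * (real m1 gchoose s)" by (simp add: gbinomial_mult_fact)
    finally show ?thesis using assms by (simp add: of_nat_diff binomial_gbinomial)
  qed
  moreover have "real (m2 choose s) * fact s \<le> real m2 ^ s"
    using binomial_fact_pow[of m2 s] by (metis of_nat_fact of_nat_le_iff of_nat_mult of_nat_power)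
  moreover have pos: "(real m1 - real s) ^ s > 0" using assms by simp
  ultimately have "real (m2 choose s) * fact s * (real m1 - real s) ^ s \<le> real m2 ^ s * (fact s * real (m1 choose s))"
    by (intro mult_mono) auto
  then have "fact s * (real (m2 choose s) * (real m1 - real s) ^ s) \<le> fact s * (real m2 ^ s * real (m1 choose s))"
    by (simp add: mult_ac)
  then have "real (m2 choose s) * (real m1 - real s) ^ s \<le> real m2 ^ s * real (m1 choose s)" by simp
  then show ?thesis using pos by (simp add: power_divide field_simps)
qed

text \<open>
The previous bound with the ratio of the binomial coefficients estimated. Since \<open>s\<close> is small compared with
\<open>n p\<^sup>k\<close>, that ratio is at most the \<open>s\<close>-th power of a constant below 1.
\<close>

lemma prob_unbalanced':
  assumes p: "0 \<le> p" "p \<le> 1" and W: "W \<subseteq> {..<n}" "card W = k" and r: "r \<ge> 1"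
    and e: "e > 0" and s: "real s \<le> e / 4 * (real n * p ^ k)" and np: "real n * p ^ k > 0"
  shows "bin_exp (all_pairs {..<n}) p (\<lambda>E. of_bool (rigid n r (2 * (k * s)) (e / 2) E \<and>
      (\<exists>c i. near_max r 0 E c \<and> i \<in> {1..r} \<and> (1 / real r + e) * (real n * p ^ k) < real (card (common_nbrs n E W \<inter> colour_class n c i)))))
    \<le> real r * ((1 / real r + e / 2) / (1 / real r + 3 / 4 * e)) ^ s"
proof -
  define y where "y = real n * p ^ k"
  have y: "y > 0" using np unfolding y_def .
  define m1 where "m1 = nat \<lfloor>(1 / real r + e) * y\<rfloor> + 1"
  define m2 where "m2 = nat \<lfloor>(1 / real r + e / 2) * real n\<rfloor>"
  have pos: "(1 / real r + e) * y \<ge> 0" "(1 / real r + e / 2) * real n \<ge> 0" using e y by auto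
  have m1: "(1 / real r + e) * y < real m1" unfolding m1_def using pos by linarith
  have m1': "m1 \<le> m" if "(1 / real r + e) * y < real m" for m unfolding m1_def using pos that by linarith
  have m2: "real m2 \<le> (1 / real r + e / 2) * real n" "(1 / real r + e / 2) * real n < real m2 + 1"
    unfolding m2_def using pos by linarith+
  have gap: "real m1 - real s \<ge> (1 / real r + 3 / 4 * e) * y"
    using m1 s unfolding y_def[symmetric] by (simp add: algebra_simps)
  have c0: "(1 / real r + 3 / 4 * e) * y > 0" using e y by (intro mult_pos_pos) (auto intro: add_nonneg_pos)
  have sm: "s < m1" using gap c0 by linarith
  define R where "R = bin_exp (all_pairs {..<n}) p (\<lambda>E. of_bool (rigid n r (2 * (k * s)) (e / 2) E \<and>
      (\<exists>c i. near_max r 0 E c \<and> i \<in> {1..r} \<and> m1 \<le> card (common_nbrs n E W \<inter> colour_class n c i))))"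
  have bpos: "real (m1 choose s) > 0" using sm by simp
  have "R * real (m1 choose s) \<le> p ^ (k * s) * (real r * real (m2 choose s))"
    unfolding R_def by (rule prob_unbalanced[OF p W r m2(2)])
  also have "\<dots> \<le> p ^ (k * s) * (real r * ((real m2 / (real m1 - real s)) ^ s * real (m1 choose s)))"
    using p by (intro mult_left_mono binomial_ratio sm) auto
  also have "\<dots> = real r * (p ^ k * real m2 / (real m1 - real s)) ^ s * real (m1 choose s)"
    by (simp add: power_mult power_mult_distrib power_divide)
  finally have "R \<le> real r * (p ^ k * real m2 / (real m1 - real s)) ^ s"
    using bpos by (simp only: mult_le_cancel_right_pos)
  also have "\<dots> \<le> real r * ((1 / real r + e / 2) / (1 / real r + 3 / 4 * e)) ^ s"
  proof (intro mult_left_mono power_mono)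
    have "p ^ k * real m2 / (real m1 - real s) \<le> p ^ k * ((1 / real r + e / 2) * real n) / ((1 / real r + 3 / 4 * e) * y)"
      using m2(1) p gap c0 by (intro frac_le mult_left_mono) (auto intro!: mult_nonneg_nonneg simp: e less_imp_le[OF e])
    also have "\<dots> = ((1 / real r + e / 2) * y) / ((1 / real r + 3 / 4 * e) * y)" unfolding y_def by (simp add: mult_ac)
    also have "\<dots> = (1 / real r + e / 2) / (1 / real r + 3 / 4 * e)" using y by simp
    finally show "p ^ k * real m2 / (real m1 - real s) \<le> (1 / real r + e / 2) / (1 / real r + 3 / 4 * e)" .
    show "0 \<le> p ^ k * real m2 / (real m1 - real s)" using p gap c0 by simp
  qed simp
  finally have "R \<le> real r * ((1 / real r + e / 2) / (1 / real r + 3 / 4 * e)) ^ s" .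
  moreover have "bin_exp (all_pairs {..<n}) p (\<lambda>E. of_bool (rigid n r (2 * (k * s)) (e / 2) E \<and>
      (\<exists>c i. near_max r 0 E c \<and> i \<in> {1..r} \<and> (1 / real r + e) * (real n * p ^ k) < real (card (common_nbrs n E W \<inter> colour_class n c i))))) \<le> R"
    unfolding R_def y_def[symmetric]
  proof (rule bin_exp_mono[OF p])
    fix E
    have "(\<exists>c i. near_max r 0 E c \<and> i \<in> {1..r} \<and> (1 / real r + e) * y < real (card (common_nbrs n E W \<inter> colour_class n c i)))
      \<Longrightarrow> (\<exists>c i. near_max r 0 E c \<and> i \<in> {1..r} \<and> m1 \<le> card (common_nbrs n E W \<inter> colour_class n c i))"
      using m1' by blast
    then show "of_bool (rigid n r (2 * (k * s)) (e / 2) E \<and>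
        (\<exists>c i. near_max r 0 E c \<and> i \<in> {1..r} \<and> (1 / real r + e) * y < real (card (common_nbrs n E W \<inter> colour_class n c i))))
      \<le> (of_bool (rigid n r (2 * (k * s)) (e / 2) E \<and>
        (\<exists>c i. near_max r 0 E c \<and> i \<in> {1..r} \<and> m1 \<le> card (common_nbrs n E W \<inter> colour_class n c i))) :: real)"
      by simp
  qed
  ultimately show ?thesis by linarith
qed


section \<open>Common neighbourhoods in maximum cuts\<close>

text \<open>
Every maximum cut arises from a colouring. The parts of the cut with indices outside \<open>{1..r}\<close> play
no role.
\<close>

lemma max_cut_colouring:
  assumes E: "E \<subseteq> all_pairs {..<n}" and V: "is_max_cut r {..<n} E V" and r: "r \<ge> 1"
  obtains c where "near_max r 0 E c" "\<And>i. i \<in> {1..r} \<Longrightarrow> V i = colour_class n c i"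
proof -
  have fin: "finite E" using E by (rule finite_edges)
  have dj: "disjoint_family_on V {1..r}" and un: "(\<Union>i\<in>{1..r}. V i) = {..<n}"
    and mx: "\<And>V'. is_cut r {..<n} V' \<Longrightarrow> cut_size r E V' \<le> cut_size r E V"
    using V unfolding is_max_cut_def is_cut_def by auto
  have size: "cut_size r E V' = col_size E c"
    if c: "c \<in> colourings r" and V': "\<And>i. i \<in> {1..r} \<Longrightarrow> V' i = colour_class n c i" for c V'
  proof -
    have eq: "(\<exists>i\<in>{1..r}. \<exists>j\<in>{1..r}. i \<noteq> j \<and> (\<exists>u\<in>V' i. \<exists>v\<in>V' j. e = {u, v})) \<longleftrightarrow> bichromatic c e"
      if eE: "e \<in> E" for e
    proof
      assume "\<exists>i\<in>{1..r}. \<exists>j\<in>{1..r}. i \<noteq> j \<and> (\<exists>u\<in>V' i. \<exists>v\<in>V' j. e = {u, v})"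
      then obtain i j u v where ij: "i \<in> {1..r}" "j \<in> {1..r}" "i \<noteq> j" "u \<in> V' i" "v \<in> V' j" and e: "e = {u, v}"
        by blast
      have "c u = i" "c v = j" using ij(4,5) unfolding V'[OF ij(1)] V'[OF ij(2)] colour_class_def by auto
      then show "bichromatic c e" unfolding e using ij(3) by simp
    next
      assume b: "bichromatic c e"
      have "e \<in> all_pairs {..<n}" using E eE by blast
      then obtain u v where e: "e = {u, v}" "u \<in> {..<n}" "v \<in> {..<n}" by (rule all_pairsE)
      have "c u \<in> {1..r}" "c v \<in> {1..r}" using c unfolding colourings_def by auto
      moreover have "c u \<noteq> c v" using b e by simp
      moreover have "u \<in> V' (c u)" "v \<in> V' (c v)"
        unfolding V'[OF calculation(1)] V'[OF calculation(2)] colour_class_def using e by auto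
      ultimately show "\<exists>i\<in>{1..r}. \<exists>j\<in>{1..r}. i \<noteq> j \<and> (\<exists>u\<in>V' i. \<exists>v\<in>V' j. e = {u, v})"
        using e(1) by blast
    qed
    show ?thesis unfolding cut_size_def col_size_def
      by (rule arg_cong[of _ _ card], rule Collect_cong, rule conj_cong[OF refl eq])
  qed
  define c where "c v = (if v < n then SOME i. i \<in> {1..r} \<and> v \<in> V i else 1)" for v
  have cv: "c v \<in> {1..r} \<and> v \<in> V (c v)" if "v < n" for v
  proof -
    have "\<exists>i. i \<in> {1..r} \<and> v \<in> V i" using un that by blast
    from someI_ex[OF this] show ?thesis unfolding c_def using that by simp
  qed
  have col: "c \<in> colourings r"
    unfolding colourings_def
  proof (intro CollectI allI)
    fix v show "c v \<in> {1..r}" using cv[of v] r by (cases "v < n") (auto simp: c_def)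
  qed
  have Vc: "V i = colour_class n c i" if i: "i \<in> {1..r}" for i
  proof
    show "V i \<subseteq> colour_class n c i"
    proof
      fix v assume v: "v \<in> V i"
      then have n: "v < n" using un i by blast
      have "c v = i"
      proof (rule ccontr)
        assume "c v \<noteq> i"
        then have "V (c v) \<inter> V i = {}" using dj cv[OF n] i unfolding disjoint_family_on_def by blast
        then show False using cv[OF n] v by blast
      qed
      then show "v \<in> colour_class n c i" using n unfolding colour_class_def by simp
    qed
    show "colour_class n c i \<subseteq> V i" using cv unfolding colour_class_def by auto
  qed
  obtain c' where c': "c' \<in> colourings r" "col_size E c' = maxcut r E" using maxcut_attained[OF fin r] .
  have "is_cut r {..<n} (colour_class n c')"
    using c'(1) unfolding is_cut_def disjoint_family_on_def colour_class_def colourings_def by auto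
  then have "cut_size r E (colour_class n c') \<le> cut_size r E V" by (rule mx)
  then have "maxcut r E \<le> col_size E c" using size[OF c'(1), of "colour_class n c'"] size[OF col Vc] c'(2) by simp
  then have "near_max r 0 E c" using col unfolding near_max_def by simp
  then show thesis using that Vc by blast
qed

text \<open>
Some class of some maximum cut contains too many common neighbours of \<open>W\<close>.
\<close>

definition top_heavy :: "nat \<Rightarrow> nat \<Rightarrow> nat \<Rightarrow> real \<Rightarrow> real \<Rightarrow> nat set set \<Rightarrow> nat set \<Rightarrow> bool" where
  "top_heavy n r k e p E W \<longleftrightarrow>
     (\<exists>c i. near_max r 0 E c \<and> i \<in> {1..r} \<and> (1 / real r + e) * (real n * p ^ k) < real (card (common_nbrs n E W \<inter> colour_class n c i)))"

text \<open>
If \<open>W\<close> has enough common neighbours and no part contains too many of them, then no part contains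
too few of them.
\<close>

lemma balanced_of_not_heavy:
  assumes E: "E \<subseteq> all_pairs {..<n}" and V: "is_max_cut r {..<n} E V" and r: "r \<ge> 1" and p: "0 \<le> p"
    and heavy: "\<not> top_heavy n r k e p E W" and many: "(1 - e') * real n * p ^ k \<le> real (card (common_nbrs n E W))"
    and i: "i \<in> {1..r}" and e: "e \<ge> 0" and le: "e \<le> \<epsilon>" "e' + real r * e \<le> \<epsilon>"
  shows "real (card {v \<in> V i. \<forall>w\<in>W. {v, w} \<in> E})
     \<in> {(1 / real r - \<epsilon>) * real n * p ^ k .. (1 / real r + \<epsilon>) * real n * p ^ k}"
proof -
  obtain c where c: "near_max r 0 E c" and Vc: "\<And>i. i \<in> {1..r} \<Longrightarrow> V i = colour_class n c i"
    using max_cut_colouring[OF E V r] by blast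
  define y where "y = real n * p ^ k"
  have y: "y \<ge> 0" unfolding y_def using p by simp
  define x where "x j = real (card (common_nbrs n E W \<inter> colour_class n c j))" for j
  have up: "x j \<le> (1 / real r + e) * y" if "j \<in> {1..r}" for j
    using heavy c that unfolding top_heavy_def x_def y_def by (meson not_le)
  have set: "{v \<in> V i. \<forall>w\<in>W. {v, w} \<in> E} = common_nbrs n E W \<inter> colour_class n c i"
    unfolding Vc[OF i] common_nbrs_def colour_class_def by auto
  have "common_nbrs n E W = (\<Union>j\<in>{1..r}. common_nbrs n E W \<inter> colour_class n c j)"
    using c unfolding near_max_def colourings_def common_nbrs_def colour_class_def by auto
  then have "card (common_nbrs n E W) \<le> (\<Sum>j\<in>{1..r}. card (common_nbrs n E W \<inter> colour_class n c j))"
    by (metis card_UN_le finite_atLeastAtMost)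
  then have "real (card (common_nbrs n E W)) \<le> (\<Sum>j\<in>{1..r}. x j)" unfolding x_def by (simp flip: of_nat_sum)
  also have "\<dots> = x i + (\<Sum>j\<in>{1..r} - {i}. x j)" using i by (simp add: sum.remove)
  also have "\<dots> \<le> x i + (\<Sum>j\<in>{1..r} - {i}. (1 / real r + e) * y)"
    using up by (intro add_left_mono sum_mono) auto
  also have "\<dots> = x i + (real r - 1) * ((1 / real r + e) * y)" using i r by (simp add: of_nat_diff)
  finally have "x i \<ge> (1 - e') * y - (real r - 1) * ((1 / real r + e) * y)"
    using many unfolding y_def by (simp add: mult.assoc)
  also have "(1 - e') * y - (real r - 1) * ((1 / real r + e) * y) = (1 / real r - e' - (real r - 1) * e) * y"
    using r by (simp add: field_simps)
  finally have 1: "x i \<ge> (1 / real r - e' - (real r - 1) * e) * y" .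
  have "1 / real r - \<epsilon> \<le> 1 / real r - e' - (real r - 1) * e" using le e by (simp add: algebra_simps)
  then have "(1 / real r - \<epsilon>) * y \<le> x i" using 1 y mult_right_mono by (smt (verit))
  moreover have "x i \<le> (1 / real r + \<epsilon>) * y" using up[OF i] le(1) y mult_right_mono by (smt (verit))
  ultimately show ?thesis unfolding set x_def y_def by (simp add: mult.assoc)
qed

lemma card_k_subsets: "card {W. W \<subseteq> {..<n} \<and> card W = k} \<le> n ^ k"
proof -
  have "card {W. W \<subseteq> {..<n} \<and> card W = k} = n choose k" using n_subsets[of "{..<n}" k] by simp
  also have "\<dots> \<le> n ^ k" by (cases "k \<le> n") (auto intro: binomial_le_pow simp: binomial_eq_0)
  finally show ?thesis .
qed

lemma power_mult_exp_ln:
  assumes "n > 0" shows "real n ^ k * exp (- ((real k + 1) * ln (real n))) = 1 / real n"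
proof -
  have "(real k + 1) * ln (real n) = real (k + 1) * ln (real n)" by simp
  also have "exp \<dots> = real n ^ (k + 1)"
    unfolding exp_of_nat_mult using assms by simp
  finally have "exp (- ((real k + 1) * ln (real n))) = inverse (real n ^ (k + 1))"
    by (simp only: exp_minus)
  then show ?thesis using assms by (simp add: field_simps)
qed

lemma prob_some_few_common_nbrs:
  assumes p: "0 \<le> p" "p \<le> 1" and e: "0 < e" "e \<le> 1" and n: "real k \<le> e / 4 * real n" "n > 0"
    and np: "16 / e\<^sup>2 * (real k + 1) * ln (real n) \<le> real n * p ^ k"
  shows "bin_exp (all_pairs {..<n}) p (\<lambda>E. of_bool (\<exists>W. W \<subseteq> {..<n} \<and> card W = k \<and>
      real (card (common_nbrs n E W)) < (1 - e) * real n * p ^ k)) \<le> 1 / real n"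
proof -
  define I where "I = {W. W \<subseteq> {..<n} \<and> card W = k}"
  have finI: "finite I" unfolding I_def by (rule finite_subset[of _ "Pow {..<n}"]) auto
  have "bin_exp (all_pairs {..<n}) p (\<lambda>E. of_bool (\<exists>W. W \<subseteq> {..<n} \<and> card W = k \<and>
      real (card (common_nbrs n E W)) < (1 - e) * real n * p ^ k))
    \<le> (\<Sum>W\<in>I. bin_exp (all_pairs {..<n}) p (\<lambda>E. of_bool (real (card (common_nbrs n E W)) < (1 - e) * real n * p ^ k)))"
    by (rule bin_exp_union_bound[OF p finI]) (auto simp: I_def)
  also have "\<dots> \<le> (\<Sum>W\<in>I. exp (- (e\<^sup>2 / 16) * (real n * p ^ k)))"
    by (intro sum_mono prob_few_common_nbrs[OF p _ _ e n(1)]) (auto simp: I_def)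
  also have "\<dots> = real (card I) * exp (- (e\<^sup>2 / 16) * (real n * p ^ k))" by simp
  also have "\<dots> \<le> real n ^ k * exp (- ((real k + 1) * ln (real n)))"
  proof (rule mult_mono)
    show "real (card I) \<le> real n ^ k" unfolding I_def using card_k_subsets[of n k] by (metis of_nat_le_iff of_nat_power)
    have "e\<^sup>2 / 16 * (16 / e\<^sup>2 * (real k + 1) * ln (real n)) \<le> e\<^sup>2 / 16 * (real n * p ^ k)"
      using np by (intro mult_left_mono) auto
    moreover have "e\<^sup>2 / 16 * (16 / e\<^sup>2 * (real k + 1) * ln (real n)) = (real k + 1) * ln (real n)"
      using e by simp
    ultimately have "(real k + 1) * ln (real n) \<le> e\<^sup>2 / 16 * (real n * p ^ k)" by linarith
    then show "exp (- (e\<^sup>2 / 16) * (real n * p ^ k)) \<le> exp (- ((real k + 1) * ln (real n)))" by simp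
  qed auto
  also have "\<dots> = 1 / real n"
    by (rule power_mult_exp_ln[OF n(2)])
  finally show ?thesis .
qed

lemma prob_top_heavy:
  assumes p: "0 \<le> p" "p \<le> 1" and r: "r \<ge> 1" and e: "e > 0" and n: "n > 0"
    and s: "real s \<le> e / 4 * (real n * p ^ k)" "(real k + 1) * ln (real n) \<le> real s * ln ((1 / real r + 3 / 4 * e) / (1 / real r + e / 2))"
    and np: "real n * p ^ k > 0"
  shows "bin_exp (all_pairs {..<n}) p (\<lambda>E. of_bool (rigid n r (2 * (k * s)) (e / 2) E \<and>
      (\<exists>W. W \<subseteq> {..<n} \<and> card W = k \<and> top_heavy n r k e p E W))) \<le> real r / real n"
proof -
  define I where "I = {W. W \<subseteq> {..<n} \<and> card W = k}"
  have finI: "finite I" unfolding I_def by (rule finite_subset[of _ "Pow {..<n}"]) auto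
  define \<rho> where "\<rho> = (1 / real r + e / 2) / (1 / real r + 3 / 4 * e)"
  have pos: "1 / real r + e / 2 > 0" "1 / real r + 3 / 4 * e > 0" using e by (auto intro: add_nonneg_pos)
  then have \<rho>: "\<rho> > 0" unfolding \<rho>_def by simp
  have ln\<rho>: "ln ((1 / real r + 3 / 4 * e) / (1 / real r + e / 2)) = - ln \<rho>"
    unfolding \<rho>_def using pos by (simp add: ln_div)
  have "bin_exp (all_pairs {..<n}) p (\<lambda>E. of_bool (rigid n r (2 * (k * s)) (e / 2) E \<and>
      (\<exists>W. W \<subseteq> {..<n} \<and> card W = k \<and> top_heavy n r k e p E W)))
    \<le> (\<Sum>W\<in>I. bin_exp (all_pairs {..<n}) p (\<lambda>E. of_bool (rigid n r (2 * (k * s)) (e / 2) E \<and> top_heavy n r k e p E W)))"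
    by (rule bin_exp_union_bound[OF p finI]) (auto simp: I_def)
  also have "\<dots> \<le> (\<Sum>W\<in>I. real r * \<rho> ^ s)"
    unfolding top_heavy_def \<rho>_def
    by (intro sum_mono prob_unbalanced'[OF p _ _ r e s(1) np]) (auto simp: I_def)
  also have "\<dots> = real (card I) * (real r * \<rho> ^ s)" by simp
  also have "\<dots> \<le> real n ^ k * (real r * exp (- ((real k + 1) * ln (real n))))"
  proof (intro mult_mono mult_left_mono)
    show "real (card I) \<le> real n ^ k" unfolding I_def using card_k_subsets[of n k] by (metis of_nat_le_iff of_nat_power)
    have "\<rho> ^ s = exp (real s * ln \<rho>)" using \<rho> by (simp add: exp_of_nat_mult)
    also have "\<dots> \<le> exp (- ((real k + 1) * ln (real n)))" using s(2) unfolding ln\<rho> by simp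
    finally show "\<rho> ^ s \<le> exp (- ((real k + 1) * ln (real n)))" .
  qed (use \<rho> in auto)
  also have "\<dots> = real r / real n"
    using power_mult_exp_ln[OF n, of k] by (simp only: mult.left_commute) simp
  finally show ?thesis .
qed

text \<open>
For \<open>p\<close> close to 1, balancedness of the maximum cuts suffices.
\<close>

lemma not_heavy_dense:
  assumes E: "E \<subseteq> all_pairs {..<n}" and J: "jumbled n p E" and r: "r \<ge> 1" and p: "0 \<le> p"
    and np: "real n * p \<ge> 1" and q: "23 * real r / sqrt (real n * p) \<le> e / 2"
    and pk: "1 / real r + e / 2 \<le> (1 / real r + e) * p ^ k"
  shows "\<not> top_heavy n r k e p E W"
proof
  assume "top_heavy n r k e p E W"
  then obtain c i where c: "near_max r 0 E c" and i: "i \<in> {1..r}"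
    and big: "(1 / real r + e) * (real n * p ^ k) < real (card (common_nbrs n E W \<inter> colour_class n c i))"
    unfolding top_heavy_def by blast
  have z: "real 0 \<le> sqrt (real n * p)" using np by simp
  have "card (common_nbrs n E W \<inter> colour_class n c i) \<le> card (colour_class n c i)" by (intro card_mono) auto
  then have "real (card (common_nbrs n E W \<inter> colour_class n c i)) \<le> real n / real r + 23 * real r * real n / sqrt (real n * p)"
    using near_max_balanced[OF E J c np z i] by linarith
  also have "\<dots> = real n / real r + (23 * real r / sqrt (real n * p)) * real n" by simp
  also have "\<dots> \<le> real n / real r + e / 2 * real n" using q by (intro add_left_mono mult_right_mono) auto
  also have "\<dots> = (1 / real r + e / 2) * real n" by (simp add: algebra_simps)
  also have "\<dots> \<le> (1 / real r + e) * p ^ k * real n" using pk by (intro mult_right_mono) auto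
  finally show False using big by (simp add: mult_ac)
qed


theorem theorem1p2:
  fixes k r :: nat and \<epsilon> :: real
  assumes "k \<ge> 1" and "r \<ge> 2" and "\<epsilon> > 0"
  shows "\<exists>C::real. C > 0 \<and>
    (\<forall>p :: nat \<Rightarrow> real.
      (\<forall>n. 0 \<le> p n \<and> p n \<le> 1) \<longrightarrow>
      (\<forall>\<^sub>F n in sequentially. p n \<ge> C * (ln (real n) / real n) powr (1 / real k)) \<longrightarrow>
      (\<lambda>n. ((ln (real n))\<^sup>2 / real n) / p n) \<longlonglongrightarrow> 0 \<longrightarrow>
      (\<lambda>n. measure_pmf.prob (gnp n (p n))
         {E. \<forall>V W i. is_max_cut r {..<n} E V \<longrightarrow> W \<subseteq> {..<n} \<longrightarrow> card W = k \<longrightarrow> i \<in> {1..r} \<longrightarrow>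
            real (card {v \<in> V i. \<forall>w\<in>W. {v, w} \<in> E})
              \<in> {(1 / real r - \<epsilon>) * real n * p n ^ k .. (1 / real r + \<epsilon>) * real n * p n ^ k}})
        \<longlonglongrightarrow> 1)"
proof -
  note k = assms(1) and r = assms(2)
  have r1: "r \<ge> 1" and rpos: "real r > 0" using r by auto
  define \<epsilon>' where "\<epsilon>' = min \<epsilon> 1"
  have \<epsilon>': "0 < \<epsilon>'" "\<epsilon>' \<le> \<epsilon>" "\<epsilon>' \<le> 1" unfolding \<epsilon>'_def using assms(3) by auto
  define e where "e = \<epsilon>' / (2 * real r)"
  define e2 where "e2 = \<epsilon>' / 2"
  have e: "0 < e" unfolding e_def using \<epsilon>' rpos by simp
  have re: "real r * e = \<epsilon>' / 2" unfolding e_def using rpos by simp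
  have "1 * e \<le> real r * e" using e r by (intro mult_right_mono) auto
  then have e\<epsilon>: "e \<le> \<epsilon>" using re \<epsilon>' by linarith
  have e2: "0 < e2" "e2 \<le> 1" "e2 + real r * e \<le> \<epsilon>" using \<epsilon>' re unfolding e2_def by auto
  have pos: "1 / real r + e / 2 > 0" "1 / real r + 3 / 4 * e > 0" "1 / real r + e > 0"
    using e by (auto intro: add_nonneg_pos)
  define R where "R = ln ((1 / real r + 3 / 4 * e) / (1 / real r + e / 2))"
  have R: "R > 0" unfolding R_def using pos e by (intro ln_gt_zero) (simp add: field_simps)
  \<comment> \<open>With \<open>s \<ge> A ln n\<close> the \<open>s\<close>-th power of the ratio is at most \<open>1 / n\<^bsup>k+1\<^esup>\<close>.\<close>
  define A where "A = (real k + 1) / R"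
  have A: "A > 0" "A * R = real k + 1" unfolding A_def using R by auto
  define C where "C = max 1 (max (4 / e * (A + 1)) (16 / e2\<^sup>2 * (real k + 1)))"
  have C: "C \<ge> 1" "C \<ge> 4 / e * (A + 1)" "C \<ge> 16 / e2\<^sup>2 * (real k + 1)" unfolding C_def by auto
  \<comment> \<open>For \<open>p > 1 - \<delta>\<close> the inequality of Bernoulli gives \<open>1/r + e/2 \<le> (1/r + e) p\<^sup>k\<close>.\<close>
  define \<delta> where "\<delta> = e / 2 / (1 / real r + e) / real k"
  have \<delta>: "\<delta> > 0" unfolding \<delta>_def using e pos k by (intro divide_pos_pos) auto
  have k\<delta>: "real k * \<delta> * (1 / real r + e) = e / 2"
  proof -
    have "real k * (e / 2 / z / real k) * z = e / 2" if "z > 0" for z using that k by simp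
    then show ?thesis unfolding \<delta>_def using pos(3) by blast
  qed
  have \<delta>1: "\<delta> \<le> 1"
  proof -
    have "e / 2 / (1 / real r + e) \<le> 1" using e pos(3) by (simp add: divide_le_eq add.commute add_increasing2)
    moreover have "\<delta> \<le> e / 2 / (1 / real r + e) / 1" unfolding \<delta>_def
      using k e pos by (intro divide_left_mono) auto
    ultimately show ?thesis by simp
  qed
  show ?thesis
  proof (intro exI[of _ C] conjI allI impI)
    show "C > 0" using C(1) by simp
    fix p :: "nat \<Rightarrow> real"
    assume p01: "\<forall>n. 0 \<le> p n \<and> p n \<le> 1"
      and pC: "\<forall>\<^sub>F n in sequentially. p n \<ge> C * (ln (real n) / real n) powr (1 / real k)"
      and lim: "(\<lambda>n. ((ln (real n))\<^sup>2 / real n) / p n) \<longlonglongrightarrow> 0"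
    define G where "G n = {E. \<forall>V W i. is_max_cut r {..<n} E V \<longrightarrow> W \<subseteq> {..<n} \<longrightarrow> card W = k \<longrightarrow> i \<in> {1..r} \<longrightarrow>
            real (card {v \<in> V i. \<forall>w\<in>W. {v, w} \<in> E})
              \<in> {(1 / real r - \<epsilon>) * real n * p n ^ k .. (1 / real r + \<epsilon>) * real n * p n ^ k}}" for n
    have main: "\<forall>\<^sub>F n in sequentially. bin_exp (all_pairs {..<n}) (p n) (\<lambda>E. of_bool (E \<notin> G n)) \<le> \<eta>" if \<eta>: "\<eta> > 0" for \<eta>
    proof -
      obtain \<Lambda> \<kappa> where \<kappa>: "\<kappa> > 0" and rig: "\<And>n p D. 0 \<le> p \<Longrightarrow> p \<le> 1 - \<delta> \<Longrightarrow> \<Lambda> \<le> sqrt (real n * p) \<Longrightarrow> \<Lambda> \<le> real n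
          \<Longrightarrow> real D + 1 \<le> \<kappa> * sqrt (real n * p)
          \<Longrightarrow> bin_exp (all_pairs {..<n}) p (\<lambda>E. of_bool (\<not> rigid n r D (e / 2) E)) \<le> \<eta> / 2"
      proof -
        have "e / 2 > 0" "\<eta> / 2 > 0" using e \<eta> by auto
        then show thesis using prob_not_rigid[OF r, of "e / 2" \<delta> "\<eta> / 2"] \<delta> that by blast
      qed
      \<comment> \<open>The hypothesis \<open>(ln n)\<^sup>2 / (n p) < 1 / b\<^sup>2\<close> turns into \<open>sqrt (n p) \<ge> b ln n\<close>, which exceeds every bound needed below.\<close>
      define b where "b = max (max 1 \<Lambda>) (max (23 * real r / (e / 2)) ((2 * real k * (A + 1) + 1) / \<kappa>))"
      have b: "b \<ge> 1" "b \<ge> \<Lambda>" "b \<ge> 23 * real r / (e / 2)" "b \<ge> (2 * real k * (A + 1) + 1) / \<kappa>"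
        unfolding b_def by auto
      have ev1: "\<forall>\<^sub>F n in sequentially. ((ln (real n))\<^sup>2 / real n) / p n < 1 / b\<^sup>2"
        using lim b(1) by (intro order_tendstoD(2)[OF lim]) simp
      have ev2: "\<forall>\<^sub>F n in sequentially. real n \<ge> max (max 3 \<Lambda>) (max (2 * (real r + 1) / \<eta>) (4 / e2 * real k))"
        using filterlim_real_sequentially unfolding filterlim_at_top by blast
      from pC ev1 ev2 show ?thesis
      proof eventually_elim
        case (elim n)
        have n3: "real n \<ge> 3" and nL: "real n \<ge> \<Lambda>" and n\<eta>: "real n \<ge> 2 * (real r + 1) / \<eta>"
          and nk: "real n \<ge> 4 / e2 * real k" using elim(3) by auto
        have n: "n > 0" and rn: "real n > 0" using n3 by auto
        have "exp 1 \<le> real n" using exp_le n3 by linarith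
        then have ln1: "ln (real n) \<ge> 1" using rn by (simp add: ln_ge_iff)
        define y where "y = real n * p n ^ k"
        define q where "q = sqrt (real n * p n)"
        have x0: "ln (real n) / real n > 0" using ln1 rn by (intro divide_pos_pos) linarith+
        have "(ln (real n) / real n) powr (1 / real k) > 0" using x0 by (metis powr_gt_zero less_irrefl)
        then have "C * (ln (real n) / real n) powr (1 / real k) > 0" using C(1) by (intro mult_pos_pos) linarith+
        then have pn: "p n > 0" using elim(1) by linarith
        have p0: "0 \<le> p n" and p1: "p n \<le> 1" using p01 by auto
        have y: "y \<ge> C * ln (real n)"
        proof -
          have "C * (ln (real n) / real n) \<le> C ^ k * (ln (real n) / real n)"
            using C(1) k x0 by (intro mult_right_mono self_le_power) auto
          also have "\<dots> = (C * (ln (real n) / real n) powr (1 / real k)) ^ k"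
          proof -
            define x where "x = ln (real n) / real n"
            have x: "x > 0" using x0 unfolding x_def .
            then have "x powr (1 / real k) > 0" by (metis powr_gt_zero less_irrefl)
            then have "(x powr (1 / real k)) ^ k = (x powr (1 / real k)) powr real k" by (rule powr_realpow[symmetric])
            also have "\<dots> = x" using x k by (simp add: powr_powr)
            finally show ?thesis unfolding x_def[symmetric] by (simp add: power_mult_distrib)
          qed
          also have "\<dots> \<le> p n ^ k" using elim(1) C(1) by (intro power_mono) auto
          finally have "real n * (C * (ln (real n) / real n)) \<le> y"
            unfolding y_def by (intro mult_left_mono) auto
          then show ?thesis using rn by simp
        qed
        have ypos: "y > 0" unfolding y_def using rn pn by simp
        have np0: "real n * p n > 0" using rn pn by simp
        have q0: "q \<ge> b * ln (real n)"
        proof -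
          have "(ln (real n))\<^sup>2 \<le> 1 / b\<^sup>2 * (real n * p n)"
            using elim(2) rn pn by (simp add: field_simps)
          then have "(b * ln (real n))\<^sup>2 \<le> real n * p n"
            using b(1) by (simp add: power_mult_distrib field_simps)
          then show ?thesis unfolding q_def by (rule real_le_rsqrt)
        qed
        have "b * 1 \<le> b * ln (real n)" using b(1) ln1 by (intro mult_left_mono) auto
        then have qb: "q \<ge> b" using q0 by linarith
        have np1: "real n * p n \<ge> 1"
        proof -
          have "1 \<le> q" using qb b(1) by linarith
          then show ?thesis unfolding q_def by simp
        qed
        define s where "s = nat \<lceil>A * ln (real n)\<rceil>"
        have "A * ln (real n) > 0" using A(1) ln1 by (intro mult_pos_pos) linarith+
        then have s: "real s \<ge> A * ln (real n)" "real s \<le> A * ln (real n) + 1" unfolding s_def by linarith+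
        have sA: "real s \<le> (A + 1) * ln (real n)" using s(2) ln1 by (simp add: algebra_simps)
        define low where "low E \<longleftrightarrow> (\<exists>W. W \<subseteq> {..<n} \<and> card W = k \<and> real (card (common_nbrs n E W)) < (1 - e2) * real n * p n ^ k)" for E
        define hv where "hv E \<longleftrightarrow> (\<exists>W. W \<subseteq> {..<n} \<and> card W = k \<and> top_heavy n r k e (p n) E W)" for E
        define P where "P = all_pairs {..<n}"
        have good: "E \<in> G n" if E: "E \<subseteq> P" and nl: "\<not> low E" and nh: "\<not> hv E" for E
          unfolding G_def
        proof (intro CollectI allI impI)
          fix V W i
          assume V: "is_max_cut r {..<n} E V" and W: "W \<subseteq> {..<n}" "card W = k" and i: "i \<in> {1..r}"
          have h: "\<not> top_heavy n r k e (p n) E W" using nh W unfolding hv_def by blast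
          have "\<not> real (card (common_nbrs n E W)) < (1 - e2) * real n * p n ^ k" using nl W unfolding low_def by blast
          then have m: "(1 - e2) * real n * p n ^ k \<le> real (card (common_nbrs n E W))" by linarith
          show "real (card {v \<in> V i. \<forall>w\<in>W. {v, w} \<in> E})
              \<in> {(1 / real r - \<epsilon>) * real n * p n ^ k .. (1 / real r + \<epsilon>) * real n * p n ^ k}"
            by (rule balanced_of_not_heavy[OF _ V r1 p0 h m i _ e\<epsilon> e2(3)]) (use E e in \<open>auto simp: P_def\<close>)
        qed
        have Plow: "bin_exp P (p n) (\<lambda>E. of_bool (low E)) \<le> 1 / real n"
          unfolding P_def low_def
        proof (rule prob_some_few_common_nbrs[OF p0 p1 e2(1,2) _ n])
          show "real k \<le> e2 / 4 * real n" using nk e2 by (simp add: field_simps)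
          have "16 / e2\<^sup>2 * (real k + 1) * ln (real n) \<le> C * ln (real n)"
            using C(3) ln1 by (intro mult_right_mono) auto
          then show "16 / e2\<^sup>2 * (real k + 1) * ln (real n) \<le> real n * p n ^ k" using y unfolding y_def by linarith
        qed
        have fin: "(real r + 1) / real n \<le> \<eta> / 2" using n\<eta> \<eta> rn by (simp add: field_simps)
        show "bin_exp (all_pairs {..<n}) (p n) (\<lambda>E. of_bool (E \<notin> G n)) \<le> \<eta>"
        proof (cases "p n \<le> 1 - \<delta>")
          case True
          define rgd where "rgd E = rigid n r (2 * (k * s)) (e / 2) E" for E
          have D: "real (2 * (k * s)) + 1 \<le> \<kappa> * q"
          proof -
            have "real (2 * (k * s)) + 1 \<le> 2 * real k * ((A + 1) * ln (real n)) + ln (real n)"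
            proof -
              have "2 * real k * real s \<le> 2 * real k * ((A + 1) * ln (real n))"
                using sA by (intro mult_left_mono) auto
              then show ?thesis using ln1 by simp
            qed
            also have "\<dots> = (2 * real k * (A + 1) + 1) * ln (real n)" by (simp add: algebra_simps)
            also have "\<dots> \<le> (\<kappa> * b) * ln (real n)"
              using b(4) \<kappa> ln1 by (intro mult_right_mono) (auto simp: field_simps)
            also have "\<dots> \<le> \<kappa> * q" using q0 \<kappa> by (simp add: mult.assoc)
            finally show ?thesis .
          qed
          have 1: "bin_exp P (p n) (\<lambda>E. of_bool (\<not> rgd E)) \<le> \<eta> / 2"
            unfolding rgd_def P_def using D nL qb b(2) unfolding q_def by (intro rig p0 True) auto
          have 2: "bin_exp P (p n) (\<lambda>E. of_bool (rgd E \<and> hv E)) \<le> real r / real n"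
            unfolding rgd_def hv_def P_def
          proof (rule prob_top_heavy[OF p0 p1 r1 e n])
            have "(A + 1) * ln (real n) = e / 4 * (4 / e * (A + 1)) * ln (real n)" using e by simp
            also have "\<dots> \<le> e / 4 * C * ln (real n)" using C(2) e ln1 by (intro mult_right_mono mult_left_mono) auto
            also have "\<dots> \<le> e / 4 * y" using y e by (simp add: mult.assoc)
            finally show "real s \<le> e / 4 * (real n * p n ^ k)" using sA unfolding y_def by linarith
            have "(real k + 1) * ln (real n) = A * ln (real n) * R" using A(2) by (simp add: mult_ac)
            also have "\<dots> \<le> real s * R" using s(1) R by (intro mult_right_mono) auto
            finally show "(real k + 1) * ln (real n) \<le> real s * ln ((1 / real r + 3 / 4 * e) / (1 / real r + e / 2))"
              unfolding R_def .
            show "real n * p n ^ k > 0" using ypos unfolding y_def .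
          qed
          have "bin_exp P (p n) (\<lambda>E. of_bool (E \<notin> G n))
             \<le> bin_exp P (p n) (\<lambda>E. of_bool (low E) + (of_bool (\<not> rgd E) + of_bool (rgd E \<and> hv E)))"
          proof (rule bin_exp_mono[OF p0 p1])
            fix E assume "E \<subseteq> P"
            then show "of_bool (E \<notin> G n) \<le> (of_bool (low E) + (of_bool (\<not> rgd E) + of_bool (rgd E \<and> hv E)) :: real)"
              using good[of E] by (cases "low E"; cases "hv E"; cases "rgd E"; simp)
          qed
          also have "\<dots> \<le> 1 / real n + (\<eta> / 2 + real r / real n)"
            unfolding bin_exp_add using Plow 1 2 by linarith
          also have "\<dots> = \<eta> / 2 + (real r + 1) / real n" by (simp add: add_divide_distrib)
          finally show ?thesis using fin unfolding P_def by linarith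
        next
          case False
          have pk: "1 / real r + e / 2 \<le> (1 / real r + e) * p n ^ k"
          proof -
            have "1 - real k * \<delta> \<le> (1 - \<delta>) ^ k" using Bernoulli_inequality[of "- \<delta>" k] \<delta>1 by simp
            also have "\<dots> \<le> p n ^ k" using False \<delta>1 by (intro power_mono) auto
            finally have "(1 / real r + e) * (1 - real k * \<delta>) \<le> (1 / real r + e) * p n ^ k"
              using pos(3) by (intro mult_left_mono) auto
            moreover have "(1 / real r + e) * (1 - real k * \<delta>) = 1 / real r + e - real k * \<delta> * (1 / real r + e)"
              by (simp add: algebra_simps)
            ultimately show ?thesis using k\<delta> by linarith
          qed
          have qe: "23 * real r / sqrt (real n * p n) \<le> e / 2"
          proof -
            have "23 * real r / (e / 2) \<le> q" using b(3) qb by linarith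
            moreover have "q > 0" using qb b(1) by linarith
            ultimately show ?thesis unfolding q_def[symmetric] using e by (simp add: field_simps)
          qed
          have "bin_exp P (p n) (\<lambda>E. of_bool (E \<notin> G n))
             \<le> bin_exp P (p n) (\<lambda>E. of_bool (low E) + of_bool (\<not> jumbled n (p n) E))"
          proof (rule bin_exp_mono[OF p0 p1])
            fix E assume E: "E \<subseteq> P"
            have "\<not> hv E" if "jumbled n (p n) E"
              using not_heavy_dense[OF _ that r1 p0 np1 qe pk] E unfolding hv_def P_def by blast
            then show "of_bool (E \<notin> G n) \<le> (of_bool (low E) + of_bool (\<not> jumbled n (p n) E) :: real)"
              using good[OF E] by (cases "low E"; cases "jumbled n (p n) E"; simp)
          qed
          also have "\<dots> \<le> 1 / real n + 1 / real n"
            unfolding bin_exp_add using Plow prob_not_jumbled[OF p0 p1 np1] unfolding P_def by linarith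
          also have "\<dots> \<le> (real r + 1) / real n"
            using r rn by (simp add: divide_right_mono flip: add_divide_distrib)
          finally show ?thesis using fin \<eta> unfolding P_def by linarith
        qed
      qed
    qed
    have prob: "measure_pmf.prob (gnp n (p n)) (G n) = 1 - bin_exp (all_pairs {..<n}) (p n) (\<lambda>E. of_bool (E \<notin> G n))" for n
    proof -
      have "measure_pmf.prob (gnp n (p n)) (G n) = bin_exp (all_pairs {..<n}) (p n) (indicator (G n))"
        using p01 by (intro prob_gnp) auto
      also have "\<dots> = bin_exp (all_pairs {..<n}) (p n) (\<lambda>E. 1 - of_bool (E \<notin> G n))"
        by (rule bin_exp_cong) (simp add: indicator_def)
      also have "\<dots> = 1 - bin_exp (all_pairs {..<n}) (p n) (\<lambda>E. of_bool (E \<notin> G n))"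
        by (simp add: bin_exp_diff bin_exp_const finite_all_pairs)
      finally show ?thesis .
    qed
    have "(\<lambda>n. measure_pmf.prob (gnp n (p n)) (G n)) \<longlonglongrightarrow> 1"
    proof (rule tendstoI)
      fix \<eta> :: real assume \<eta>: "\<eta> > 0"
      from main[of "\<eta> / 2"] \<eta> have "\<forall>\<^sub>F n in sequentially. bin_exp (all_pairs {..<n}) (p n) (\<lambda>E. of_bool (E \<notin> G n)) \<le> \<eta> / 2" by simp
      then show "\<forall>\<^sub>F n in sequentially. dist (measure_pmf.prob (gnp n (p n)) (G n)) 1 < \<eta>"
      proof eventually_elim
        case (elim n)
        have "measure_pmf.prob (gnp n (p n)) (G n) \<le> 1" by simp
        then show ?case using elim prob[of n] \<eta> unfolding dist_real_def by linarith
      qed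
    qed
    then show "(\<lambda>n. measure_pmf.prob (gnp n (p n))
         {E. \<forall>V W i. is_max_cut r {..<n} E V \<longrightarrow> W \<subseteq> {..<n} \<longrightarrow> card W = k \<longrightarrow> i \<in> {1..r} \<longrightarrow>
            real (card {v \<in> V i. \<forall>w\<in>W. {v, w} \<in> E})
              \<in> {(1 / real r - \<epsilon>) * real n * p n ^ k .. (1 / real r + \<epsilon>) * real n * p n ^ k}})
        \<longlonglongrightarrow> 1"
      unfolding G_def .
  qed
qed

end
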